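(* Let $n=1$. (1) For every $\alpha\in(0,\infty)$ there exists a constant $a_\alpha>0$, depending only on $\alpha$, such that the following holds. Let $f\ge 0$ be a function on $\mathbb{R}$ with $\sqrt f\in W^{1,2}(\mathbb{R},d\gamma)$, which is normalized and centered in $L^1(\mathbb{R},d\gamma)$, i.e. $\int_{\mathbb{R}} f\,d\gamma=1$ and $\int_{\mathbb{R}} x f\,d\gamma=0$, and which satisfies $$m_2(f\,d\gamma):=\int_{\mathbb{R}}|x|^2 f\,d\gamma\le\alpha .$$ Then $$\|f-1\|_{W^{1,1}(\mathbb{R},d\gamma)}\le a_\alpha\left(\delta(f)^{1/4}+\delta(f)^{3/4}\right).$$ (2) For every $\alpha\in(0,\infty)$ there exists a constant $\overline a_\alpha>0$, depending only on $\alpha$, such that the following holds. Let $u\ge 0$ be a function in $W^{1,2}(\mathbb{R},e^{-\pi|x|^2}dx)$ which is normalized and centered in $L^2(\mathbb{R},e^{-\pi|x|^2}dx)$, i.e. $\int_{\mathbb{R}} |u|^2e^{-\pi|x|^2}dx=1$ and $\int_{\mathbb{R}} x|u|^2e^{-\pi|x|^2}dx=0$, and which satisfies $$\int_{\mathbb{R}}|x|^2|u(x)|^2e^{-\pi|x|^2}dx\le\alpha .$$ Then $$\|u-1\|_{W^{1,1}(\mathbb{R},e^{-\pi|x|^2}dx)}\le\overline a_\alpha\left(\delta_*(u)^{1/4}+\delta_*(u)\right).$$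
   Context: $d\gamma=(2\pi)^{-n/2}e^{-|x|^2/2}dx$ is the standard Gaussian measure on $\mathbb{R}^n$ (here $n=1$). The logarithmic Sobolev deficit of $f$ is $$\delta(f)=\frac12\int\frac{|\nabla f|^2}{f}\,d\gamma-\int f\log f\,d\gamma ,$$ which is nonnegative (with $0\log 0=0$, and $|\nabla f|^2/f=4|\nabla\sqrt f|^2$). The quantity $\delta_*(u)$ is defined by $$\pi\,\delta_*(u)=\int|\nabla u|^2e^{-\pi|x|^2}dx-\pi\int|u|^2\ln|u|^2\,e^{-\pi|x|^2}dx .$$ For a measure $\mu$ on $\mathbb{R}^n$, $\|g\|_{W^{1,1}(\mathbb{R}^n,\mu)}=\int|g|\,d\mu+\int|\nabla g|\,d\mu$, with weak gradient and Euclidean norm. $W^{1,2}(\mathbb{R}^n,\mu)$ is the Sobolev space of functions $g$ with $\int (|g|^2+|\nabla g|^2)\,d\mu<\infty$. *)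

theory Defs
  imports "HOL-Probability.Distributions"
begin

text \<open>
  All measures have the Lebesgue sets as measurable sets, so that every Lebesgue measurable
  function is admitted, not only the Borel ones.
\<close>

definition gauss :: "real measure" where
  "gauss = density lebesgue (\<lambda>x. ennreal (std_normal_density x))"

definition gauss_pi :: "real measure" where
  "gauss_pi = density lebesgue (\<lambda>x. ennreal (exp (- pi * x\<^sup>2)))"

definition test_function :: "(real \<Rightarrow> real) \<Rightarrow> bool" where
  "test_function \<phi> \<longleftrightarrow>
     (\<forall>k x. (deriv ^^ k) \<phi> differentiable (at x)) \<and> compact (closure {x. \<phi> x \<noteq> 0})"

definition locally_integrable :: "(real \<Rightarrow> real) \<Rightarrow> bool" where
  "locally_integrable g \<longleftrightarrow> (\<forall>K. compact K \<longrightarrow> g absolutely_integrable_on K)"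

definition has_weak_deriv :: "(real \<Rightarrow> real) \<Rightarrow> (real \<Rightarrow> real) \<Rightarrow> bool" where
  "has_weak_deriv g h \<longleftrightarrow> locally_integrable g \<and> locally_integrable h \<and>
     (\<forall>\<phi>. test_function \<phi> \<longrightarrow>
        (\<integral>x. g x * deriv \<phi> x \<partial>lebesgue) = - (\<integral>x. h x * \<phi> x \<partial>lebesgue))"

text \<open>
  A weak derivative is determined up to null sets; the choice below is unspecified if there is none,
  so statements about it should come with membership in a Sobolev space.
\<close>

definition weak_deriv :: "(real \<Rightarrow> real) \<Rightarrow> real \<Rightarrow> real" where
  "weak_deriv g = (SOME h. has_weak_deriv g h)"

text \<open>\<open>sobolev p \<mu>\<close> is $W^{1,p}(\mu)$.\<close>

definition sobolev :: "nat \<Rightarrow> real measure \<Rightarrow> (real \<Rightarrow> real) set" where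
  "sobolev p \<mu> = {g. \<exists>h. has_weak_deriv g h \<and>
     integrable \<mu> (\<lambda>x. \<bar>g x\<bar> ^ p) \<and> integrable \<mu> (\<lambda>x. \<bar>h x\<bar> ^ p)}"

definition W11_norm :: "real measure \<Rightarrow> (real \<Rightarrow> real) \<Rightarrow> real" where
  "W11_norm \<mu> g = (\<integral>x. \<bar>g x\<bar> \<partial>\<mu>) + (\<integral>x. \<bar>weak_deriv g x\<bar> \<partial>\<mu>)"

text \<open>
  The conventions \<open>y / 0 = 0\<close> and \<open>0 * ln 0 = 0\<close> are the intended ones: where \<open>f\<close> vanishes, so does
  its weak derivative almost everywhere, and $|f'|^2/f = 4|(\sqrt f)'|^2$ holds almost everywhere for
  $f \ge 0$ with $\sqrt f$ in $W^{1,2}$ of the Gaussian measure. For such \<open>f\<close> both integrals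
  are finite, by the logarithmic Sobolev inequality.
\<close>

definition deficit :: "(real \<Rightarrow> real) \<Rightarrow> real" where
  "deficit f = 1/2 * (\<integral>x. \<bar>weak_deriv f x\<bar>\<^sup>2 / f x \<partial>gauss) - (\<integral>x. f x * ln (f x) \<partial>gauss)"

definition deficit_star :: "(real \<Rightarrow> real) \<Rightarrow> real" where
  "deficit_star u = 1/pi * ((\<integral>x. \<bar>weak_deriv u x\<bar>\<^sup>2 \<partial>gauss_pi)
     - pi * (\<integral>x. \<bar>u x\<bar>\<^sup>2 * ln (\<bar>u x\<bar>\<^sup>2) \<partial>gauss_pi))"

end

theory Submission
  imports Defs
begin

text \<open>
  Let \<open>\<phi>\<close> be the Gaussian density, \<open>F = \<phi> f\<close> the density of \<open>f d\<gamma>\<close> and \<open>G\<close> its distribution function. On the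
  line the monotone map pushing \<open>f d\<gamma>\<close> to \<open>\<gamma>\<close> is explicit, \<open>T = Phi\<^sup>-\<^sup>1 \<circ> G\<close>, with \<open>T' = F / \<phi>(T)\<close>. Write
  \<open>\<theta> x = T x - x\<close> and \<open>u = sqrt f\<close>. Taking logarithms in \<open>\<phi>(T) T' = F\<close> and using \<open>ln T' \<le> T' - 1\<close> one finds
  pointwise
    \<open>2 u'\<^sup>2 - f ln f \<ge> (2 u' + \<theta> u)\<^sup>2 / 2 - (F \<theta>)' / \<phi>\<close>,
  and \<open>F \<theta>\<close> vanishes at both ends, so that
    \<open>\<integral> (2 u' + \<theta> u)\<^sup>2 d\<gamma> \<le> 2 \<delta>(f)\<close> (lemma \<open>deficit_bound\<close>).
  By Cauchy-Schwarz \<open>\<integral> \<bar>f'\<bar> d\<gamma> \<le> sqrt (2 \<delta>) + \<integral> \<bar>\<theta>\<bar> f d\<gamma>\<close>, and everything rests on the transport cost on the right.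

  This cost is of order \<open>sqrt \<delta>\<close> (lemma \<open>transport_cost_bound\<close>), because the same inequality controls \<open>T'\<close>.
  The function \<open>F - \<phi>(T)\<close> has the derivative \<open>\<phi> u (2 u' + \<theta> u)\<close>, hence is at most \<open>sqrt (2 \<delta>)\<close> times the root
  of the mass to the left or to the right of the point; after division by \<open>\<phi>(T)\<close> this says
  \<open>\<bar>T' - 1\<bar> \<le> 2 sqrt (\<pi> \<delta>) exp (T\<^sup>2 / 4)\<close>. So \<open>T\<close> is close to a translation as long as \<open>\<bar>T\<bar> \<le> R\<close>, where
  \<open>exp (- R\<^sup>2 / 4)\<close> is of order \<open>sqrt \<delta>\<close>. What lies outside has Gaussian mass \<open>exp (- R\<^sup>2 / 2)\<close> and is handled
  by Cauchy-Schwarz and the bound on the second moment. The translation itself is small because both measures are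
  centered.

  For the first part an \<open>L\<^sup>1\<close> Poincare inequality for \<open>\<gamma>\<close> bounds \<open>\<integral> \<bar>f - 1\<bar> d\<gamma>\<close> by \<open>\<integral> \<bar>f'\<bar> d\<gamma>\<close>, and
  \<open>sqrt \<delta> \<le> \<delta>\<^bsup>1/4\<^esup> + \<delta>\<^bsup>3/4\<^esup>\<close>. The second part is about \<open>u = sqrt f\<close> after the dilation by \<open>sqrt (2 \<pi>)\<close>. Now
  \<open>\<integral> \<bar>u'\<bar> d\<gamma>\<close> leads to \<open>\<integral> \<bar>\<theta>\<bar> u d\<gamma>\<close>, with \<open>u\<close> in place of \<open>f = u\<^sup>2\<close>. Splitting \<open>u = u\<^sup>2 + u (1 - u)\<close>
  leaves, by Cauchy-Schwarz, a multiple of the root of \<open>\<integral> (1 - u)\<^sup>2 d\<gamma> \<le> \<integral> \<bar>1 - f\<bar> d\<gamma>\<close>, which is of order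
  \<open>\<delta>\<^bsup>1/4\<^esup>\<close>.

  For weakly differentiable functions this calculus is carried out in integrated form: on the line such a function is almost
  everywhere a primitive of its weak derivative (lemma \<open>has_weak_deriv_imp_primitive\<close>), and primitives obey
  the product rule (lemma \<open>primitive_on_mult\<close>).
\<close>

section \<open>Primitives of integrable functions\<close>

text \<open>
  The body says that \<open>f\<close> is absolutely continuous on \<open>{a..b}\<close> with density \<open>f'\<close>, in the integrated form that
  avoids differentiability almost everywhere.
\<close>

definition primitive_on :: "real \<Rightarrow> real \<Rightarrow> (real \<Rightarrow> real) \<Rightarrow> (real \<Rightarrow> real) \<Rightarrow> bool" where
  "primitive_on a b f f' \<longleftrightarrow> set_integrable lborel {a..b} f' \<and>
     (\<forall>x\<in>{a..b}. (LBINT t:{a..x}. f' t) = f x - f a)"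

lemma primitive_on_integrable:
  "primitive_on a b f f' \<Longrightarrow> set_integrable lborel {a..b} f'"
  by (simp add: primitive_on_def)

lemma set_lborel_integral_split:
  fixes f :: "real \<Rightarrow> real"
  assumes "set_integrable lborel {a..b} f" "a \<le> x" "x \<le> b"
  shows "(LBINT t:{a..b}. f t) = (LBINT t:{a..x}. f t) + (LBINT t:{x..b}. f t)"
proof -
  have "{a..b} = {a..x} \<union> {x..b}" using assms by auto
  moreover have "(LBINT t:{a..x} \<union> {x..b}. f t) =
      (LBINT t:{a..x}. f t) + (LBINT t:{x..b}. f t)"
  proof (rule set_integral_Un_AE)
    show "AE t in lborel. \<not> (t \<in> {a..x} \<and> t \<in> {x..b})"
      using AE_lborel_singleton[of x] by eventually_elim auto
    show "set_integrable lborel {a..x} f" "set_integrable lborel {x..b} f"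
      using assms by (auto intro: set_integrable_subset)
  qed auto
  ultimately show ?thesis by simp
qed

lemma primitive_on_increment:
  assumes "primitive_on a b f f'" "a \<le> x" "x \<le> y" "y \<le> b"
  shows "(LBINT t:{x..y}. f' t) = f y - f x"
proof -
  have "set_integrable lborel {a..y} f'"
    using assms unfolding primitive_on_def by (auto intro: set_integrable_subset)
  from set_lborel_integral_split[OF this, of x] show ?thesis
    using assms unfolding primitive_on_def by auto
qed

lemma primitive_on_subinterval:
  assumes "primitive_on a b f f'" "a \<le> c" "d \<le> b"
  shows "primitive_on c d f f'"
  unfolding primitive_on_def
proof (intro conjI ballI)
  show "set_integrable lborel {c..d} f'"
    using assms unfolding primitive_on_def by (auto intro: set_integrable_subset)
  show "(LBINT t:{c..x}. f' t) = f x - f c" if "x \<in> {c..d}" for x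
    using primitive_on_increment[OF assms(1), of c x] that assms by auto
qed

lemma primitive_on_cong:
  assumes "primitive_on a b f f'" "\<And>x. a \<le> x \<Longrightarrow> x \<le> b \<Longrightarrow> f x = g x"
    "\<And>x. a \<le> x \<Longrightarrow> x \<le> b \<Longrightarrow> f' x = g' x"
  shows "primitive_on a b g g'"
  unfolding primitive_on_def
proof (intro conjI ballI)
  have "set_integrable lborel {a..b} f' \<longleftrightarrow> set_integrable lborel {a..b} g'"
    by (rule set_integrable_cong) (auto simp: assms)
  with assms(1) show "set_integrable lborel {a..b} g'" by (simp add: primitive_on_def)
  fix x assume x: "x \<in> {a..b}"
  have "(LBINT t:{a..x}. g' t) = (LBINT t:{a..x}. f' t)"
    using x by (intro set_lebesgue_integral_cong) (auto simp: assms)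
  also have "\<dots> = f x - f a" using assms(1) x by (simp add: primitive_on_def)
  finally show "(LBINT t:{a..x}. g' t) = g x - g a" using x assms(2) by auto
qed

lemma primitive_on_DERIV:
  assumes "\<And>x. a \<le> x \<Longrightarrow> x \<le> b \<Longrightarrow> (f has_real_derivative f' x) (at x)"
    "continuous_on {a..b} f'"
  shows "primitive_on a b f f'"
  unfolding primitive_on_def
proof (intro conjI ballI)
  show "set_integrable lborel {a..b} f'"
    using borel_integrable_atLeastAtMost'[OF assms(2)] .
  fix x assume x: "x \<in> {a..b}"
  show "(LBINT t:{a..x}. f' t) = f x - f a"
    unfolding set_lebesgue_integral_def
  proof (rule integral_FTC_atLeastAtMost)
    show "(f has_vector_derivative f' t) (at t within {a..x})" if "a \<le> t" "t \<le> x" for t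
      using assms(1)[of t] that x
      by (auto simp: has_real_derivative_iff_has_vector_derivative intro: has_vector_derivative_at_within)
    show "continuous_on {a..x} f'" using assms(2) x by (auto intro: continuous_on_subset)
  qed (use x in auto)
qed

lemma primitive_on_add:
  assumes "primitive_on a b f f'" "primitive_on a b g g'"
  shows "primitive_on a b (\<lambda>x. f x + g x) (\<lambda>x. f' x + g' x)"
  unfolding primitive_on_def
proof (intro conjI ballI)
  show "set_integrable lborel {a..b} (\<lambda>x. f' x + g' x)"
    using assms unfolding primitive_on_def by auto
  fix x assume x: "x \<in> {a..b}"
  have "set_integrable lborel {a..x} f'" "set_integrable lborel {a..x} g'"
    using assms x unfolding primitive_on_def by (auto intro: set_integrable_subset)
  then show "(LBINT t:{a..x}. f' t + g' t) = f x + g x - (f a + g a)"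
    using assms x unfolding primitive_on_def by (subst set_integral_add) auto
qed

lemma primitive_on_cmult:
  assumes "primitive_on a b f f'"
  shows "primitive_on a b (\<lambda>x. c * f x) (\<lambda>x. c * f' x)"
  using assms unfolding primitive_on_def by (auto simp: right_diff_distrib)

lemma primitive_on_diff:
  assumes "primitive_on a b f f'" "primitive_on a b g g'"
  shows "primitive_on a b (\<lambda>x. f x - g x) (\<lambda>x. f' x - g' x)"
  using primitive_on_add[OF assms(1) primitive_on_cmult[OF assms(2), of "-1"]] by simp

lemma primitive_on_continuous:
  assumes "primitive_on a b f f'"
  shows "continuous_on {a..b} f"
proof -
  have I: "set_integrable lborel {a..b} f'" using assms by (simp add: primitive_on_def)
  have "continuous_on {a..b} (\<lambda>x. integral {a..x} f')"
    using set_borel_integral_eq_integral(1)[OF I] by (rule indefinite_integral_continuous_1)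
  then have "continuous_on {a..b} (\<lambda>x. f a + integral {a..x} f')"
    by (intro continuous_intros)
  moreover have "f a + integral {a..x} f' = f x" if "x \<in> {a..b}" for x
  proof -
    have "set_integrable lborel {a..x} f'" using I by (rule set_integrable_subset) (use that in auto)
    from set_borel_integral_eq_integral(2)[OF this] assms that show ?thesis
      by (auto simp: primitive_on_def)
  qed
  ultimately show ?thesis using continuous_on_cong[OF refl, of "{a..b}" "\<lambda>x. f a + integral {a..x} f'" f] by blast
qed

lemma set_integrable_mult_continuous:
  fixes f g :: "real \<Rightarrow> real"
  assumes "set_integrable lborel {a..b} f" "continuous_on {a..b} g"
  shows "set_integrable lborel {a..b} (\<lambda>x. f x * g x)"
proof -
  obtain B where B: "\<And>x. x \<in> {a..b} \<Longrightarrow> \<bar>g x\<bar> \<le> B"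
    using compact_imp_bounded[OF compact_continuous_image[OF assms(2) compact_Icc]]
    unfolding bounded_iff by (metis imageI real_norm_def)
  have gm: "(\<lambda>x. indicator {a..b} x * g x) \<in> borel_measurable lborel"
    using borel_integrable_atLeastAtMost'[OF assms(2)] unfolding set_integrable_def
    by (auto dest: borel_measurable_integrable)
  have fi: "integrable lborel (\<lambda>x. indicator {a..b} x * f x)"
    using assms(1) by (simp add: set_integrable_def)
  have "integrable lborel (\<lambda>x. (indicator {a..b} x * f x) * (indicator {a..b} x * g x))"
  proof (rule Bochner_Integration.integrable_bound)
    show "integrable lborel (\<lambda>x. B * (indicator {a..b} x * f x))" using fi by simp
    show "(\<lambda>x. (indicator {a..b} x * f x) * (indicator {a..b} x * g x)) \<in> borel_measurable lborel"
      using borel_measurable_integrable[OF fi] gm by (rule borel_measurable_times)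
    show "AE x in lborel. norm (indicator {a..b} x * f x * (indicator {a..b} x * g x))
        \<le> norm (B * (indicator {a..b} x * f x))"
    proof (intro AE_I2)
      fix x show "norm (indicator {a..b} x * f x * (indicator {a..b} x * g x))
        \<le> norm (B * (indicator {a..b} x * f x))"
        using B[of x] mult_left_mono[of "\<bar>g x\<bar>" "\<bar>B\<bar>" "\<bar>f x\<bar>"]
        by (auto simp: indicator_def abs_mult mult.commute)
    qed
  qed
  moreover have "(\<lambda>x. (indicator {a..b} x * f x) * (indicator {a..b} x * g x)) =
      (\<lambda>x. indicator {a..b} x * (f x * g x :: real))"
    by (auto simp: indicator_def fun_eq_iff)
  ultimately show ?thesis by (simp add: set_integrable_def)
qed

text \<open>
  Fubini on the square \<open>{a..b} \<times> {a..b}\<close>: the product of the increments of \<open>f\<close> and \<open>g\<close> is the integral of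
  \<open>f' s * g' t\<close>, and the two triangles \<open>t \<le> s\<close> and \<open>s < t\<close> produce the two terms of the product rule.
\<close>

lemma integral_by_parts_primitive:
  assumes f: "primitive_on a b f f'" and g: "primitive_on a b g g'" and ab: "a \<le> b"
  shows "(LBINT t:{a..b}. f' t * g t + f t * g' t) = f b * g b - f a * g a"
proof -
  define p where "p = (\<lambda>t. indicator {a..b} t * f' t)"
  define q where "q = (\<lambda>t. indicator {a..b} t * g' t)"
  have pI: "integrable lborel p" and qI: "integrable lborel q"
    using f g unfolding primitive_on_def set_integrable_def p_def q_def by auto
  have [measurable]: "p \<in> borel_measurable borel" "q \<in> borel_measurable borel"
    using borel_measurable_integrable[OF pI] borel_measurable_integrable[OF qI] by auto
  have pq: "integrable (lborel \<Otimes>\<^sub>M lborel) (\<lambda>(s,t). p s * q t)"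
  proof (rule lborel_pair.Fubini_integrable)
    show "integrable lborel (\<lambda>x. LBINT y. norm (case (x, y) of (s, t) \<Rightarrow> p s * q t))"
      using pI by (simp add: abs_mult)
    show "AE x in lborel. integrable lborel (\<lambda>y. case (x, y) of (s, t) \<Rightarrow> p s * q t)"
      using qI by simp
  qed measurable
  have pq1: "integrable (lborel \<Otimes>\<^sub>M lborel) (\<lambda>(s,t). p s * (q t * indicator {..s} t))"
    by (rule Bochner_Integration.integrable_bound[OF pq]) (auto simp: indicator_def)
  have pq2: "integrable (lborel \<Otimes>\<^sub>M lborel) (\<lambda>(s,t). p s * q t * indicator {..<t} s)"
    by (rule Bochner_Integration.integrable_bound[OF pq]) (auto simp: indicator_def)
  have i1: "(LBINT t. p s * (q t * indicator {..s} t)) = indicator {a..b} s * (f' s * (g s - g a))" for s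
  proof (cases "s \<in> {a..b}")
    case True
    have "(LBINT t. q t * indicator {..s} t) = (LBINT t:{a..s}. g' t)"
      unfolding set_lebesgue_integral_def q_def
      by (rule Bochner_Integration.integral_cong) (use True in \<open>auto simp: indicator_def\<close>)
    also have "\<dots> = g s - g a" using g True by (simp add: primitive_on_def)
    finally show ?thesis using True by (simp add: p_def)
  qed (simp add: p_def)
  have i2: "(LBINT s. p s * q t * indicator {..<t} s) = indicator {a..b} t * ((f t - f a) * g' t)" for t
  proof (cases "t \<in> {a..b}")
    case True
    have "(LBINT s. p s * indicator {..<t} s) = (LBINT s:{a..t}. f' s)"
      unfolding set_lebesgue_integral_def p_def
    proof (rule integral_cong_AE)
      show "(\<lambda>x. indicat_real {a..b} x * f' x * indicat_real {..<t} x) \<in> borel_measurable lborel"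
        using \<open>p \<in> borel_measurable borel\<close> unfolding p_def by measurable
      have "(\<lambda>x. indicat_real {a..t} x *\<^sub>R f' x) = (\<lambda>x. p x * indicat_real {a..t} x)"
        using True by (auto simp: p_def indicator_def fun_eq_iff)
      then show "(\<lambda>x. indicat_real {a..t} x *\<^sub>R f' x) \<in> borel_measurable lborel"
        by simp
      show "AE x in lborel. indicat_real {a..b} x * f' x * indicat_real {..<t} x = indicat_real {a..t} x *\<^sub>R f' x"
        using AE_lborel_singleton[of t] by eventually_elim (use True in \<open>auto simp: indicator_def\<close>)
    qed
    also have "\<dots> = f t - f a" using f True by (simp add: primitive_on_def)
    finally have "(LBINT s. q t * (p s * indicator {..<t} s)) = q t * (f t - f a)" by simp
    moreover have "(LBINT s. p s * q t * indicator {..<t} s) = (LBINT s. q t * (p s * indicator {..<t} s))"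
      by (simp add: mult_ac)
    ultimately show ?thesis using True by (simp add: q_def)
  qed (simp add: q_def)
  have "(LINT z|(lborel \<Otimes>\<^sub>M lborel). (case z of (s,t) \<Rightarrow> p s * q t)) = (LBINT s. LBINT t. p s * q t)"
    using lborel_pair.integral_fst'[OF pq] by simp
  also have "\<dots> = (LBINT s. p s) * (LBINT t. q t)" by simp
  also have "(LBINT s. p s) = f b - f a"
    using f ab unfolding primitive_on_def p_def set_lebesgue_integral_def by auto
  also have "(LBINT s. q s) = g b - g a"
    using g ab unfolding primitive_on_def q_def set_lebesgue_integral_def by auto
  finally have total: "(LINT z|(lborel \<Otimes>\<^sub>M lborel). (case z of (s,t) \<Rightarrow> p s * q t)) = (f b - f a) * (g b - g a)" .
  have "(\<lambda>(s,t). p s * q t) = (\<lambda>z. (case z of (s,t) \<Rightarrow> p s * (q t * indicator {..s} t)) +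
      (case z of (s,t) \<Rightarrow> p s * q t * indicator {..<t} s))"
    by (auto simp: fun_eq_iff indicator_def)
  then have "(LINT z|(lborel \<Otimes>\<^sub>M lborel). (case z of (s,t) \<Rightarrow> p s * q t)) =
     (LINT z|(lborel \<Otimes>\<^sub>M lborel). (case z of (s,t) \<Rightarrow> p s * (q t * indicator {..s} t))) +
     (LINT z|(lborel \<Otimes>\<^sub>M lborel). (case z of (s,t) \<Rightarrow> p s * q t * indicator {..<t} s))"
    using pq1 pq2 by simp
  also have "(LINT z|(lborel \<Otimes>\<^sub>M lborel). (case z of (s,t) \<Rightarrow> p s * (q t * indicator {..s} t))) =
      (LBINT s. indicator {a..b} s * (f' s * (g s - g a)))"
    unfolding lborel_pair.integral_fst'[OF pq1, symmetric] prod.case i1 ..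
  also have "(LINT z|(lborel \<Otimes>\<^sub>M lborel). (case z of (s,t) \<Rightarrow> p s * q t * indicator {..<t} s)) =
      (LBINT t. indicator {a..b} t * ((f t - f a) * g' t))"
    using lborel_pair.integral_snd[OF pq2] by (simp add: i2)
  finally have sum: "(f b - f a) * (g b - g a) = (LBINT t:{a..b}. f' t * (g t - g a)) +
      (LBINT t:{a..b}. (f t - f a) * g' t)"
    unfolding total by (simp add: set_lebesgue_integral_def)
  have cont: "continuous_on {a..b} f" "continuous_on {a..b} g"
    using f g primitive_on_continuous by auto
  have I: "set_integrable lborel {a..b} (\<lambda>t. f' t * (g t - g a))"
      "set_integrable lborel {a..b} (\<lambda>t. (f t - f a) * g' t)"
      "set_integrable lborel {a..b} (\<lambda>t. f' t * g a)"
      "set_integrable lborel {a..b} (\<lambda>t. f a * g' t)"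
  proof -
    have c: "continuous_on {a..b} (\<lambda>t. g t - g a)" "continuous_on {a..b} (\<lambda>t. f t - f a)"
      using cont by (auto intro!: continuous_intros)
    show "set_integrable lborel {a..b} (\<lambda>t. f' t * (g t - g a))"
      using set_integrable_mult_continuous[OF primitive_on_integrable[OF f] c(1)] .
    show "set_integrable lborel {a..b} (\<lambda>t. (f t - f a) * g' t)"
      using set_integrable_mult_continuous[OF primitive_on_integrable[OF g] c(2)] by (simp add: mult.commute)
  qed (use f g in \<open>auto simp: primitive_on_integrable\<close>)
  have "(LBINT t:{a..b}. f' t * g t + f t * g' t) =
    (LBINT t:{a..b}. (f' t * (g t - g a) + (f t - f a) * g' t) + (f' t * g a + f a * g' t))"
    by (simp add: algebra_simps)
  also have "\<dots> = (f b - f a) * (g b - g a) + ((f b - f a) * g a + f a * (g b - g a))"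
    using I f g ab by (simp add: sum set_integral_add(2) set_integral_add(1) primitive_on_def)
  finally show ?thesis by (simp add: algebra_simps)
qed

lemma primitive_on_mult:
  assumes f: "primitive_on a b f f'" and g: "primitive_on a b g g'"
  shows "primitive_on a b (\<lambda>x. f x * g x) (\<lambda>x. f' x * g x + f x * g' x)"
  unfolding primitive_on_def
proof (intro conjI ballI)
  have cont: "continuous_on {a..b} f" "continuous_on {a..b} g"
    using f g primitive_on_continuous by auto
  show "set_integrable lborel {a..b} (\<lambda>x. f' x * g x + f x * g' x)"
    using set_integrable_mult_continuous[OF primitive_on_integrable[OF f] cont(2)]
      set_integrable_mult_continuous[OF primitive_on_integrable[OF g] cont(1)]
    by (auto simp: mult.commute)
  show "(LBINT t:{a..x}. f' t * g t + f t * g' t) = f x * g x - f a * g a" if "x \<in> {a..b}" for x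
    using that f g by (intro integral_by_parts_primitive) (auto intro: primitive_on_subinterval)
qed

section \<open>Bump functions and the fundamental lemma of the calculus of variations\<close>

text \<open>
  The functions \<open>exp (-1/x) / x^k\<close>, extended by 0; the powers in the denominator make the family closed
  under differentiation up to linear combinations.
\<close>

definition flat :: "nat \<Rightarrow> real \<Rightarrow> real" where
  "flat k x = (if x > 0 then exp (- 1 / x) / x ^ k else 0)"

lemma flat_tendsto_0: "(flat k \<longlongrightarrow> 0) (at 0)"
proof -
  have "((\<lambda>y::real. y ^ k / exp y) \<longlongrightarrow> 0) at_top" by (rule tendsto_power_div_exp_0)
  then have "((\<lambda>x::real. (inverse x) ^ k / exp (inverse x)) \<longlongrightarrow> 0) (at_right 0)"
    by (rule filterlim_compose[OF _ filterlim_inverse_at_top_right])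
  moreover have "eventually (\<lambda>x::real. (inverse x) ^ k / exp (inverse x) = flat k x) (at_right 0)"
    using eventually_at_right_less[of 0]
    by eventually_elim (auto simp: flat_def exp_minus field_simps)
  ultimately have "(flat k \<longlongrightarrow> 0) (at_right 0)" by (rule Lim_transform_eventually)
  moreover have "(flat k \<longlongrightarrow> 0) (at_left 0)"
    by (rule tendsto_eventually) (auto simp: flat_def eventually_at_left_field intro!: exI[of _ "-1"])
  ultimately show ?thesis by (auto intro: filterlim_split_at)
qed

lemma DERIV_flat:
  "(flat k has_real_derivative (flat (k + 2) x - real k * flat (k + 1) x)) (at x)"
proof -
  consider "x > 0" | "x < 0" | "x = 0" by linarith
  then show ?thesis
  proof cases
    case 1
    have "((\<lambda>x. exp (- 1 / x) / x ^ k) has_real_derivative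
        exp (- 1 / x) / x ^ (k + 2) - real k * (exp (- 1 / x) / x ^ (k + 1))) (at x)"
    proof -
      have "((\<lambda>x. exp (- 1 / x)) has_real_derivative exp (- 1 / x) / x\<^sup>2) (at x)"
        using 1 by (auto intro!: derivative_eq_intros simp: field_simps power2_eq_square)
      from DERIV_divide[OF this DERIV_pow[of k]]
      have D: "((\<lambda>x. exp (- 1 / x) / x ^ k) has_real_derivative
          (exp (- 1 / x) / x\<^sup>2 * x ^ k - exp (- 1 / x) * (real k * x ^ (k - Suc 0))) / (x ^ k * x ^ k)) (at x)"
        using 1 by simp
      show ?thesis
      proof (rule DERIV_cong[OF D])
        show "(exp (- 1 / x) / x\<^sup>2 * x ^ k - exp (- 1 / x) * (real k * x ^ (k - Suc 0))) / (x ^ k * x ^ k)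
          = exp (- 1 / x) / x ^ (k + 2) - real k * (exp (- 1 / x) / x ^ (k + 1))"
          using 1 by (cases k) (simp_all add: field_simps power2_eq_square)
      qed
    qed
    moreover have "eventually (\<lambda>y. exp (- 1 / y) / y ^ k = flat k y) (nhds x)"
      using eventually_nhds_in_open[of "{0<..}" x] 1
      by (auto elim!: eventually_mono simp: flat_def)
    ultimately show ?thesis using 1
      by (subst DERIV_cong_ev[OF refl _ refl, of _ "\<lambda>y. exp (- 1 / y) / y ^ k"])
         (auto simp: flat_def elim: eventually_mono)
  next
    case 2
    have "eventually (\<lambda>y. flat k y = 0) (nhds x)"
      using eventually_nhds_in_open[of "{..<0}" x] 2
      by (auto elim!: eventually_mono simp: flat_def)
    then show ?thesis using 2
      by (subst DERIV_cong_ev[OF refl _ refl, of _ "\<lambda>y. 0"]) (auto simp: flat_def)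
  next
    case 3
    have "((\<lambda>h. flat (k + 1) h) \<longlongrightarrow> 0) (at 0)" by (rule flat_tendsto_0)
    moreover have "flat (k + 1) h = (flat k (0 + h) - flat k 0) / h" for h
      by (auto simp: flat_def)
    ultimately show ?thesis using 3 by (simp add: DERIV_def flat_def)
  qed
qed

definition smooth_fun :: "(real \<Rightarrow> real) \<Rightarrow> bool" where
  "smooth_fun f \<longleftrightarrow> (\<forall>k x. (deriv ^^ k) f differentiable (at x))"

text \<open>
  A coinduction principle: membership in a class of differentiable functions that contains a derivative of each of
  its members already gives derivatives of all orders.
\<close>

lemma smooth_fun_if_closed:
  assumes "f \<in> S" "\<And>g. g \<in> S \<Longrightarrow> \<exists>g'\<in>S. \<forall>x. (g has_real_derivative g' x) (at x)"
  shows "smooth_fun f"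
proof -
  have d: "deriv g \<in> S" if gS: "g \<in> S" for g
  proof -
    obtain g' where "g' \<in> S" "\<forall>x. (g has_real_derivative g' x) (at x)" using assms(2)[OF gS] by auto
    moreover from this have "deriv g = g'" by (auto intro!: DERIV_imp_deriv)
    ultimately show ?thesis by simp
  qed
  have "(deriv ^^ k) f \<in> S" for k by (induction k) (auto simp: assms(1) d)
  then show ?thesis unfolding smooth_fun_def using assms(2)
    by (metis real_differentiable_def)
qed

lemma smooth_fun_DERIV:
  assumes "smooth_fun f" shows "(f has_real_derivative deriv f x) (at x)"
proof -
  have "(deriv ^^ 0) f differentiable (at x)" using assms unfolding smooth_fun_def by blast
  then show ?thesis by (simp add: DERIV_deriv_iff_real_differentiable)
qed

lemma smooth_fun_deriv:
  assumes "smooth_fun f" shows "smooth_fun (deriv f)"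
proof -
  have "(deriv ^^ Suc k) f differentiable (at x)" for k x using assms unfolding smooth_fun_def by blast
  then show ?thesis unfolding funpow_Suc_right o_apply smooth_fun_def by blast
qed

lemma smooth_fun_diff_cmult:
  assumes "smooth_fun f" "smooth_fun g" shows "smooth_fun (\<lambda>x. f x - r * g x)"
proof -
  define S where "S = (\<lambda>(f, g) x. f x - r * g x) ` (Collect smooth_fun \<times> Collect smooth_fun)"
  have SI: "(\<lambda>x. f x - r * g x) \<in> S" if "smooth_fun f" "smooth_fun g" for f g
    unfolding S_def by (rule image_eqI[of _ _ "(f, g)"]) (use that in auto)
  show ?thesis
  proof (rule smooth_fun_if_closed[OF SI[OF assms]])
    fix h assume "h \<in> S"
    then obtain f g where fg: "smooth_fun f" "smooth_fun g" and h: "h = (\<lambda>x. f x - r * g x)"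
      unfolding S_def by auto
    have "(h has_real_derivative deriv f x - r * deriv g x) (at x)" for x
      unfolding h by (intro DERIV_diff DERIV_cmult smooth_fun_DERIV fg)
    then show "\<exists>h'\<in>S. \<forall>x. (h has_real_derivative h' x) (at x)"
      by (intro bexI[OF _ SI[OF smooth_fun_deriv[OF fg(1)] smooth_fun_deriv[OF fg(2)]]]) auto
  qed
qed

lemma smooth_fun_antiderivative:
  assumes "smooth_fun f'" "\<And>x. (f has_real_derivative f' x) (at x)" shows "smooth_fun f"
proof (rule smooth_fun_if_closed[where S="insert f {g. smooth_fun g}"])
  fix g assume "g \<in> insert f {g. smooth_fun g}"
  then show "\<exists>g'\<in>insert f {g. smooth_fun g}. \<forall>x. (g has_real_derivative g' x) (at x)"
    using assms smooth_fun_DERIV smooth_fun_deriv by blast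
qed simp

text \<open>
  The linear span of the products of two flat functions; it is the class to which the coinduction principle is
  applied in order to see that bumps are smooth.
\<close>

inductive_set bump_span :: "real \<Rightarrow> real \<Rightarrow> real \<Rightarrow> (real \<Rightarrow> real) set" for c a b where
  base: "(\<lambda>x. flat i (c * (x - a)) * flat j (c * (b - x))) \<in> bump_span c a b"
| add: "f \<in> bump_span c a b \<Longrightarrow> g \<in> bump_span c a b \<Longrightarrow> (\<lambda>x. f x + g x) \<in> bump_span c a b"
| cmult: "f \<in> bump_span c a b \<Longrightarrow> (\<lambda>x. r * f x) \<in> bump_span c a b"

lemma bump_span_deriv:
  "g \<in> bump_span c a b \<Longrightarrow> \<exists>g'\<in>bump_span c a b. \<forall>x. (g has_real_derivative g' x) (at x)"
proof (induction rule: bump_span.induct)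
  case (base i j)
  let ?B = "\<lambda>i j x. flat i (c * (x - a)) * flat j (c * (b - x))"
  let ?g = "\<lambda>x. (c * ?B (i + 2) j x + (- c * real i) * ?B (i + 1) j x) +
       ((- c) * ?B i (j + 2) x + (c * real j) * ?B i (j + 1) x)"
  have 1: "((\<lambda>x. flat i (c * (x - a))) has_real_derivative
      (flat (i + 2) (c * (x - a)) - real i * flat (i + 1) (c * (x - a))) * c) (at x)" for x
    by (rule DERIV_chain2[OF DERIV_flat]) (auto intro!: derivative_eq_intros)
  have 2: "((\<lambda>x. flat j (c * (b - x))) has_real_derivative
      (flat (j + 2) (c * (b - x)) - real j * flat (j + 1) (c * (b - x))) * - c) (at x)" for x
    by (rule DERIV_chain2[OF DERIV_flat]) (auto intro!: derivative_eq_intros)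
  have "(?B i j has_real_derivative ?g x) (at x)" for x
    by (rule DERIV_cong[OF DERIV_mult[OF 1 2]]) (simp add: algebra_simps)
  moreover have "?g \<in> bump_span c a b" by (intro bump_span.intros)
  ultimately show ?case by (intro bexI[of _ ?g]) auto
next
  case (add f g)
  then obtain f' g' where "f' \<in> bump_span c a b" "g' \<in> bump_span c a b"
    "\<And>x. (f has_real_derivative f' x) (at x)" "\<And>x. (g has_real_derivative g' x) (at x)" by blast
  then show ?case
    by (intro bexI[of _ "\<lambda>x. f' x + g' x"] allI DERIV_add) (auto intro: bump_span.add)
next
  case (cmult f r)
  then obtain f' where "f' \<in> bump_span c a b" "\<And>x. (f has_real_derivative f' x) (at x)" by blast
  then show ?case
    by (intro bexI[of _ "\<lambda>x. r * f' x"] allI DERIV_cmult) (auto intro: bump_span.cmult)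
qed

definition bump :: "real \<Rightarrow> real \<Rightarrow> real \<Rightarrow> real \<Rightarrow> real" where
  "bump c a b x = flat 0 (c * (x - a)) * flat 0 (c * (b - x))"

lemma bump_nonneg: "0 \<le> bump c a b x" and bump_le_1: "bump c a b x \<le> 1"
  by (auto simp: bump_def flat_def intro!: mult_le_one)

lemma bump_eq_0: "c > 0 \<Longrightarrow> x \<notin> {a<..<b} \<Longrightarrow> bump c a b x = 0"
  by (auto simp: bump_def flat_def zero_less_mult_iff)

lemma bump_pos: "c > 0 \<Longrightarrow> x \<in> {a<..<b} \<Longrightarrow> bump c a b x > 0"
  by (auto simp: bump_def flat_def zero_less_mult_iff)

lemma smooth_fun_bump: "smooth_fun (bump c a b)"
proof (rule smooth_fun_if_closed)
  show "bump c a b \<in> bump_span c a b"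
    unfolding bump_def[abs_def] by (rule bump_span.base)
qed (rule bump_span_deriv)

lemma test_functionI:
  assumes "smooth_fun f" "\<And>x. x \<notin> {a..b} \<Longrightarrow> f x = 0"
  shows "test_function f"
proof -
  have "{x. f x \<noteq> 0} \<subseteq> {a..b}" using assms(2) by blast
  then have "closure {x. f x \<noteq> 0} \<subseteq> {a..b}" by (rule closure_minimal) simp
  then have "compact (closure {x. f x \<noteq> 0})"
    by (metis closed_closure compact_Icc compact_Int_closed inf.absorb_iff2)
  then show ?thesis using assms(1) by (simp add: test_function_def smooth_fun_def)
qed

lemma test_function_bump: "c > 0 \<Longrightarrow> test_function (bump c a b)"
  by (rule test_functionI[of _ a b]) (auto simp: smooth_fun_bump intro!: bump_eq_0)

lemma test_function_DERIV:
  assumes "test_function f" shows "(f has_real_derivative deriv f x) (at x)"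
proof -
  have "(deriv ^^ 0) f differentiable (at x)" using assms unfolding test_function_def by blast
  then show ?thesis by (simp add: DERIV_deriv_iff_real_differentiable)
qed

lemma test_function_continuous:
  assumes "test_function f" shows "continuous_on A f" "continuous_on A (deriv f)"
proof -
  show "continuous_on A f"
    using test_function_DERIV[OF assms] by (meson DERIV_isCont continuous_at_imp_continuous_on)
  have "(deriv ^^ 1) f differentiable (at x)" for x
    using assms unfolding test_function_def by blast
  then show "continuous_on A (deriv f)"
    by (auto intro!: continuous_at_imp_continuous_on differentiable_imp_continuous_within)
qed

lemma test_function_support:
  assumes "test_function f"
  shows "\<exists>M>0. \<forall>x. M \<le> \<bar>x\<bar> \<longrightarrow> f x = 0 \<and> deriv f x = 0"
proof -
  have "bounded (closure {x. f x \<noteq> 0})"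
    using assms compact_imp_bounded unfolding test_function_def by blast
  then obtain B where B: "\<And>x. x \<in> closure {x. f x \<noteq> 0} \<Longrightarrow> \<bar>x\<bar> \<le> B"
    unfolding bounded_iff by auto
  have 0: "f x = 0" if "\<bar>B\<bar> < \<bar>x\<bar>" for x
    using B[of x] closure_subset[of "{x. f x \<noteq> 0}"] that by force
  have "f x = 0 \<and> deriv f x = 0" if "\<bar>B\<bar> + 1 \<le> \<bar>x\<bar>" for x
  proof
    show "f x = 0" using 0 that by auto
    have "open {y::real. \<bar>B\<bar> < \<bar>y\<bar>}" by (intro open_Collect_less continuous_intros)
    then have "eventually (\<lambda>y. \<bar>B\<bar> < \<bar>y\<bar>) (nhds x)"
      using eventually_nhds_in_open[of "{y. \<bar>B\<bar> < \<bar>y\<bar>}" x] that by auto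
    then have "eventually (\<lambda>y. f y = 0) (nhds x)" by eventually_elim (rule 0)
    then have "(f has_real_derivative 0) (at x)"
      by (subst DERIV_cong_ev[OF refl _ refl, of _ "\<lambda>_. 0"]) auto
    then show "deriv f x = 0" by (rule DERIV_imp_deriv)
  qed
  then show ?thesis by (intro exI[of _ "\<bar>B\<bar> + 1"]) auto
qed

text \<open>
  Both factors are \<open>exp (-1/(c d))\<close> with a fixed \<open>d > 0\<close>, and \<open>c\<close> tends to infinity. Letting the
  steepness grow thus recovers the indicator without moving the support.
\<close>

lemma bump_tendsto_indicator: "(\<lambda>n. bump (real (Suc n)) a b x) \<longlonglongrightarrow> indicator {a<..<b} x"
proof (cases "x \<in> {a<..<b}")
  case True
  have e: "(\<lambda>n. exp (- 1 / (real (Suc n) * d))) \<longlonglongrightarrow> exp 0" for d :: real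
  proof (rule tendsto_exp)
    have "(\<lambda>n. (- 1 / d) * (1 / real (Suc n))) \<longlonglongrightarrow> (- 1 / d) * 0"
      by (intro tendsto_mult tendsto_const LIMSEQ_Suc lim_1_over_n)
    then show "(\<lambda>n. - 1 / (real (Suc n) * d)) \<longlonglongrightarrow> 0" by (simp add: field_simps)
  qed
  have "(\<lambda>n. exp (- 1 / (real (Suc n) * (x - a))) * exp (- 1 / (real (Suc n) * (b - x)))) \<longlonglongrightarrow> exp 0 * exp 0"
    by (intro tendsto_mult e)
  moreover have "bump (real (Suc n)) a b x =
      exp (- 1 / (real (Suc n) * (x - a))) * exp (- 1 / (real (Suc n) * (b - x)))" for n
    unfolding bump_def flat_def using True by (auto simp: zero_less_mult_iff)
  ultimately show ?thesis using True by simp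
qed (auto simp: bump_eq_0)

text \<open>
  On each interval \<open>{-n..n}\<close> the positive and the negative part of \<open>k\<close> are densities of finite measures that agree
  on all half-lines, hence agree.
\<close>

lemma AE_zero_if_interval_integrals_zero:
  fixes k :: "real \<Rightarrow> real"
  assumes [measurable]: "k \<in> borel_measurable borel"
    and I: "\<And>a b. set_integrable lborel {a..b} k"
    and Z: "\<And>a b. (LBINT x:{a..b}. k x) = 0"
  shows "AE x in lborel. k x = 0"
proof -
  have "AE x in lborel. indicator {-real n..real n} x * k x = 0" for n
  proof -
    let ?I = "\<lambda>x. indicator {-real n..real n} x :: real"
    define p where "p = (\<lambda>x. max 0 (?I x * k x))"
    define q where "q = (\<lambda>x. max 0 (- (?I x * k x)))"
    have [measurable]: "p \<in> borel_measurable borel" "q \<in> borel_measurable borel"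
      unfolding p_def q_def by measurable
    have kI: "integrable lborel (\<lambda>x. ?I x * k x)" using I[of "-real n" "real n"] by (simp add: set_integrable_def)
    have pI: "integrable lborel p" and qI: "integrable lborel q"
      unfolding p_def q_def by (rule Bochner_Integration.integrable_bound[OF kI]; auto)+
    have pos: "0 \<le> p x" "0 \<le> q x" for x by (auto simp: p_def q_def)
    have pxI: "integrable lborel (\<lambda>t. p t * indicator {x<..} t)" for x
      by (rule Bochner_Integration.integrable_bound[OF pI]) (auto simp: indicator_def)
    have qxI: "integrable lborel (\<lambda>t. q t * indicator {x<..} t)" for x
      by (rule Bochner_Integration.integrable_bound[OF qI]) (auto simp: indicator_def)
    have e1: "emeasure (density lborel p) {x<..} = ennreal (LBINT t. p t * indicator {x<..} t)" for x
      using pxI pos by (simp add: emeasure_density nn_integral_eq_integral ennreal_indicator[symmetric] ennreal_mult'[symmetric])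
    have e2: "emeasure (density lborel q) {x<..} = ennreal (LBINT t. q t * indicator {x<..} t)" for x
      using qxI pos by (simp add: emeasure_density nn_integral_eq_integral ennreal_indicator[symmetric] ennreal_mult'[symmetric])
    have "density lborel p = density lborel q"
    proof (rule measure_eqI_lessThan)
      fix x
      show "emeasure (density lborel p) {x<..} < \<infinity>" by (simp add: e1)
      have "(LBINT t. p t * indicator {x<..} t) - (LBINT t. q t * indicator {x<..} t)
          = (LBINT t. p t * indicator {x<..} t - q t * indicator {x<..} t)"
        using pxI qxI by simp
      also have "\<dots> = (LBINT t:{max x (-real n)..real n}. k t)"
        unfolding set_lebesgue_integral_def
      proof (rule integral_cong_AE)
        show "AE t in lborel. p t * indicat_real {x<..} t - q t * indicat_real {x<..} t =
            indicat_real {max x (- real n)..real n} t *\<^sub>R k t"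
          using AE_lborel_singleton[of x] by eventually_elim (auto simp: p_def q_def indicator_def)
      qed measurable
      also have "\<dots> = 0" by (rule Z)
      finally show "emeasure (density lborel p) {x<..} = emeasure (density lborel q) {x<..}"
        by (simp add: e1 e2)
    qed auto
    then have "AE x in lborel. ennreal (p x) = ennreal (q x)"
      by (intro sigma_finite_measure.density_unique) (auto simp: lborel.sigma_finite_measure_axioms)
    then show ?thesis
    proof eventually_elim
      case (elim x) then have "p x = q x" using pos by simp
      then show ?case unfolding p_def q_def by (auto simp: max_def split: if_splits)
    qed
  qed
  then have "AE x in lborel. \<forall>n. indicator {-real n..real n} x * k x = 0"
    by (intro AE_all_countable[THEN iffD2] allI)
  then show ?thesis
  proof eventually_elim
    case (elim x)
    obtain n where "\<bar>x\<bar> \<le> real n" using real_arch_simple by blast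
    then show ?case using elim[rule_format, of n] by (auto simp: indicator_def)
  qed
qed

lemma integrable_mult_test_function:
  fixes k \<phi> :: "real \<Rightarrow> real"
  assumes [measurable]: "k \<in> borel_measurable borel" and I: "\<And>a b. set_integrable lborel {a..b} k"
    and c: "continuous_on UNIV \<phi>" and z: "\<And>x. M \<le> \<bar>x\<bar> \<Longrightarrow> \<phi> x = 0"
  shows "integrable lborel (\<lambda>x. k x * \<phi> x)" "(LBINT x. k x * \<phi> x) = (LBINT x:{-M..M}. k x * \<phi> x)"
proof -
  have "set_integrable lborel {-M..M} (\<lambda>x. k x * \<phi> x)"
    by (rule set_integrable_mult_continuous[OF I]) (rule continuous_on_subset[OF c], simp)
  moreover have e: "(\<lambda>x. indicator {-M..M} x *\<^sub>R (k x * \<phi> x)) = (\<lambda>x. k x * \<phi> x)"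
  proof
    show "indicator {-M..M} x *\<^sub>R (k x * \<phi> x) = k x * \<phi> x" for x
      using z[of x] by (cases "M \<le> \<bar>x\<bar>") (auto simp: indicator_def)
  qed
  ultimately show "integrable lborel (\<lambda>x. k x * \<phi> x)" by (simp add: set_integrable_def)
  show "(LBINT x. k x * \<phi> x) = (LBINT x:{-M..M}. k x * \<phi> x)"
    unfolding set_lebesgue_integral_def e ..
qed

text \<open>
  Testing with bumps that increase to the indicator of an interval shows that all interval integrals vanish.
\<close>

lemma fundamental_lemma:
  fixes k :: "real \<Rightarrow> real"
  assumes [measurable]: "k \<in> borel_measurable borel" and I: "\<And>a b. set_integrable lborel {a..b} k"
    and Z: "\<And>\<phi>. test_function \<phi> \<Longrightarrow> (LBINT x. k x * \<phi> x) = 0"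
  shows "AE x in lborel. k x = 0"
proof (rule AE_zero_if_interval_integrals_zero[OF assms(1) I])
  fix a b :: real
  have "(\<lambda>n. LBINT x. k x * bump (real (Suc n)) a b x) \<longlonglongrightarrow> (LBINT x. k x * indicator {a<..<b} x)"
  proof (rule integral_dominated_convergence[where w="\<lambda>x. indicator {a..b} x * \<bar>k x\<bar>"])
    show "integrable lborel (\<lambda>x. indicator {a..b} x * \<bar>k x\<bar>)"
      using set_integrable_abs[OF I[of a b]] by (simp add: set_integrable_def)
    show "AE x in lborel. (\<lambda>n. k x * bump (real (Suc n)) a b x) \<longlonglongrightarrow> k x * indicat_real {a<..<b} x"
      by (intro AE_I2 tendsto_mult tendsto_const bump_tendsto_indicator)
    show "AE x in lborel. norm (k x * bump (real (Suc n)) a b x) \<le> indicat_real {a..b} x * \<bar>k x\<bar>" for n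
    proof (rule AE_I2)
      fix x
      show "norm (k x * bump (real (Suc n)) a b x) \<le> indicat_real {a..b} x * \<bar>k x\<bar>"
      proof (cases "x \<in> {a<..<b}")
        case True
        then show ?thesis using mult_left_mono[OF bump_le_1[of "real (Suc n)" a b x], of "\<bar>k x\<bar>"]
          by (simp add: abs_mult bump_nonneg)
      qed (simp add: bump_eq_0)
    qed
    have [measurable]: "bump (real (Suc n)) a b \<in> borel_measurable borel" for n
      by (rule borel_measurable_continuous_onI test_function_continuous(1) test_function_bump)+ simp
    show "(\<lambda>x. k x * bump (real (Suc n)) a b x) \<in> borel_measurable lborel" for n by measurable
  qed measurable
  moreover have "(LBINT x. k x * bump (real (Suc n)) a b x) = 0" for n
    by (rule Z) (simp add: test_function_bump)
  ultimately have "(LBINT x. k x * indicator {a<..<b} x) = 0"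
    by (simp add: LIMSEQ_const_iff)
  moreover have "(LBINT x. k x * indicator {a<..<b} x) = (LBINT x:{a..b}. k x)"
    unfolding set_lebesgue_integral_def
  proof (rule integral_cong_AE)
    show "AE x in lborel. k x * indicat_real {a<..<b} x = indicat_real {a..b} x *\<^sub>R k x"
      using AE_lborel_singleton[of a] AE_lborel_singleton[of b]
      by eventually_elim (auto simp: indicator_def)
  qed measurable
  ultimately show "(LBINT x:{a..b}. k x) = 0" by simp
qed

text \<open>
  A test function of mean 0 is the derivative of a test function. Subtracting from \<open>\<psi>\<close> the multiple of a fixed bump
  with the same integral therefore gives an admissible derivative, and the constant is the mean of \<open>k\<close> against the
  normalized bump.
\<close>

lemma fundamental_lemma_deriv:
  fixes k :: "real \<Rightarrow> real"
  assumes [measurable]: "k \<in> borel_measurable borel" and I: "\<And>a b. set_integrable lborel {a..b} k"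
    and Z: "\<And>\<phi>. test_function \<phi> \<Longrightarrow> (LBINT x. k x * deriv \<phi> x) = 0"
  shows "\<exists>c. AE x in lborel. k x = c"
proof -
  let ?B = "bump 1 0 1"
  have tB: "test_function ?B" by (rule test_function_bump) simp
  have "set_integrable lborel {a..b} (\<lambda>x::real. 1::real)" for a b
    by (rule borel_integrable_atLeastAtMost') auto
  note tint = integrable_mult_test_function[of "\<lambda>_. 1", OF _ this, simplified]
  have mass: "(LBINT x. ?B x) > 0"
  proof -
    have "(LBINT x. ?B x) \<noteq> 0"
    proof
      assume "(LBINT x. ?B x) = 0"
      moreover have "integrable lborel ?B"
        by (rule tint[of _ 1]) (auto intro!: test_function_continuous tB bump_eq_0)
      ultimately have "AE x in lborel. ?B x = 0"
        by (subst (asm) integral_nonneg_eq_0_iff_AE) (auto simp: bump_nonneg)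
      then have "AE x in lborel. x \<notin> {0<..<1::real}"
        by eventually_elim (use bump_pos[of 1 _ 0 1] in force)
      then have "{0<..<1::real} \<in> null_sets lborel" by (subst AE_iff_null_sets) auto
      then have "emeasure lborel {0<..<1::real} = 0" by (rule null_setsD1)
      then show False by (subst (asm) emeasure_lborel_Ioo) auto
    qed
    moreover have "0 \<le> (LBINT x. ?B x)" by (intro Bochner_Integration.integral_nonneg) (auto simp: bump_nonneg)
    ultimately show ?thesis by simp
  qed
  define m where "m = (LBINT x. ?B x)"
  define c where "c = (LBINT x. k x * ?B x) / m"
  have "AE x in lborel. k x - c = 0"
  proof (rule fundamental_lemma)
    show "set_integrable lborel {a..b} (\<lambda>x. k x - c)" for a b
      using I borel_integrable_atLeastAtMost'[of a b "\<lambda>_. c"] by (intro set_integral_diff(1)) auto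
    fix \<psi> assume t: "test_function \<psi>"
    obtain M where "M > 0" "\<forall>x. M \<le> \<bar>x\<bar> \<longrightarrow> \<psi> x = 0 \<and> deriv \<psi> x = 0"
      using test_function_support[OF t] by blast
    then have M: "M > 0" "\<And>x. M \<le> \<bar>x\<bar> \<Longrightarrow> \<psi> x = 0" by auto
    \<comment> \<open>large enough for the supports of \<open>\<psi>\<close> and of the bump on \<open>{0..1}\<close>\<close>
    define N where "N = max M 2"
    define r where "r = (LBINT x. \<psi> x) / m"
    define \<eta> where "\<eta> = (\<lambda>x. \<psi> x - r * ?B x)"
    have \<psi>0: "\<psi> x = 0" if "N \<le> \<bar>x\<bar>" for x using M that by (auto simp: N_def)
    have B0: "?B x = 0" if "N \<le> \<bar>x\<bar>" for x using that by (auto simp: N_def intro!: bump_eq_0)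
    have \<eta>0: "\<eta> x = 0" if "N \<le> \<bar>x\<bar>" for x using \<psi>0 B0 that by (auto simp: \<eta>_def)
    have c\<psi>: "continuous_on A \<psi>" and cB: "continuous_on A ?B" for A
      using test_function_continuous t tB by auto
    have c\<eta>: "continuous_on A \<eta>" for A unfolding \<eta>_def by (intro continuous_intros c\<psi> cB)
    have kint: "integrable lborel (\<lambda>x. k x * \<psi> x)" "integrable lborel (\<lambda>x. k x * ?B x)"
      by (rule integrable_mult_test_function(1)[OF assms(1) I c\<psi> \<psi>0]
          integrable_mult_test_function(1)[OF assms(1) I cB B0]; assumption)+
    have tint': "integrable lborel \<psi>" "integrable lborel ?B" "integrable lborel \<eta>"
      by (rule tint(1)[OF c\<psi> \<psi>0] tint(1)[OF cB B0] tint(1)[OF c\<eta> \<eta>0]; assumption)+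
    note kint = kint tint'
    have \<eta>int: "(LBINT x. \<eta> x) = 0"
      using kint mass unfolding \<eta>_def r_def m_def by simp
    define \<Psi> :: "real \<Rightarrow> real" where "\<Psi> = (\<lambda>x. LBINT t=ereal (-N)..ereal x. \<eta> t)"
    have D: "(\<Psi> has_real_derivative \<eta> x) (at x)" for x
    proof -
      define A where "A = max \<bar>x\<bar> N + 1"
      have A: "A > \<bar>x\<bar>" "A > N" by (auto simp: A_def)
      have "(\<Psi> has_vector_derivative \<eta> x) (at x within {-A..A})"
        unfolding \<Psi>_def using A c\<eta>
        by (intro interval_integral_FTC2) (auto simp: N_def)
      then show ?thesis using A
        by (auto simp: has_real_derivative_iff_has_vector_derivative at_within_Icc_at abs_less_iff)
    qed
    have \<Psi>0: "\<Psi> x = 0" if "x \<notin> {-N..N}" for x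
    proof (cases "x < -N")
      case True
      have "\<Psi> x = - (LBINT t:{x<..<-N}. \<eta> t)"
        unfolding \<Psi>_def using True by (subst interval_integral_endpoints_reverse) (simp add: interval_lebesgue_integral_def)
      also have "(LBINT t:{x<..<-N}. \<eta> t) = (LBINT t:{x<..<-N}. 0)"
        by (rule set_lebesgue_integral_cong) (auto intro!: \<eta>0)
      finally show ?thesis by simp
    next
      case False
      then have x: "x > N" using that by auto
      have "-N \<le> x" using x by (auto simp: N_def)
      have "\<Psi> x = (LBINT t:{-N<..<x}. \<eta> t)"
        unfolding \<Psi>_def using x \<open>-N \<le> x\<close> by (simp add: interval_lebesgue_integral_def)
      also have "\<dots> = (LBINT t. \<eta> t)"
        unfolding set_lebesgue_integral_def
      proof (rule Bochner_Integration.integral_cong[OF refl])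
        show "indicator {-N<..<x} t *\<^sub>R \<eta> t = \<eta> t" for t
          using x \<eta>0[of t] by (cases "N \<le> \<bar>t\<bar>") (auto simp: indicator_def)
      qed
      finally show ?thesis using \<eta>int by simp
    qed
    have "smooth_fun \<psi>" "smooth_fun ?B" using t tB by (simp_all add: test_function_def smooth_fun_def)
    then have "smooth_fun \<eta>" unfolding \<eta>_def by (rule smooth_fun_diff_cmult)
    then have "smooth_fun \<Psi>" using D by (rule smooth_fun_antiderivative)
    then have "test_function \<Psi>" using \<Psi>0 by (rule test_functionI)
    moreover have "deriv \<Psi> = \<eta>" using D by (auto intro!: DERIV_imp_deriv)
    ultimately have "(LBINT x. k x * \<eta> x) = 0" using Z[of \<Psi>] by simp
    moreover have "(LBINT x. k x * \<eta> x) = (LBINT x. k x * \<psi> x) - r * (LBINT x. k x * ?B x)"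
      using kint unfolding \<eta>_def by (simp add: right_diff_distrib mult.left_commute)
    moreover have "r * (LBINT x. k x * ?B x) = c * (LBINT x. \<psi> x)"
      by (simp add: r_def c_def)
    ultimately show "(LBINT x. (k x - c) * \<psi> x) = 0"
      using kint by (simp add: left_diff_distrib)
  qed measurable
  then show ?thesis by (intro exI[of _ c]) simp
qed

section \<open>Weak derivatives on the line\<close>

lemma borel_measurable_lebesgue_AE:
  fixes g h :: "real \<Rightarrow> real"
  assumes "g \<in> borel_measurable lebesgue" "AE x in lborel. g x = h x"
  shows "h \<in> borel_measurable lebesgue"
proof (rule measurableI)
  fix A :: "real set" assume A: "A \<in> sets borel"
  have m: "g -` A \<inter> space lebesgue \<in> sets lebesgue" using assms(1) A by (rule measurable_sets)
  have ae: "AE x in lebesgue. x \<in> g -` A \<inter> space lebesgue \<longleftrightarrow> x \<in> h -` A \<inter> space lebesgue"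
    using AE_completion[OF assms(2)] by eventually_elim auto
  show "h -` A \<inter> space lebesgue \<in> sets lebesgue"
    by (rule completion.in_sets_AE[OF ae m]) simp
qed auto

lemma integral_lebesgue_eq_lborel:
  fixes g :: "real \<Rightarrow> real"
  assumes "AE x in lborel. g x = h x" "h \<in> borel_measurable borel"
  shows "(LINT x|lebesgue. g x) = (LBINT x. h x)"
    and "integrable lebesgue g \<longleftrightarrow> integrable lborel h"
proof -
  have h: "h \<in> borel_measurable lebesgue" using assms(2) by (simp add: measurable_completion)
  then have g: "g \<in> borel_measurable lebesgue"
    by (rule borel_measurable_lebesgue_AE) (use assms(1) in eventually_elim, simp)
  have "(LINT x|lebesgue. g x) = (LINT x|lebesgue. h x)"
    by (rule integral_cong_AE[OF g h AE_completion[OF assms(1)]])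
  then show "(LINT x|lebesgue. g x) = (LBINT x. h x)"
    using assms(2) by (simp add: integral_completion)
  have "integrable lebesgue g \<longleftrightarrow> integrable lebesgue h"
    by (rule integrable_cong_AE[OF g h AE_completion[OF assms(1)]])
  then show "integrable lebesgue g \<longleftrightarrow> integrable lborel h"
    using assms(2) by (simp add: integrable_completion)
qed

text \<open>
  Lebesgue measurable functions are replaced by Borel functions, so that everything afterwards takes place
  in \<open>lborel\<close>, where Fubini and affine substitutions are available without completion.
\<close>

lemma locally_integrable_borel_representative:
  assumes "locally_integrable g"
  shows "\<exists>g'. g' \<in> borel_measurable borel \<and> (AE x in lborel. g x = g' x) \<and>
    (\<forall>a b. set_integrable lborel {a..b} g')"
proof -
  have I: "integrable lebesgue (\<lambda>x. indicator {a..b} x * g x)" for a b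
    using assms compact_Icc[of a b] unfolding locally_integrable_def set_integrable_def by auto
  have "g \<in> borel_measurable lebesgue"
  proof (rule borel_measurable_LIMSEQ_real)
    show "(\<lambda>x. indicator {-real n..real n} x * g x) \<in> borel_measurable lebesgue" for n
      using I by (rule borel_measurable_integrable)
    fix x
    obtain N where N: "\<bar>x\<bar> \<le> real N" using real_arch_simple by blast
    have "eventually (\<lambda>n. indicator {-real n..real n} x * g x = g x) sequentially"
      using eventually_ge_at_top[of N] by eventually_elim (use N in \<open>auto simp: indicator_def\<close>)
    then show "(\<lambda>n. indicator {-real n..real n} x * g x) \<longlonglongrightarrow> g x" by (rule tendsto_eventually)
  qed
  then obtain g' where g': "g' \<in> borel_measurable lborel" "AE x in lborel. g x = g' x"
    using completion_ex_borel_measurable_real[of g lborel] by auto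
  have "set_integrable lborel {a..b} g'" for a b
  proof -
    have "AE x in lborel. indicator {a..b} x * g x = indicator {a..b} x * g' x"
      using g'(2) by eventually_elim simp
    from integral_lebesgue_eq_lborel(2)[OF this] I[of a b] g'(1) show ?thesis
      by (simp add: set_integrable_def)
  qed
  with g' show ?thesis by auto
qed

lemma primitive_exists:
  assumes "\<And>a b. set_integrable lborel {a..b} h"
  shows "\<exists>H. \<forall>a b. primitive_on a b H h"
proof -
  define H where "H = (\<lambda>x. if 0 \<le> x then (LBINT t:{0..x}. h t) else - (LBINT t:{x..0}. h t))"
  have "(LBINT t:{a..x}. h t) = H x - H a" if "a \<le> x" for a x
  proof -
    consider "0 \<le> a" | "a < 0" "0 \<le> x" | "x < 0" using that by linarith
    then show ?thesis
    proof cases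
      case 1 then show ?thesis using that set_lborel_integral_split[OF assms, where a=0 and x=a and b=x]
        by (auto simp: H_def)
    next
      case 2 then show ?thesis using that set_lborel_integral_split[OF assms, where a=a and x=0 and b=x]
        by (auto simp: H_def)
    next
      case 3 then show ?thesis using that set_lborel_integral_split[OF assms, where a=a and x=x and b=0]
        by (auto simp: H_def)
    qed
  qed
  then have "primitive_on a b H h" for a b using assms by (simp add: primitive_on_def)
  then show ?thesis by blast
qed

lemma primitive_on_continuous_UNIV:
  assumes "\<And>a b. primitive_on a b G H" shows "continuous_on UNIV G"
proof (rule continuous_at_imp_continuous_on, rule ballI)
  fix x :: real
  have "continuous_on {x-1..x+1} G" using assms primitive_on_continuous by blast
  then show "isCont G x"
    by (rule continuous_on_interior) (auto simp: interior_atLeastAtMost_real)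
qed

lemma integral_by_parts_test_function:
  assumes P: "\<And>a b. primitive_on a b G H" and H: "H \<in> borel_measurable borel"
    and t: "test_function \<phi>"
  shows "(LBINT x. G x * deriv \<phi> x) = - (LBINT x. H x * \<phi> x)"
    and "integrable lborel (\<lambda>x. G x * deriv \<phi> x)" "integrable lborel (\<lambda>x. H x * \<phi> x)"
proof -
  obtain M where "M > 0" "\<forall>x. M \<le> \<bar>x\<bar> \<longrightarrow> \<phi> x = 0 \<and> deriv \<phi> x = 0"
    using test_function_support[OF t] by blast
  then have M: "M > 0" "\<And>x. M \<le> \<bar>x\<bar> \<Longrightarrow> \<phi> x = 0" "\<And>x. M \<le> \<bar>x\<bar> \<Longrightarrow> deriv \<phi> x = 0" by auto
  have c\<phi>: "continuous_on A \<phi>" "continuous_on A (deriv \<phi>)" for A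
    using test_function_continuous[OF t] by auto
  have G: "continuous_on UNIV G" using P by (rule primitive_on_continuous_UNIV)
  then have Gb: "G \<in> borel_measurable borel" by (rule borel_measurable_continuous_onI)
  have GI: "set_integrable lborel {a..b} G" for a b
    using G by (intro borel_integrable_atLeastAtMost') (auto intro: continuous_on_subset)
  have HI: "set_integrable lborel {a..b} H" for a b using P by (rule primitive_on_integrable)
  note 1 = integrable_mult_test_function[OF Gb GI c\<phi>(2) M(3)]
  note 2 = integrable_mult_test_function[OF H HI c\<phi>(1) M(2)]
  show "integrable lborel (\<lambda>x. G x * deriv \<phi> x)" "integrable lborel (\<lambda>x. H x * \<phi> x)"
    by (rule 1, assumption) (rule 2, assumption)
  have p\<phi>: "primitive_on (-M) M \<phi> (deriv \<phi>)"
    by (rule primitive_on_DERIV) (auto intro: test_function_DERIV t c\<phi>)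
  have "(LBINT x:{-M..M}. H x * \<phi> x + G x * deriv \<phi> x) = G M * \<phi> M - G (-M) * \<phi> (-M)"
    by (rule integral_by_parts_primitive[OF P p\<phi>]) (use M in auto)
  also have "\<dots> = 0" using M by simp
  also have "(LBINT x:{-M..M}. H x * \<phi> x + G x * deriv \<phi> x) =
     (LBINT x:{-M..M}. H x * \<phi> x) + (LBINT x:{-M..M}. G x * deriv \<phi> x)"
    by (rule set_integral_add(2)) (auto intro!: set_integrable_mult_continuous HI GI c\<phi>)
  finally show "(LBINT x. G x * deriv \<phi> x) = - (LBINT x. H x * \<phi> x)"
    using 1(2) 2(2) by simp
qed

text \<open>
  If \<open>K\<close> is any primitive of the weak derivative, then \<open>g - K\<close> has weak derivative 0, hence is constant.
\<close>

lemma has_weak_deriv_imp_primitive: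
  assumes "has_weak_deriv g h"
  shows "\<exists>G H. H \<in> borel_measurable borel \<and> (\<forall>a b. primitive_on a b G H) \<and>
    (AE x in lborel. g x = G x) \<and> (AE x in lborel. h x = H x)"
proof -
  have gh: "locally_integrable g" "locally_integrable h" using assms by (auto simp: has_weak_deriv_def)
  obtain g' where g': "g' \<in> borel_measurable borel" "AE x in lborel. g x = g' x"
    "\<And>a b. set_integrable lborel {a..b} g'"
    using locally_integrable_borel_representative[OF gh(1)] by auto
  obtain H where H: "H \<in> borel_measurable borel" "AE x in lborel. h x = H x"
    "\<And>a b. set_integrable lborel {a..b} H"
    using locally_integrable_borel_representative[OF gh(2)] by auto
  obtain K where K: "\<And>a b. primitive_on a b K H" using primitive_exists[OF H(3)] by auto
  have cK: "continuous_on UNIV K" using K by (rule primitive_on_continuous_UNIV)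
  then have Kb: "K \<in> borel_measurable borel" by (rule borel_measurable_continuous_onI)
  have KI: "set_integrable lborel {a..b} K" for a b
    using cK by (intro borel_integrable_atLeastAtMost') (auto intro: continuous_on_subset)
  have "\<exists>c. AE x in lborel. g' x - K x = c"
  proof (rule fundamental_lemma_deriv)
    show "(\<lambda>x. g' x - K x) \<in> borel_measurable borel" using g'(1) Kb by simp
    show "set_integrable lborel {a..b} (\<lambda>x. g' x - K x)" for a b using g'(3) KI by auto
    fix \<phi> assume t: "test_function \<phi>"
    obtain M where "M > 0" "\<forall>x. M \<le> \<bar>x\<bar> \<longrightarrow> \<phi> x = 0 \<and> deriv \<phi> x = 0"
    using test_function_support[OF t] by blast
  then have M: "M > 0" "\<And>x. M \<le> \<bar>x\<bar> \<Longrightarrow> \<phi> x = 0" "\<And>x. M \<le> \<bar>x\<bar> \<Longrightarrow> deriv \<phi> x = 0" by auto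
    have b\<phi>: "\<phi> \<in> borel_measurable borel" "deriv \<phi> \<in> borel_measurable borel"
      using test_function_continuous[OF t] by (auto intro!: borel_measurable_continuous_onI)
    have "(LINT x|lebesgue. g x * deriv \<phi> x) = (LBINT x. g' x * deriv \<phi> x)"
      by (rule integral_lebesgue_eq_lborel(1)) (use g'(2) in eventually_elim, simp, use g'(1) b\<phi> in measurable)
    moreover have "(LINT x|lebesgue. h x * \<phi> x) = (LBINT x. H x * \<phi> x)"
      by (rule integral_lebesgue_eq_lborel(1)) (use H(2) in eventually_elim, simp, use H(1) b\<phi> in measurable)
    moreover have "(LINT x|lebesgue. g x * deriv \<phi> x) = - (LINT x|lebesgue. h x * \<phi> x)"
      using assms t by (simp add: has_weak_deriv_def)
    moreover have "(LBINT x. K x * deriv \<phi> x) = - (LBINT x. H x * \<phi> x)"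
      by (rule integral_by_parts_test_function(1)[OF K H(1) t])
    moreover have "integrable lborel (\<lambda>x. K x * deriv \<phi> x)"
      by (rule integral_by_parts_test_function(2)[OF K H(1) t])
    moreover have "integrable lborel (\<lambda>x. g' x * deriv \<phi> x)"
      by (rule integrable_mult_test_function(1)[OF g'(1) g'(3) test_function_continuous(2)[OF t] M(3)])
    ultimately show "(LBINT x. (g' x - K x) * deriv \<phi> x) = 0"
      by (simp add: left_diff_distrib)
  qed
  then obtain c where c: "AE x in lborel. g' x - K x = c" ..
  have "primitive_on a b (\<lambda>x. K x + c) H" for a b using K[of a b] by (simp add: primitive_on_def)
  moreover have "AE x in lborel. g x = K x + c" using g'(2) c by eventually_elim simp
  ultimately show ?thesis using H by (intro exI[of _ "\<lambda>x. K x + c"] exI[of _ H]) auto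
qed

lemma locally_integrable_AE_borel:
  fixes k k' :: "real \<Rightarrow> real"
  assumes e: "AE x in lborel. k' x = k x" and k: "k \<in> borel_measurable borel"
    and I: "\<And>a b. set_integrable lborel {a..b} k"
  shows "locally_integrable k'"
  unfolding locally_integrable_def
proof (intro allI impI)
  fix K :: "real set" assume K: "compact K"
  then have Km: "K \<in> sets borel" by (simp add: borel_compact)
  obtain B where B: "\<forall>x\<in>K. \<bar>x\<bar> \<le> B"
    using compact_imp_bounded[OF K] unfolding bounded_iff real_norm_def by blast
  have KB: "K \<subseteq> {-B..B}" using B by (auto simp: abs_le_iff)
  have kI: "set_integrable lborel K k" by (rule set_integrable_subset[OF I _ KB]) (use Km in simp)
  have ae: "AE x in lborel. indicator K x * k' x = indicator K x * k x"
    using e by eventually_elim simp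
  have m: "(\<lambda>x. indicator K x * k x) \<in> borel_measurable borel"
    using k Km by (intro borel_measurable_times borel_measurable_indicator)
  have "integrable lborel (\<lambda>x. indicator K x * k x)"
    using kI unfolding set_integrable_def real_scaleR_def .
  then have "integrable lebesgue (\<lambda>x. indicator K x * k' x)"
    by (rule integral_lebesgue_eq_lborel(2)[OF ae m, THEN iffD2])
  then show "k' absolutely_integrable_on K"
    unfolding set_integrable_def real_scaleR_def .
qed

lemma primitive_imp_has_weak_deriv:
  assumes P: "\<And>a b. primitive_on a b G H" and H: "H \<in> borel_measurable borel"
    and g: "AE x in lborel. g x = G x" and h: "AE x in lborel. h x = H x"
  shows "has_weak_deriv g h"
proof -
  have G: "continuous_on UNIV G" using P by (rule primitive_on_continuous_UNIV)
  then have Gb: "G \<in> borel_measurable borel" by (rule borel_measurable_continuous_onI)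
  have GI: "set_integrable lborel {a..b} G" for a b
    using G by (intro borel_integrable_atLeastAtMost') (auto intro: continuous_on_subset)
  have HI: "set_integrable lborel {a..b} H" for a b using P by (rule primitive_on_integrable)
  have "(LINT x|lebesgue. g x * deriv \<phi> x) = - (LINT x|lebesgue. h x * \<phi> x)" if t: "test_function \<phi>" for \<phi>
  proof -
    have b\<phi>: "\<phi> \<in> borel_measurable borel" "deriv \<phi> \<in> borel_measurable borel"
      using test_function_continuous[OF t] by (auto intro!: borel_measurable_continuous_onI)
    have "(LINT x|lebesgue. g x * deriv \<phi> x) = (LBINT x. G x * deriv \<phi> x)"
      by (rule integral_lebesgue_eq_lborel(1)) (use g in eventually_elim, simp, use Gb b\<phi> in measurable)
    moreover have "(LINT x|lebesgue. h x * \<phi> x) = (LBINT x. H x * \<phi> x)"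
      by (rule integral_lebesgue_eq_lborel(1)) (use h in eventually_elim, simp, use H b\<phi> in measurable)
    ultimately show ?thesis using integral_by_parts_test_function(1)[OF P H t] by simp
  qed
  then have "\<forall>\<phi>. test_function \<phi> \<longrightarrow> (LINT x|lebesgue. g x * deriv \<phi> x) = - (LINT x|lebesgue. h x * \<phi> x)"
    by (intro allI impI)
  then show ?thesis
    unfolding has_weak_deriv_def
    by (intro conjI locally_integrable_AE_borel[OF g Gb GI] locally_integrable_AE_borel[OF h H HI])
qed

text \<open>
  The choice in \<^const>\<open>weak_deriv\<close> is harmless: by the fundamental lemma it agrees almost everywhere with the density of any
  primitive representing \<open>g\<close>.
\<close>

lemma weak_deriv_primitive:
  assumes P: "\<And>a b. primitive_on a b G H" and H: "H \<in> borel_measurable borel"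
    and g: "AE x in lborel. g x = G x"
  shows "AE x in lborel. weak_deriv g x = H x"
proof -
  have "has_weak_deriv g H" by (rule primitive_imp_has_weak_deriv[OF P H g]) simp
  then have "has_weak_deriv g (weak_deriv g)" unfolding weak_deriv_def by (rule someI[where P="has_weak_deriv g"])
  from has_weak_deriv_imp_primitive[OF this]
  obtain G' H' where G'0: "H' \<in> borel_measurable borel \<and> (\<forall>a b. primitive_on a b G' H') \<and>
    (AE x in lborel. g x = G' x) \<and> (AE x in lborel. weak_deriv g x = H' x)"
    by (elim exE)
  then have G': "H' \<in> borel_measurable borel" "\<And>a b. primitive_on a b G' H'"
    "AE x in lborel. g x = G' x" "AE x in lborel. weak_deriv g x = H' x"
    by simp_all
  have GG': "AE x in lborel. G x = G' x" using g G'(3) by eventually_elim simp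
  have "AE x in lborel. H x - H' x = 0"
  proof (rule fundamental_lemma)
    show "(\<lambda>x. H x - H' x) \<in> borel_measurable borel" using H G'(1) by simp
    show "set_integrable lborel {a..b} (\<lambda>x. H x - H' x)" for a b
      using P[of a b] G'(2)[of a b] by (auto simp: primitive_on_def)
    fix \<phi> assume t: "test_function \<phi>"
    have b\<phi>: "\<phi> \<in> borel_measurable borel" "deriv \<phi> \<in> borel_measurable borel"
      using test_function_continuous[OF t] by (auto intro!: borel_measurable_continuous_onI)
    have [measurable]: "G \<in> borel_measurable borel" "G' \<in> borel_measurable borel"
      using primitive_on_continuous_UNIV[OF P] primitive_on_continuous_UNIV[OF G'(2)]
      by (auto intro: borel_measurable_continuous_onI)
    have "(LBINT x. G x * deriv \<phi> x) = (LBINT x. G' x * deriv \<phi> x)"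
      by (rule integral_cong_AE) (use b\<phi> in measurable, use GG' in eventually_elim, simp)
    then show "(LBINT x. (H x - H' x) * \<phi> x) = 0"
      using integral_by_parts_test_function[OF P H t] integral_by_parts_test_function[OF G'(2) G'(1) t]
      by (simp add: left_diff_distrib)
  qed
  with G'(4) show ?thesis by eventually_elim simp
qed

section \<open>Weighted integrals and distribution functions\<close>

text \<open>
  The inequality is the discriminant condition for the quadratic
  polynomial \<open>t \<mapsto> \<integral> w (\<bar>p\<bar> - t \<bar>q\<bar>)\<^sup>2\<close>.
\<close>

lemma weighted_Cauchy_Schwarz:
  fixes w p q :: "'a \<Rightarrow> real"
  assumes [measurable]: "w \<in> borel_measurable M" "p \<in> borel_measurable M" "q \<in> borel_measurable M"
    and w: "\<And>x. 0 \<le> w x"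
    and P: "integrable M (\<lambda>x. w x * (p x)\<^sup>2)" and Q: "integrable M (\<lambda>x. w x * (q x)\<^sup>2)"
  shows "integrable M (\<lambda>x. w x * (p x * q x))"
    and "(LINT x|M. w x * \<bar>p x * q x\<bar>) \<le> sqrt (LINT x|M. w x * (p x)\<^sup>2) * sqrt (LINT x|M. w x * (q x)\<^sup>2)"
proof -
  show I: "integrable M (\<lambda>x. w x * (p x * q x))"
  proof (rule Bochner_Integration.integrable_bound[OF Bochner_Integration.integrable_add[OF P Q]])
    show "AE x in M. norm (w x * (p x * q x)) \<le> norm (w x * (p x)\<^sup>2 + w x * (q x)\<^sup>2)"
    proof (rule AE_I2)
      fix x
      have "\<bar>p x * q x\<bar> \<le> (p x)\<^sup>2 + (q x)\<^sup>2"
        using sum_squares_bound[of "\<bar>p x\<bar>" "\<bar>q x\<bar>"] mult_nonneg_nonneg[OF abs_ge_zero[of "p x"] abs_ge_zero[of "q x"]]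
        unfolding abs_mult power2_abs mult.assoc by linarith
      then have "w x * \<bar>p x * q x\<bar> \<le> w x * ((p x)\<^sup>2 + (q x)\<^sup>2)" using w by (intro mult_left_mono)
      then show "norm (w x * (p x * q x)) \<le> norm (w x * (p x)\<^sup>2 + w x * (q x)\<^sup>2)"
        using w[of x] by (simp add: abs_mult distrib_left)
    qed
  qed measurable
  have Ia: "integrable M (\<lambda>x. w x * \<bar>p x * q x\<bar>)"
    using integrable_abs[OF I] w by (simp add: abs_mult)
  let ?A = "LINT x|M. w x * (p x)\<^sup>2" let ?B = "LINT x|M. w x * (q x)\<^sup>2" let ?I = "LINT x|M. w x * \<bar>p x * q x\<bar>"
  have A0: "0 \<le> ?A" and B0: "0 \<le> ?B" and I0: "0 \<le> ?I"
    by (intro Bochner_Integration.integral_nonneg mult_nonneg_nonneg w zero_le_power2 abs_ge_zero)+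
  have quad: "0 \<le> ?A - 2 * t * ?I + t\<^sup>2 * ?B" for t
  proof -
    have "0 \<le> (LINT x|M. w x * (\<bar>p x\<bar> - t * \<bar>q x\<bar>)\<^sup>2)"
      by (intro Bochner_Integration.integral_nonneg mult_nonneg_nonneg w zero_le_power2)
    also have "\<dots> = (LINT x|M. w x * (p x)\<^sup>2 - 2 * t * (w x * \<bar>p x * q x\<bar>) + t\<^sup>2 * (w x * (q x)\<^sup>2))"
      by (intro Bochner_Integration.integral_cong) (auto simp: power2_diff power_mult_distrib abs_mult algebra_simps)
    also have "\<dots> = ?A - 2 * t * ?I + t\<^sup>2 * ?B" using P Q Ia by simp
    finally show ?thesis .
  qed
  have "?I\<^sup>2 \<le> ?A * ?B"
  proof (cases "?B = 0")
    case True
    have "?I = 0"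
    proof (rule ccontr)
      assume "?I \<noteq> 0"
      then have "0 \<le> ?A - 2 * ((?A + 1) / ?I) * ?I" using quad[of "(?A + 1) / ?I"] True by simp
      also have "\<dots> = - ?A - 2" using \<open>?I \<noteq> 0\<close> by simp
      finally show False using A0 by simp
    qed
    then show ?thesis using True by simp
  next
    case False
    then have "?B > 0" using B0 by simp
    have "0 \<le> ?A - 2 * (?I / ?B) * ?I + (?I / ?B)\<^sup>2 * ?B" by (rule quad)
    also have "\<dots> = ?A - ?I\<^sup>2 / ?B" using \<open>?B > 0\<close> by (simp add: power2_eq_square field_simps)
    finally show ?thesis using \<open>?B > 0\<close> by (simp add: field_simps)
  qed
  then have "sqrt (?I\<^sup>2) \<le> sqrt (?A * ?B)" by (rule real_sqrt_le_mono)
  then show "?I \<le> sqrt ?A * sqrt ?B" using I0 by (simp add: real_sqrt_mult)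
qed

text \<open>
  Fatou's lemma along an exhaustion. It is used for the nonnegative integrands whose integrability over the line is
  itself a consequence of bounds on growing intervals.
\<close>

lemma integrable_exhaust:
  fixes W :: "'a \<Rightarrow> real"
  assumes [measurable]: "W \<in> borel_measurable M" "\<And>n. A n \<in> sets M" and W: "\<And>x. 0 \<le> W x"
    and ev: "\<And>x. eventually (\<lambda>n. x \<in> A n \<or> W x = 0) sequentially"
    and I: "\<And>n. set_integrable M (A n) W" and le: "\<And>n. (LINT x:A n|M. W x) \<le> c n"
    and c: "c \<longlonglongrightarrow> C"
  shows "integrable M W" "(LINT x|M. W x) \<le> C"
proof -
  have lim: "(\<lambda>n. ennreal (indicator (A n) x * W x)) \<longlonglongrightarrow> ennreal (W x)" for x
    by (rule tendsto_eventually) (use ev[of x] in eventually_elim, auto)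
  have "(\<integral>\<^sup>+x. ennreal (W x) \<partial>M) = (\<integral>\<^sup>+x. liminf (\<lambda>n. ennreal (indicator (A n) x * W x)) \<partial>M)"
    by (intro nn_integral_cong lim_imp_Liminf[symmetric] lim) simp
  also have "\<dots> \<le> liminf (\<lambda>n. \<integral>\<^sup>+x. ennreal (indicator (A n) x * W x) \<partial>M)"
    by (rule nn_integral_liminf) measurable
  also have "\<dots> \<le> liminf (\<lambda>n. ennreal (c n))"
  proof (rule Liminf_mono, rule always_eventually, rule allI)
    fix n
    have "(\<integral>\<^sup>+x. ennreal (indicator (A n) x * W x) \<partial>M) = ennreal (LINT x:A n|M. W x)"
      using I[of n] W unfolding set_integrable_def set_lebesgue_integral_def
      by (subst nn_integral_eq_integral) auto
    then show "(\<integral>\<^sup>+x. ennreal (indicator (A n) x * W x) \<partial>M) \<le> ennreal (c n)"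
      using le[of n] by (simp add: ennreal_leI)
  qed
  also have "\<dots> = ennreal C" by (intro lim_imp_Liminf tendsto_ennrealI c) simp
  finally have *: "(\<integral>\<^sup>+x. ennreal (W x) \<partial>M) \<le> ennreal C" .
  show int: "integrable M W"
    using le_less_trans[OF * ennreal_less_top] W by (intro integrableI_bounded) auto
  have "0 \<le> (LINT x:A n|M. W x)" for n unfolding set_lebesgue_integral_def using W by (intro Bochner_Integration.integral_nonneg) auto
  then have "0 \<le> c n" for n using le[of n] order_trans by blast
  then have "0 \<le> C" using c by (intro LIMSEQ_le_const) auto
  then show "(LINT x|M. W x) \<le> C" using * int W by (simp add: nn_integral_eq_integral)
qed

lemma set_integrable_of_integrable:
  "integrable lborel g \<Longrightarrow> S \<in> sets borel \<Longrightarrow> set_integrable lborel S (g :: real \<Rightarrow> real)"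
  unfolding set_integrable_def by (rule integrable_mult_indicator) simp_all

lemma x_ln_x_lower: "- 1 \<le> x * ln x" if "0 \<le> (x::real)"
proof (cases "x = 0")
  case False
  then have "ln (1 / x) \<le> 1 / x - 1" using that by (intro ln_le_minus_one) simp
  then have "x * ln (1 / x) \<le> x * (1 / x - 1)" using that by (rule mult_left_mono)
  then show ?thesis using False that by (simp add: ln_div algebra_simps)
qed simp

lemma abs_le_1_square: "\<bar>y\<bar> \<le> 1 + y\<^sup>2" for y :: real
  using sum_squares_bound[of 1 "\<bar>y\<bar>"] abs_ge_zero[of y] unfolding power2_abs by simp

definition cumul :: "(real \<Rightarrow> real) \<Rightarrow> real \<Rightarrow> real" where
  "cumul F x = (LBINT t:{..x}. F t)"

lemma cumul_diff:
  assumes "integrable lborel F" "x \<le> y"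
  shows "cumul F y - cumul F x = (LBINT t:{x..y}. F t)"
proof -
  have S: "set_integrable lborel A F" if "A \<in> sets lborel" for A
    unfolding set_integrable_def by (rule integrable_mult_indicator[OF that]) (use assms in simp)
  have "{..y} = {..x} \<union> {x..y}" using assms by auto
  moreover have "(LBINT t:{..x} \<union> {x..y}. F t) = cumul F x + (LBINT t:{x..y}. F t)"
    unfolding cumul_def
  proof (rule set_integral_Un_AE)
    show "AE t in lborel. \<not> (t \<in> {..x} \<and> t \<in> {x..y})"
      using AE_lborel_singleton[of x] by eventually_elim auto
  qed (auto intro: S)
  ultimately show ?thesis by (simp add: cumul_def)
qed

lemma cumul_total:
  assumes "integrable lborel F"
  shows "(LBINT t:{x<..}. F t) = (LBINT t. F t) - cumul F x"
proof -
  have S: "set_integrable lborel A F" if "A \<in> sets lborel" for A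
    unfolding set_integrable_def by (rule integrable_mult_indicator[OF that]) (use assms in simp)
  have "UNIV = {..x} \<union> {x<..}" by auto
  then have "(LBINT t. F t) = (LBINT t:{..x} \<union> {x<..}. F t)"
    by (simp add: set_lebesgue_integral_def)
  also have "\<dots> = cumul F x + (LBINT t:{x<..}. F t)"
    unfolding cumul_def by (rule set_integral_Un) (auto intro: S)
  finally show ?thesis by simp
qed

lemma DERIV_cumul:
  assumes F: "integrable lborel F" and c: "continuous_on UNIV F"
  shows "(cumul F has_real_derivative F x) (at x)"
proof -
  let ?a = "x - 1" let ?b = "x + 1"
  have "((\<lambda>y. LBINT t=ereal ?a..ereal y. F t) has_vector_derivative F x) (at x within {?a..?b})"
    by (rule interval_integral_FTC2) (auto intro: continuous_on_subset[OF c])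
  then have "((\<lambda>y. LBINT t=ereal ?a..ereal y. F t) has_real_derivative F x) (at x)"
    by (simp add: has_real_derivative_iff_has_vector_derivative at_within_Icc_at)
  then have "((\<lambda>y. cumul F ?a + (LBINT t=ereal ?a..ereal y. F t)) has_real_derivative F x) (at x)"
    by (auto intro!: derivative_eq_intros)
  moreover have "eventually (\<lambda>y. cumul F ?a + (LBINT t=ereal ?a..ereal y. F t) = cumul F y) (nhds x)"
  proof -
    have "eventually (\<lambda>y. y \<in> {?a<..}) (nhds x)" by (rule eventually_nhds_in_open) auto
    then show ?thesis
    proof eventually_elim
      case (elim y)
      then have "(LBINT t=ereal ?a..ereal y. F t) = (LBINT t:{?a..y}. F t)"
        by (simp add: interval_integral_Icc)
      then show ?case using cumul_diff[OF F, of ?a y] elim by simp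
    qed
  qed
  ultimately show ?thesis by (subst (asm) DERIV_cong_ev[OF refl _ refl]) 
qed

lemma cumul_at_bot: 
  assumes "integrable lborel F" shows "(\<lambda>n. cumul F (- real n)) \<longlonglongrightarrow> 0"
proof -
  have "(\<lambda>n. LBINT t. indicator {..- real n} t * F t) \<longlonglongrightarrow> (LBINT t::real. 0)"
  proof (rule integral_dominated_convergence[where w="\<lambda>t. \<bar>F t\<bar>"])
    show "AE t in lborel. (\<lambda>n. indicator {..- real n} t * F t) \<longlonglongrightarrow> 0"
    proof (rule AE_I2)
      fix t
      obtain N where N: "\<bar>t\<bar> < real N" using reals_Archimedean2 by blast
      have "eventually (\<lambda>n. indicator {..- real n} t * F t = 0) sequentially"
        using eventually_ge_at_top[of N] by eventually_elim (use N in \<open>auto simp: indicator_def\<close>)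
      then show "(\<lambda>n. indicator {..- real n} t * F t) \<longlonglongrightarrow> 0" by (rule tendsto_eventually)
    qed
  qed (use assms in \<open>auto intro!: AE_I2 simp: indicator_def borel_measurable_integrable\<close>)
  then show ?thesis by (simp add: cumul_def set_lebesgue_integral_def)
qed

lemma cumul_at_top: 
  assumes "integrable lborel F" shows "(\<lambda>n. cumul F (real n)) \<longlonglongrightarrow> (LBINT t. F t)"
proof -
  have "(\<lambda>n. LBINT t. indicator {..real n} t * F t) \<longlonglongrightarrow> (LBINT t. F t)"
  proof (rule integral_dominated_convergence[where w="\<lambda>t. \<bar>F t\<bar>"])
    show "AE t in lborel. (\<lambda>n. indicator {..real n} t * F t) \<longlonglongrightarrow> F t"
    proof (rule AE_I2)
      fix t
      obtain N where N: "\<bar>t\<bar> < real N" using reals_Archimedean2 by blast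
      have "eventually (\<lambda>n. indicator {..real n} t * F t = F t) sequentially"
        using eventually_ge_at_top[of N] by eventually_elim (use N in \<open>auto simp: indicator_def\<close>)
      then show "(\<lambda>n. indicator {..real n} t * F t) \<longlonglongrightarrow> F t" by (rule tendsto_eventually)
    qed
  qed (use assms in \<open>auto intro!: AE_I2 simp: indicator_def borel_measurable_integrable\<close>)
  then show ?thesis by (simp add: cumul_def set_lebesgue_integral_def)
qed

lemma cumul_mono:
  assumes "integrable lborel F" "\<And>x. 0 \<le> F x" "x \<le> y" shows "cumul F x \<le> cumul F y"
proof -
  have "0 \<le> (LBINT t:{x..y}. F t)"
    unfolding set_lebesgue_integral_def using assms by (intro Bochner_Integration.integral_nonneg) auto
  then show ?thesis using cumul_diff[OF assms(1,3)] by simp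
qed

lemma cumul_bounds:
  assumes "integrable lborel F" "\<And>x. 0 \<le> F x"
  shows "0 \<le> cumul F x" "cumul F x \<le> (LBINT t. F t)"
proof -
  show "0 \<le> cumul F x"
    unfolding cumul_def set_lebesgue_integral_def using assms by (intro Bochner_Integration.integral_nonneg) auto
  have "0 \<le> (LBINT t:{x<..}. F t)"
    unfolding set_lebesgue_integral_def using assms by (intro Bochner_Integration.integral_nonneg) auto
  then show "cumul F x \<le> (LBINT t. F t)" using cumul_total[OF assms(1), of x] by simp
qed

lemma cumul_surj:
  assumes F: "integrable lborel F" and c: "continuous_on UNIV F"
    and p: "0 < p" "p < (LBINT t. F t)"
  shows "\<exists>x. cumul F x = p"
proof -
  have "eventually (\<lambda>n. cumul F (- real n) < p) sequentially"
    using cumul_at_bot[OF F] p(1) by (rule order_tendstoD(2))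
  moreover have "eventually (\<lambda>n. p < cumul F (real n)) sequentially"
    using cumul_at_top[OF F] p(2) by (rule order_tendstoD(1))
  ultimately have "eventually (\<lambda>n. cumul F (- real n) < p \<and> p < cumul F (real n)) sequentially"
    by (rule eventually_conj)
  then obtain n where n: "cumul F (- real n) < p" "p < cumul F (real n)"
    by (auto simp: eventually_sequentially)
  have "continuous_on {- real n..real n} (cumul F)"
    using DERIV_cumul[OF F c] by (meson DERIV_isCont continuous_at_imp_continuous_on)
  then show ?thesis
    using IVT'[of "cumul F" "- real n" p "real n"] n by auto
qed

section \<open>The normal distribution function\<close>

abbreviation "\<phi> \<equiv> std_normal_density"

definition Phi :: "real \<Rightarrow> real" where "Phi = cumul \<phi>"

lemma phi_pos: "0 < \<phi> x" by (simp add: normal_density_pos)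

lemma phi_nonneg: "0 \<le> \<phi> x" by simp

lemma DERIV_phi: "(\<phi> has_real_derivative - x * \<phi> x) (at x)"
  unfolding std_normal_density_def[abs_def]
  by (auto intro!: derivative_eq_intros simp: field_simps power2_eq_square)

lemma continuous_on_phi: "continuous_on A \<phi>"
  by (meson DERIV_isCont DERIV_phi continuous_at_imp_continuous_on)

lemma integrable_phi: "integrable lborel \<phi>" and integral_phi: "(LBINT x. \<phi> x) = 1"
  by (simp_all add: integral_normal_density)

lemma phi_minus: "\<phi> (- x) = \<phi> x" by (simp add: std_normal_density_def)

lemma DERIV_Phi: "(Phi has_real_derivative \<phi> x) (at x)"
  unfolding Phi_def by (rule DERIV_cumul[OF integrable_phi continuous_on_phi])

lemma Phi_strict_mono: "x < y \<Longrightarrow> Phi x < Phi y"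
  by (rule DERIV_pos_imp_increasing[where f=Phi]) (use DERIV_Phi phi_pos in blast)+

lemma Phi_bounds: "0 < Phi x" "Phi x < 1"
proof -
  have "0 \<le> Phi (x - 1)" "Phi (x + 1) \<le> 1"
    using cumul_bounds[OF integrable_phi, of "x - 1"] cumul_bounds[OF integrable_phi, of "x + 1"]
    by (simp_all add: Phi_def integral_phi)
  then show "0 < Phi x" "Phi x < 1"
    using Phi_strict_mono[of "x - 1" x] Phi_strict_mono[of x "x + 1"] by auto
qed

lemma Phi_surj: "0 < p \<Longrightarrow> p < 1 \<Longrightarrow> \<exists>x. Phi x = p"
  unfolding Phi_def by (rule cumul_surj[OF integrable_phi continuous_on_phi]) (simp_all add: integral_phi)

lemma Phi_minus: "Phi (- x) = 1 - Phi x"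
proof -
  have "Phi (- x) = (LBINT t. indicator {..- x} t * \<phi> t)"
    by (simp add: Phi_def cumul_def set_lebesgue_integral_def)
  also have "\<dots> = (LBINT t. indicator {..- x} (- t) * \<phi> (- t))"
    by (subst lborel_integral_real_affine[of "-1" _ 0]) auto
  also have "\<dots> = (LBINT t. indicator {x<..} t * \<phi> t)"
  proof (rule integral_cong_AE)
    show "AE t in lborel. indicator {..- x} (- t) * \<phi> (- t) = indicator {x<..} t * \<phi> t"
      using AE_lborel_singleton[of x] by eventually_elim (auto simp: indicator_def phi_minus)
  qed auto
  also have "\<dots> = 1 - Phi x"
    using cumul_total[OF integrable_phi, of x] by (simp add: Phi_def set_lebesgue_integral_def integral_phi)
  finally show ?thesis .
qed

lemma Phi_0: "Phi 0 = 1 / 2" using Phi_minus[of 0] by simp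

text \<open>
  Shift by \<open>x\<close> and use \<open>(x + t)\<^sup>2 \<ge> x\<^sup>2 + t\<^sup>2\<close> for \<open>x, t \<ge> 0\<close>; the remaining integral over the half-line is \<open>1/2\<close>.
\<close>

lemma Phi_upper_tail:
  assumes "0 \<le> x" shows "1 - Phi x \<le> exp (- x\<^sup>2 / 2) / 2"
proof -
  have "1 - Phi x = (LBINT t. indicator {x<..} t * \<phi> t)"
    using cumul_total[OF integrable_phi, of x] by (simp add: Phi_def set_lebesgue_integral_def integral_phi)
  also have "\<dots> = (LBINT t. indicator {x<..} (x + t) * \<phi> (x + t))"
    by (subst lborel_integral_real_affine[of "1" _ x]) auto
  also have "\<dots> \<le> (LBINT t. exp (- x\<^sup>2 / 2) * (indicator {0<..} t * \<phi> t))"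
  proof (rule integral_mono)
    have 1: "integrable lborel (\<lambda>t. indicator {x<..} t * \<phi> t)" "integrable lborel (\<lambda>t. indicator {0<..} t * \<phi> t)"
      using integrable_mult_indicator[OF _ integrable_phi, of "{x<..}"] integrable_mult_indicator[OF _ integrable_phi, of "{0<..}"]
      by simp_all
    show "integrable lborel (\<lambda>t. indicator {x<..} (x + t) * \<phi> (x + t))"
      using lborel_integrable_real_affine[OF 1(1), of 1 x] by simp
    show "integrable lborel (\<lambda>t. exp (- x\<^sup>2 / 2) * (indicator {0<..} t * \<phi> t))" using 1 by simp
    fix t
    show "indicator {x<..} (x + t) * \<phi> (x + t) \<le> exp (- x\<^sup>2 / 2) * (indicator {0<..} t * \<phi> t)"
    proof (cases "t > 0")
      case True
      have "(x + t)\<^sup>2 \<ge> x\<^sup>2 + t\<^sup>2" using True assms by (simp add: power2_sum)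
      then have "exp (- (x + t)\<^sup>2 / 2) \<le> exp (- x\<^sup>2 / 2 + - t\<^sup>2 / 2)" by simp
      then have "exp (- (x + t)\<^sup>2 / 2) / sqrt (2 * pi) \<le> exp (- x\<^sup>2 / 2) * exp (- t\<^sup>2 / 2) / sqrt (2 * pi)"
        unfolding exp_add by (rule divide_right_mono) simp
      then show ?thesis using True by (simp add: std_normal_density_def)
    qed simp
  qed
  also have "\<dots> = exp (- x\<^sup>2 / 2) * (1 - Phi 0)"
    using cumul_total[OF integrable_phi, of 0] by (simp add: Phi_def set_lebesgue_integral_def integral_phi)
  finally show ?thesis by (simp add: Phi_0)
qed

lemma Phi_lower_tail: "x \<le> 0 \<Longrightarrow> Phi x \<le> exp (- x\<^sup>2 / 2) / 2"
  using Phi_upper_tail[of "- x"] by (simp add: Phi_minus)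

lemma phi_tendsto_0: "(\<lambda>n. \<phi> (real n)) \<longlonglongrightarrow> 0"
proof (rule Lim_null_comparison)
  show "(\<lambda>n. exp 1 * (real n ^ 0 / exp (real n))) \<longlonglongrightarrow> 0"
    by (intro tendsto_mult_right_zero filterlim_compose[OF tendsto_power_div_exp_0 filterlim_real_sequentially])
  show "eventually (\<lambda>n. norm (\<phi> (real n)) \<le> exp 1 * (real n ^ 0 / exp (real n))) sequentially"
  proof (rule always_eventually, rule allI)
    fix n
    have "1 \<le> sqrt (2 * pi)" using pi_gt3 by simp
    then have "\<phi> (real n) \<le> exp (- (real n)\<^sup>2 / 2)"
      unfolding std_normal_density_def by (simp add: divide_simps)
    also have "\<dots> \<le> exp (1 - real n)"
      using zero_le_power2[of "real n - 1"] by (simp add: power2_eq_square algebra_simps)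
    finally show "norm (\<phi> (real n)) \<le> exp 1 * (real n ^ 0 / exp (real n))"
      using phi_pos[of "real n"] by (simp add: exp_diff)
  qed
qed

definition Phi_inv :: "real \<Rightarrow> real" where "Phi_inv p = (THE x. Phi x = p)"

lemma Phi_inv_Phi: "Phi_inv (Phi x) = x"
  unfolding Phi_inv_def by (rule the_equality) (auto, metis Phi_strict_mono less_irrefl linorder_neqE)

lemma Phi_Phi_inv: "0 < p \<Longrightarrow> p < 1 \<Longrightarrow> Phi (Phi_inv p) = p"
  using Phi_surj[of p] by (auto simp: Phi_inv_Phi)

lemma DERIV_Phi_inv:
  assumes "0 < p" "p < 1"
  shows "(Phi_inv has_real_derivative 1 / \<phi> (Phi_inv p)) (at p)"
proof -
  have "isCont Phi_inv (Phi (Phi_inv p))"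
    by (rule isCont_inverse_function[of 1]) (auto simp: Phi_inv_Phi DERIV_isCont[OF DERIV_Phi])
  then have c: "isCont Phi_inv p" using assms by (simp add: Phi_Phi_inv)
  show ?thesis
    using DERIV_inverse_function[OF DERIV_Phi less_imp_neq[OF phi_pos, symmetric] assms _ c] Phi_Phi_inv
    by (simp add: inverse_eq_divide)
qed

section \<open>An L1 Poincare inequality for the Gaussian measure\<close>

lemma primitive_on_affine:
  assumes P: "\<And>a b. primitive_on a b G H" and c: "c \<noteq> 0"
  shows "primitive_on a b (\<lambda>x. G (c * x)) (\<lambda>x. c * H (c * x))"
proof -
  have HI: "set_integrable lborel {a..b} H" for a b using P by (rule primitive_on_integrable)
  have inc: "(LBINT t:{a..b}. H t) = G b - G a" if "a \<le> b" for a b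
    using primitive_on_increment[OF P[of a b]] that by simp
  define J where "J = (\<lambda>a b. if c > 0 then {c * a..c * b} else {c * b..c * a})"
  have ind: "indicator (J a b) (c * t) = (indicator {a..b} t :: real)" for a b t
    using c by (auto simp: J_def indicator_def)
  have JI: "integrable lborel (\<lambda>t. indicator (J a b) t * H t)" for a b
    using HI by (auto simp: J_def set_integrable_def)
  have "set_integrable lborel {a..b} (\<lambda>t. H (c * t))" for a b
    using lborel_integrable_real_affine[OF JI c, of a b 0] by (simp add: ind set_integrable_def)
  then have I: "set_integrable lborel {a..b} (\<lambda>t. c * H (c * t))" for a b by auto
  have E: "(LBINT t:{a..b}. c * H (c * t)) = G (c * b) - G (c * a)" if "a \<le> b" for a b
  proof -
    have "(LBINT t. indicator (J a b) t * H t) = \<bar>c\<bar> * (LBINT t. indicator {a..b} t * H (c * t))"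
      by (subst lborel_integral_real_affine[OF c, of _ 0]) (simp add: ind)
    moreover have "(LBINT t. indicator (J a b) t * H t) = sgn c * (G (c * b) - G (c * a))"
      using that c inc[of "c * a" "c * b"] inc[of "c * b" "c * a"]
      by (auto simp: J_def set_lebesgue_integral_def sgn_if mult_left_mono mult_left_mono_neg)
    moreover have "\<bar>c\<bar> = sgn c * c" by (simp add: abs_sgn mult.commute)
    ultimately have "sgn c * (c * (LBINT t. indicator {a..b} t * H (c * t))) = sgn c * (G (c * b) - G (c * a))"
      by (simp only: mult.assoc)
    then have "c * (LBINT t. indicator {a..b} t * H (c * t)) = G (c * b) - G (c * a)"
      using c by (simp add: sgn_zero_iff)
    then show ?thesis by (simp add: set_lebesgue_integral_def mult.left_commute)
  qed
  show ?thesis unfolding primitive_on_def using I E by auto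
qed

text \<open>
  With \<open>K x\<close> the integral of \<open>\<bar>f'\<bar>\<close> over \<open>{0..x}\<close> one has \<open>\<bar>f x - f 0\<bar> \<le> K x\<close>, and integration by parts
  against \<open>1 - Phi\<close> moves the derivative onto \<open>K\<close>. The tail bound compares \<open>1 - Phi\<close> with \<open>\<phi>\<close>, with the
  constant \<open>sqrt (2 pi) / 2\<close>.
\<close>

lemma gaussian_poincare_half_line:
  fixes f f' :: "real \<Rightarrow> real"
  assumes P: "\<And>a b. primitive_on a b f f'" and [measurable]: "f' \<in> borel_measurable borel"
    and I: "integrable lborel (\<lambda>x. \<phi> x * f' x)"
  shows "integrable lborel (\<lambda>x. indicator {0..} x * (\<phi> x * \<bar>f x - f 0\<bar>))"
    and "(LBINT x. indicator {0..} x * (\<phi> x * \<bar>f x - f 0\<bar>))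
      \<le> sqrt (2 * pi) / 2 * (LBINT x. indicator {0..} x * (\<phi> x * \<bar>f' x\<bar>))"
proof -
  have f: "continuous_on UNIV f" using P by (rule primitive_on_continuous_UNIV)
  then have [measurable]: "f \<in> borel_measurable borel" by (rule borel_measurable_continuous_onI)
  have I': "integrable lborel (\<lambda>x. indicator {0..} x * (\<phi> x * \<bar>f' x\<bar>))"
    using integrable_mult_indicator[OF _ integrable_abs[OF I], of "{0..}"] by (simp add: abs_mult)
  have aI: "set_integrable lborel {a..b} (\<lambda>x. \<bar>f' x\<bar>)" for a b
    using primitive_on_integrable[OF P] by (rule set_integrable_abs)
  obtain K0 where K0: "\<And>a b. primitive_on a b K0 (\<lambda>x. \<bar>f' x\<bar>)"
    using primitive_exists[of "\<lambda>x. \<bar>f' x\<bar>"] aI by blast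
  define K where "K = (\<lambda>x. K0 x - K0 0)"
  have K: "primitive_on a b K (\<lambda>x. \<bar>f' x\<bar>)" for a b using K0[of a b] by (simp add: primitive_on_def K_def)
  have cK: "continuous_on A K" for A
    using primitive_on_continuous_UNIV[OF K] by (rule continuous_on_subset) simp
  have fK: "\<bar>f x - f 0\<bar> \<le> K x" if "0 \<le> x" for x
  proof -
    have "\<bar>f x - f 0\<bar> = \<bar>LBINT t:{0..x}. f' t\<bar>"
      using primitive_on_increment[OF P[of 0 x], of 0 x] that by simp
    also have "\<dots> \<le> (LBINT t. \<bar>indicator {0..x} t * f' t\<bar>)"
      unfolding set_lebesgue_integral_def using integral_abs_bound by simp
    also have "\<dots> = (LBINT t:{0..x}. \<bar>f' t\<bar>)" by (simp add: set_lebesgue_integral_def abs_mult)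
    also have "\<dots> = K x" using primitive_on_increment[OF K[of 0 x], of 0 x] that by (simp add: K_def)
    finally show ?thesis .
  qed
  define C where "C = sqrt (2 * pi) / 2 * (LBINT x. indicator {0..} x * (\<phi> x * \<bar>f' x\<bar>))"
  have gradient_const: "continuous_on {0..real n} (\<lambda>x. \<phi> x * \<bar>f x - f 0\<bar>)" for n
    by (intro continuous_intros continuous_on_phi continuous_on_subset[OF f]) simp
  have e1: "(\<lambda>x. indicator {..real n} x *\<^sub>R (indicator {0..} x * (\<phi> x * \<bar>f x - f 0\<bar>)))
    = (\<lambda>x. indicator {0..real n} x *\<^sub>R (\<phi> x * \<bar>f x - f 0\<bar>))" for n
    by (auto simp: indicator_def fun_eq_iff)
  have bound: "(LBINT x:{0..real n}. \<phi> x * \<bar>f x - f 0\<bar>) \<le> C" for n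
  proof -
    let ?n = "real n"
    have cPhi: "continuous_on A Phi" for A using DERIV_Phi by (meson DERIV_isCont continuous_at_imp_continuous_on)
    have pPsi: "primitive_on 0 ?n (\<lambda>x. 1 - Phi x) (\<lambda>x. - \<phi> x)"
      by (rule primitive_on_DERIV) (auto intro!: derivative_eq_intros DERIV_Phi continuous_intros continuous_on_phi)
    have i1: "set_integrable lborel {0..?n} (\<lambda>x. \<phi> x * K x)"
      by (intro borel_integrable_atLeastAtMost' continuous_intros continuous_on_phi cK)
    have i2: "set_integrable lborel {0..?n} (\<lambda>x. \<bar>f' x\<bar> * (1 - Phi x))"
      by (rule set_integrable_mult_continuous[OF aI]) (intro continuous_intros cPhi)
    have i3: "set_integrable lborel {0..?n} (\<lambda>x. \<bar>f' x\<bar> * (sqrt (2 * pi) / 2 * \<phi> x))"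
      by (rule set_integrable_mult_continuous[OF aI]) (intro continuous_intros continuous_on_phi)
    have "(LBINT x:{0..?n}. \<phi> x * \<bar>f x - f 0\<bar>) \<le> (LBINT x:{0..?n}. \<phi> x * K x)"
      by (rule set_integral_mono[OF borel_integrable_atLeastAtMost'[OF gradient_const] i1])
         (auto intro!: mult_left_mono fK)
    also have "(LBINT x:{0..?n}. \<bar>f' x\<bar> * (1 - Phi x) + K x * (- \<phi> x)) = K ?n * (1 - Phi ?n) - K 0 * (1 - Phi 0)"
      by (rule integral_by_parts_primitive[OF K pPsi]) simp
    then have "(LBINT x:{0..?n}. \<bar>f' x\<bar> * (1 - Phi x)) - (LBINT x:{0..?n}. \<phi> x * K x) = K ?n * (1 - Phi ?n)"
      using set_integral_diff(2)[OF i2 i1] by (simp add: K_def mult.commute)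
    then have "(LBINT x:{0..?n}. \<phi> x * K x) \<le> (LBINT x:{0..?n}. \<bar>f' x\<bar> * (1 - Phi x))"
      using fK[of ?n] Phi_bounds(2)[of ?n] mult_nonneg_nonneg[of "K ?n" "1 - Phi ?n"] by linarith
    also have "\<dots> \<le> (LBINT x:{0..?n}. \<bar>f' x\<bar> * (sqrt (2 * pi) / 2 * \<phi> x))"
    proof (rule set_integral_mono[OF i2 i3])
      fix x assume "x \<in> {0..?n}"
      then have "1 - Phi x \<le> sqrt (2 * pi) / 2 * \<phi> x"
        using Phi_upper_tail[of x] by (simp add: std_normal_density_def)
      then show "\<bar>f' x\<bar> * (1 - Phi x) \<le> \<bar>f' x\<bar> * (sqrt (2 * pi) / 2 * \<phi> x)" by (rule mult_left_mono) simp
    qed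
    also have "\<dots> = sqrt (2 * pi) / 2 * (LBINT x. indicator {0..?n} x * (\<phi> x * \<bar>f' x\<bar>))"
      unfolding set_lebesgue_integral_def
      by (subst integral_mult_right_zero[symmetric], rule Bochner_Integration.integral_cong[OF refl])
         (simp only: real_scaleR_def mult_ac)
    also have "(LBINT x. indicator {0..?n} x * (\<phi> x * \<bar>f' x\<bar>)) \<le> (LBINT x. indicator {0..} x * (\<phi> x * \<bar>f' x\<bar>))"
    proof (rule integral_mono[OF _ I'])
      show "integrable lborel (\<lambda>x. indicator {0..?n} x * (\<phi> x * \<bar>f' x\<bar>))"
        using integrable_mult_indicator[OF _ integrable_abs[OF I], of "{0..?n}"] by (simp add: abs_mult)
    qed (auto simp: indicator_def)
    finally show ?thesis unfolding C_def by simp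
  qed
  have S: "set_integrable lborel {..real n} (\<lambda>x. indicator {0..} x * (\<phi> x * \<bar>f x - f 0\<bar>))" for n
    using borel_integrable_atLeastAtMost'[OF gradient_const[of n]] unfolding set_integrable_def e1 .
  have B: "(LBINT x:{..real n}. indicator {0..} x * (\<phi> x * \<bar>f x - f 0\<bar>)) \<le> C" for n
    using bound[of n] unfolding set_lebesgue_integral_def e1 .
  have ev: "eventually (\<lambda>n. x \<in> {..real n} \<or> indicator {0..} x * (\<phi> x * \<bar>f x - f 0\<bar>) = 0) sequentially" for x
  proof -
    obtain N where "x \<le> real N" using real_arch_simple by blast
    then show ?thesis by (intro eventually_sequentiallyI[of N]) auto
  qed
  have W0: "0 \<le> indicator {0..} x * (\<phi> x * \<bar>f x - f 0\<bar>)" for x by (simp add: phi_nonneg)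
  have W: "(\<lambda>x. indicator {0..} x * (\<phi> x * \<bar>f x - f 0\<bar>)) \<in> borel_measurable lborel" by measurable
  note ex = integrable_exhaust[where A="\<lambda>n. {..real n}" and c="\<lambda>_. C" and C=C, OF W _ W0 ev S B tendsto_const]
  show "integrable lborel (\<lambda>x. indicator {0..} x * (\<phi> x * \<bar>f x - f 0\<bar>))" by (rule ex) simp
  show "(LBINT x. indicator {0..} x * (\<phi> x * \<bar>f x - f 0\<bar>))
      \<le> sqrt (2 * pi) / 2 * (LBINT x. indicator {0..} x * (\<phi> x * \<bar>f' x\<bar>))"
    unfolding C_def[symmetric] by (rule ex) simp
qed

text \<open>
  The two half-lines are exchanged by reflection, which bounds \<open>\<integral> \<phi> \<bar>f - f 0\<bar>\<close>. Replacing \<open>f 0\<close> by the mean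
  costs at most the same amount again.
\<close>

lemma gaussian_poincare_L1:
  fixes f f' :: "real \<Rightarrow> real"
  assumes P: "\<And>a b. primitive_on a b f f'" and [measurable]: "f' \<in> borel_measurable borel"
    and I: "integrable lborel (\<lambda>x. \<phi> x * f' x)"
  shows "integrable lborel (\<lambda>x. \<phi> x * f x)"
    and "(LBINT x. \<phi> x * \<bar>f x - (LBINT y. \<phi> y * f y)\<bar>) \<le> sqrt (2 * pi) * (LBINT x. \<phi> x * \<bar>f' x\<bar>)"
proof -
  have f: "continuous_on UNIV f" using P by (rule primitive_on_continuous_UNIV)
  then have [measurable]: "f \<in> borel_measurable borel" by (rule borel_measurable_continuous_onI)
  have P': "primitive_on a b (\<lambda>x. f (- x)) (\<lambda>x. - f' (- x))" for a b
    using primitive_on_affine[OF P, of "-1" a b] by simp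
  have I': "integrable lborel (\<lambda>x. \<phi> x * - f' (- x))"
    using lborel_integrable_real_affine[OF I, of "-1" 0] by (simp add: phi_minus)
  note right = gaussian_poincare_half_line[OF P assms(2) I]
  have m': "(\<lambda>x. - f' (- x)) \<in> borel_measurable borel" by measurable
  note left0 = gaussian_poincare_half_line[OF P' m' I']
  have left1: "integrable lborel (\<lambda>x. indicator {..0} x * (\<phi> x * \<bar>f x - f 0\<bar>))"
    using lborel_integrable_real_affine[OF left0(1), of "-1" 0] by (simp add: phi_minus indicator_def)
  have r: "(LBINT x. g x) = (LBINT x. g (- x))" for g :: "real \<Rightarrow> real"
    by (subst lborel_integral_real_affine[of "-1" _ 0]) auto
  have left2: "(LBINT x. indicator {..0} x * (\<phi> x * \<bar>f x - f 0\<bar>))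
      \<le> sqrt (2 * pi) / 2 * (LBINT x. indicator {..0} x * (\<phi> x * \<bar>f' x\<bar>))"
    using left0(2) unfolding r[of "\<lambda>x. indicator {0..} x * _ x"] by (simp add: phi_minus indicator_def)
  define g where "g = (\<lambda>x. \<phi> x * \<bar>f x - f 0\<bar>)"
  have [measurable]: "g \<in> borel_measurable borel" unfolding g_def by measurable
  have ga: "AE x in lborel. g x = indicator {0..} x * g x + indicator {..0} x * g x"
    using AE_lborel_singleton[of 0] by eventually_elim (auto simp: indicator_def)
  have gR: "integrable lborel (\<lambda>x. indicator {0..} x * g x + indicator {..0} x * g x)"
    using right(1) left1 by (simp add: g_def)
  have gI: "integrable lborel g"
    by (subst integrable_cong_AE[OF _ _ ga]) (use gR in auto)
  have IA: "integrable lborel (\<lambda>x. \<phi> x * \<bar>f' x\<bar>)" using integrable_abs[OF I] by (simp add: abs_mult)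
  have II: "integrable lborel (\<lambda>x. indicator A x * (\<phi> x * \<bar>f' x\<bar>))" if "A \<in> sets borel" for A
    using integrable_mult_indicator[OF _ IA, of A] that by simp
  have "(LBINT x. g x) = (LBINT x. indicator {0..} x * g x + indicator {..0} x * g x)"
    by (rule integral_cong_AE[OF _ _ ga]) auto
  also have "\<dots> = (LBINT x. indicator {0..} x * g x) + (LBINT x. indicator {..0} x * g x)"
    using right(1) left1 by (simp add: g_def)
  also have "\<dots> \<le> sqrt (2 * pi) / 2 * ((LBINT x. indicator {0..} x * (\<phi> x * \<bar>f' x\<bar>)) + (LBINT x. indicator {..0} x * (\<phi> x * \<bar>f' x\<bar>)))"
    using right(2) left2 by (simp add: g_def distrib_left)
  also have "(LBINT x. indicator {0..} x * (\<phi> x * \<bar>f' x\<bar>)) + (LBINT x. indicator {..0} x * (\<phi> x * \<bar>f' x\<bar>))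
      = (LBINT x. indicator {0..} x * (\<phi> x * \<bar>f' x\<bar>) + indicator {..0} x * (\<phi> x * \<bar>f' x\<bar>))"
    using II by simp
  also have "\<dots> = (LBINT x. \<phi> x * \<bar>f' x\<bar>)"
  proof (rule integral_cong_AE)
    show "AE x in lborel. indicator {0..} x * (\<phi> x * \<bar>f' x\<bar>) + indicator {..0} x * (\<phi> x * \<bar>f' x\<bar>) = \<phi> x * \<bar>f' x\<bar>"
      using AE_lborel_singleton[of 0] by eventually_elim (auto simp: indicator_def)
  qed measurable
  finally have G: "(LBINT x. g x) \<le> sqrt (2 * pi) / 2 * (LBINT x. \<phi> x * \<bar>f' x\<bar>)" .
  have dI: "integrable lborel (\<lambda>x. \<phi> x * (f x - f 0))"
    by (rule Bochner_Integration.integrable_bound[OF gI]) (auto simp: g_def abs_mult)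
  have cI: "integrable lborel (\<lambda>x. \<phi> x * c)" for c using integrable_phi by simp
  have "integrable lborel (\<lambda>x. \<phi> x * (f x - f 0) + \<phi> x * f 0)" by (intro Bochner_Integration.integrable_add dI cI)
  then show fI: "integrable lborel (\<lambda>x. \<phi> x * f x)" by (simp add: algebra_simps)
  define c where "c = (LBINT y. \<phi> y * f y)"
  have "(LBINT x. \<phi> x * (f x - f 0)) = c - f 0"
    using fI cI[of "f 0"] by (simp add: right_diff_distrib c_def integral_phi)
  moreover have "\<bar>LBINT x. \<phi> x * (f x - f 0)\<bar> \<le> (LBINT x. g x)"
    using integral_abs_bound[of lborel "\<lambda>x. \<phi> x * (f x - f 0)"] by (simp add: g_def abs_mult)
  ultimately have cf: "\<bar>f 0 - c\<bar> \<le> (LBINT x. g x)" by simp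
  have "(LBINT x. \<phi> x * \<bar>f x - c\<bar>) \<le> (LBINT x. g x + \<phi> x * \<bar>f 0 - c\<bar>)"
  proof (rule integral_mono)
    show "integrable lborel (\<lambda>x. g x + \<phi> x * \<bar>f 0 - c\<bar>)" by (intro Bochner_Integration.integrable_add gI cI)
    have "integrable lborel (\<lambda>x. \<phi> x * f x - \<phi> x * c)" by (intro Bochner_Integration.integrable_diff fI cI)
    from integrable_abs[OF this] show "integrable lborel (\<lambda>x. \<phi> x * \<bar>f x - c\<bar>)"
      by (simp add: right_diff_distrib[symmetric] abs_mult)
    fix x
    have "\<phi> x * \<bar>f x - c\<bar> \<le> \<phi> x * (\<bar>f x - f 0\<bar> + \<bar>f 0 - c\<bar>)" by (intro mult_left_mono) (auto simp: phi_nonneg)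
    then show "\<phi> x * \<bar>f x - c\<bar> \<le> g x + \<phi> x * \<bar>f 0 - c\<bar>" by (simp add: g_def distrib_left)
  qed
  also have "\<dots> = (LBINT x. g x) + \<bar>f 0 - c\<bar>" using gI cI[of "\<bar>f 0 - c\<bar>"] by (simp add: integral_phi)
  finally show "(LBINT x. \<phi> x * \<bar>f x - (LBINT y. \<phi> y * f y)\<bar>) \<le> sqrt (2 * pi) * (LBINT x. \<phi> x * \<bar>f' x\<bar>)"
    using cf G unfolding c_def[symmetric] by simp
qed

section \<open>Monotone transport onto the Gaussian measure\<close>

text \<open>
  The setting of the transport argument: \<open>u\<close> is the root of a density with respect to the standard Gaussian, and \<open>s\<close>
  plays the role of \<open>u'\<close>. Only \<open>(u\<^sup>2)' = 2 u s\<close> is demanded. This leaves \<open>s\<close> free on the zero set of \<open>u\<close>, where the two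
  deficits to be treated differ: \<open>f'\<^sup>2 / f\<close> is 0 there by convention, while \<open>u'\<^sup>2\<close> is kept.
\<close>

locale gaussian_transport =
  fixes u s :: "real \<Rightarrow> real" and \<alpha> :: real
  assumes u_cont: "continuous_on UNIV u" and u_nonneg: "\<And>x. 0 \<le> u x"
    and s_borel [measurable]: "s \<in> borel_measurable borel"
    and prim_u2: "\<And>a b. primitive_on a b (\<lambda>x. (u x)\<^sup>2) (\<lambda>x. 2 * u x * s x)"
    and int_u2: "integrable lborel (\<lambda>x. \<phi> x * (u x)\<^sup>2)"
    and mass: "(LBINT x. \<phi> x * (u x)\<^sup>2) = 1"
    and int_xu: "integrable lborel (\<lambda>x. \<phi> x * (x * u x)\<^sup>2)"
    and moment: "(LBINT x. \<phi> x * (x * u x)\<^sup>2) \<le> \<alpha>"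
    and centered: "(LBINT x. x * (\<phi> x * (u x)\<^sup>2)) = 0"
    and int_s2: "integrable lborel (\<lambda>x. \<phi> x * (s x)\<^sup>2)"
begin

lemma u_borel [measurable]: "u \<in> borel_measurable borel"
  using u_cont by (rule borel_measurable_continuous_onI)

definition F :: "real \<Rightarrow> real" where "F x = \<phi> x * (u x)\<^sup>2"

lemma F_nonneg: "0 \<le> F x" by (simp add: F_def phi_nonneg)

lemma F_cont: "continuous_on A F"
  unfolding F_def by (intro continuous_intros continuous_on_phi continuous_on_subset[OF u_cont]) simp

lemma F_borel [measurable]: "F \<in> borel_measurable borel"
  using F_cont by (rule borel_measurable_continuous_onI)

lemma F_int: "integrable lborel F" and F_mass: "(LBINT x. F x) = 1"
  using int_u2 mass by (simp_all add: F_def[abs_def])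

lemma F_prim: "primitive_on a b F (\<lambda>x. \<phi> x * (u x * (2 * s x - x * u x)))"
proof -
  have "primitive_on a b \<phi> (\<lambda>x. - x * \<phi> x)"
    by (rule primitive_on_DERIV[OF DERIV_phi]) (intro continuous_intros continuous_on_phi)
  from primitive_on_mult[OF this prim_u2] show ?thesis
    by (rule primitive_on_cong) (auto simp: F_def power2_eq_square algebra_simps)
qed

definition G :: "real \<Rightarrow> real" where "G = cumul F"

lemma DERIV_G: "(G has_real_derivative F x) (at x)"
  unfolding G_def by (rule DERIV_cumul[OF F_int F_cont])

lemma G_cont: "continuous_on A G"
  using DERIV_G by (meson DERIV_isCont continuous_at_imp_continuous_on)

lemma G_bounds: "0 \<le> G x" "G x \<le> 1"
  using cumul_bounds[OF F_int F_nonneg, of x] by (simp_all add: G_def F_mass)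

lemma G_mono: "x \<le> y \<Longrightarrow> G x \<le> G y"
  unfolding G_def by (rule cumul_mono[OF F_int F_nonneg])

lemma G_diff: "x \<le> y \<Longrightarrow> G y - G x = (LBINT t:{x..y}. F t)"
  unfolding G_def by (rule cumul_diff[OF F_int])

text \<open>
  Cauchy-Schwarz for the increments of a primitive with density \<open>\<phi> u w\<close>: one factor is the mass of the
  interval. It is used twice, for \<open>F\<close> itself and for the difference of \<open>F\<close> and \<open>\<phi> (T x)\<close>.
\<close>

lemma increment_bound:
  assumes P: "primitive_on x y P (\<lambda>t. \<phi> t * (u t * w t))" and xy: "x \<le> y"
    and [measurable]: "w \<in> borel_measurable borel" and W: "integrable lborel (\<lambda>t. \<phi> t * (w t)\<^sup>2)"
    and S: "(LBINT t. \<phi> t * (w t)\<^sup>2) \<le> S"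
  shows "\<bar>P y - P x\<bar> \<le> sqrt S * sqrt (G y - G x)"
proof -
  let ?p = "\<lambda>t. indicator {x..y} t * u t"
  have e: "\<phi> t * (?p t)\<^sup>2 = indicator {x..y} t *\<^sub>R F t" for t
    by (auto simp: indicator_def F_def)
  have I: "integrable lborel (\<lambda>t. \<phi> t * (?p t)\<^sup>2)"
    unfolding e by (rule integrable_mult_indicator[OF _ F_int]) simp
  have "P y - P x = (LBINT t. \<phi> t * (?p t * w t))"
    using primitive_on_increment[OF P, of x y] xy
    by (simp add: set_lebesgue_integral_def mult.left_commute mult.assoc)
  then have "\<bar>P y - P x\<bar> \<le> (LBINT t. \<bar>\<phi> t * (?p t * w t)\<bar>)" by simp
  also have "\<dots> = (LBINT t. \<phi> t * \<bar>?p t * w t\<bar>)" by (simp add: abs_mult)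
  also have "\<dots> \<le> sqrt (LBINT t. \<phi> t * (?p t)\<^sup>2) * sqrt (LBINT t. \<phi> t * (w t)\<^sup>2)"
    by (rule weighted_Cauchy_Schwarz(2)[OF _ _ _ _ I W]) (auto simp: phi_nonneg)
  also have "(LBINT t. \<phi> t * (?p t)\<^sup>2) = G y - G x"
    using G_diff[OF xy] by (simp only: e set_lebesgue_integral_def)
  also have "sqrt (G y - G x) * sqrt (LBINT t. \<phi> t * (w t)\<^sup>2) \<le> sqrt (G y - G x) * sqrt S"
    by (intro mult_left_mono real_sqrt_le_mono S) (use G_mono[OF xy] in simp)
  finally show ?thesis by (simp add: mult.commute)
qed

definition K :: real where "K = sqrt (LBINT t. \<phi> t * (2 * s t - t * u t)\<^sup>2)"

lemma int_fisher: "integrable lborel (\<lambda>t. \<phi> t * (2 * s t - t * u t)\<^sup>2)"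
proof (rule Bochner_Integration.integrable_bound[OF Bochner_Integration.integrable_add])
  show "integrable lborel (\<lambda>t. 8 * (\<phi> t * (s t)\<^sup>2))" "integrable lborel (\<lambda>t. 2 * (\<phi> t * (t * u t)\<^sup>2))"
    using int_s2 int_xu by auto
  show "AE t in lborel. norm (\<phi> t * (2 * s t - t * u t)\<^sup>2) \<le> norm (8 * (\<phi> t * (s t)\<^sup>2) + 2 * (\<phi> t * (t * u t)\<^sup>2))"
  proof (rule AE_I2)
    fix t
    have "(2 * s t - t * u t)\<^sup>2 \<le> 8 * (s t)\<^sup>2 + 2 * (t * u t)\<^sup>2"
      using zero_le_power2[of "2 * s t + t * u t"] by (simp add: power2_sum power2_diff power_mult_distrib)
    then have "\<phi> t * (2 * s t - t * u t)\<^sup>2 \<le> \<phi> t * (8 * (s t)\<^sup>2 + 2 * (t * u t)\<^sup>2)"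
      by (intro mult_left_mono) (simp_all add: phi_nonneg)
    then show "norm (\<phi> t * (2 * s t - t * u t)\<^sup>2) \<le> norm (8 * (\<phi> t * (s t)\<^sup>2) + 2 * (\<phi> t * (t * u t)\<^sup>2))"
      using phi_pos[of t] by (simp add: abs_mult algebra_simps)
  qed
qed measurable

lemma K_nonneg: "0 \<le> K"
  unfolding K_def by (intro real_sqrt_ge_zero Bochner_Integration.integral_nonneg mult_nonneg_nonneg) (auto simp: phi_nonneg)

lemma F_increment: "x \<le> y \<Longrightarrow> \<bar>F y - F x\<bar> \<le> K * sqrt (G y - G x)"
  unfolding K_def by (rule increment_bound[OF F_prim]) (auto intro: int_fisher)

text \<open>
  By the increment bound a failure of the inequality at \<open>x\<close> by \<open>e\<close> forces \<open>F \<ge> e\<close> on the whole half-line to the left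
  of \<open>x\<close>, so that an interval of length \<open>2 / e\<close> would carry mass 2.
\<close>

lemma F_le_left: "F x \<le> K * sqrt (G x)"
proof (rule ccontr)
  define e where "e = F x - K * sqrt (G x)"
  assume "\<not> ?thesis"
  then have e: "e > 0" by (simp add: e_def)
  define z where "z = x - 2 / e"
  have zx: "z \<le> x" using e by (simp add: z_def)
  have "e \<le> F t" if "t \<le> x" for t
  proof -
    have "F x - F t \<le> K * sqrt (G x - G t)" using F_increment[OF that] by linarith
    also have "\<dots> \<le> K * sqrt (G x)" using G_bounds[of t] by (intro mult_left_mono real_sqrt_le_mono) (auto simp: K_nonneg)
    finally show ?thesis by (simp add: e_def)
  qed
  then have "(LBINT t:{z..x}. e) \<le> (LBINT t:{z..x}. F t)"
    by (intro set_integral_mono borel_integrable_atLeastAtMost' F_cont continuous_intros) auto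
  also have "\<dots> \<le> 1" using G_diff[OF zx] G_bounds[of x] G_bounds[of z] by simp
  also have "(LBINT t:{z..x}. e) = 2" using zx e by (subst set_integral_const) (simp_all add: z_def)
  finally show False by simp
qed

text \<open>
  As before, on the half-line to the right of \<open>x\<close>.
\<close>

lemma F_le_right: "F x \<le> K * sqrt (1 - G x)"
proof (rule ccontr)
  define e where "e = F x - K * sqrt (1 - G x)"
  assume "\<not> ?thesis"
  then have e: "e > 0" by (simp add: e_def)
  define z where "z = x + 2 / e"
  have zx: "x \<le> z" using e by (simp add: z_def)
  have "e \<le> F t" if "x \<le> t" for t
  proof -
    have "F x - F t \<le> K * sqrt (G t - G x)" using F_increment[OF that] by linarith
    also have "\<dots> \<le> K * sqrt (1 - G x)" using G_bounds[of t] by (intro mult_left_mono real_sqrt_le_mono) (auto simp: K_nonneg)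
    finally show ?thesis by (simp add: e_def)
  qed
  then have "(LBINT t:{x..z}. e) \<le> (LBINT t:{x..z}. F t)"
    by (intro set_integral_mono borel_integrable_atLeastAtMost' F_cont continuous_intros) auto
  also have "\<dots> \<le> 1" using G_diff[OF zx] G_bounds[of x] G_bounds[of z] by simp
  also have "(LBINT t:{x..z}. e) = 2" using zx e by (subst set_integral_const) (simp_all add: z_def)
  finally show False by simp
qed

lemma F_eq_0: "\<not> (0 < G x \<and> G x < 1) \<Longrightarrow> F x = 0"
  using F_le_left[of x] F_le_right[of x] F_nonneg[of x] G_bounds[of x]
  by (cases "G x = 0"; cases "G x = 1") simp_all

lemma u_eq_0: "\<not> (0 < G x \<and> G x < 1) \<Longrightarrow> u x = 0"
  using F_eq_0[of x] phi_pos[of x] by (simp add: F_def)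

text \<open>
  A right inverse of the transport map. The density may vanish on intervals, and then \<open>X\<close> jumps over them. It is
  monotone and satisfies \<open>T (X t) = t\<close>, which serves to cut the line at prescribed values of \<open>T\<close>.
\<close>

definition X :: "real \<Rightarrow> real" where "X t = (SOME x. G x = Phi t)"

lemma G_X: "G (X t) = Phi t"
proof -
  have "\<exists>x. G x = Phi t" unfolding G_def
    by (rule cumul_surj[OF F_int F_cont]) (simp_all add: F_mass Phi_bounds)
  then show ?thesis unfolding X_def by (rule someI_ex)
qed

lemma X_less: "a < b \<Longrightarrow> X a < X b"
  using Phi_strict_mono[of a b] G_mono[of "X b" "X a"] unfolding G_X by linarith

lemma X_le: "a \<le> b \<Longrightarrow> X a \<le> X b"
  using X_less[of a b] by (cases "a = b") auto

text \<open>
  Where the distribution function is 0 or 1 there is no mass, and the value \<open>x\<close> makes the displacement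
  \<open>T x - x\<close> vanish there.
\<close>

definition T :: "real \<Rightarrow> real" where
  "T x = (if 0 < G x \<and> G x < 1 then Phi_inv (G x) else x)"

lemma T_X: "T (X t) = t" by (simp add: T_def G_X Phi_bounds Phi_inv_Phi)

lemma Phi_T: "0 < G x \<Longrightarrow> G x < 1 \<Longrightarrow> Phi (T x) = G x" by (simp add: T_def Phi_Phi_inv)

lemma X_interval:
  assumes "X a \<le> x" "x \<le> X b"
  shows "0 < G x" "G x < 1" "a \<le> T x" "T x \<le> b"
proof -
  have *: "Phi a \<le> G x" "G x \<le> Phi b" using G_mono[OF assms(1)] G_mono[OF assms(2)] by (simp_all add: G_X)
  then show 1: "0 < G x" "G x < 1" using Phi_bounds[of a] Phi_bounds[of b] by auto
  show "a \<le> T x" using * Phi_T[OF 1] Phi_strict_mono[of "T x" a] by linarith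
  show "T x \<le> b" using * Phi_T[OF 1] Phi_strict_mono[of b "T x"] by linarith
qed

lemma DERIV_T:
  assumes "0 < G x" "G x < 1"
  shows "(T has_real_derivative F x / \<phi> (T x)) (at x)"
proof -
  have "((\<lambda>y. Phi_inv (G y)) has_real_derivative 1 / \<phi> (Phi_inv (G x)) * F x) (at x)"
    by (rule DERIV_chain2[OF DERIV_Phi_inv[OF assms] DERIV_G])
  moreover have "eventually (\<lambda>y. Phi_inv (G y) = T y) (nhds x)"
  proof -
    have "open {y. 0 < G y \<and> G y < 1}"
      by (intro open_Collect_conj open_Collect_less continuous_intros G_cont)
    then have "eventually (\<lambda>y. y \<in> {y. 0 < G y \<and> G y < 1}) (nhds x)"
      by (rule eventually_nhds_in_open) (use assms in auto)
    then show ?thesis by eventually_elim (auto simp: T_def)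
  qed
  ultimately have "(T has_real_derivative 1 / \<phi> (Phi_inv (G x)) * F x) (at x)"
    by (subst (asm) DERIV_cong_ev[OF refl _ refl])
  then show ?thesis using assms by (simp add: T_def)
qed

definition q :: "real \<Rightarrow> real" where "q x = F x / \<phi> (T x)"

lemma DERIV_T_q: "X a \<le> x \<Longrightarrow> x \<le> X b \<Longrightarrow> (T has_real_derivative q x) (at x)"
  unfolding q_def using X_interval by (intro DERIV_T) auto

lemma T_cont: "continuous_on {X a..X b} T"
  by (intro continuous_at_imp_continuous_on ballI DERIV_isCont[OF DERIV_T_q]) auto

lemma phiT_cont: "continuous_on {X a..X b} (\<lambda>x. \<phi> (T x))"
  by (rule continuous_on_compose2[OF continuous_on_phi T_cont]) auto

lemma q_cont: "continuous_on {X a..X b} q"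
  unfolding q_def by (intro continuous_intros F_cont phiT_cont) (simp add: less_imp_neq[OF phi_pos, symmetric])

lemma q_phi: "q x * \<phi> (T x) = F x" using phi_pos[of "T x"] by (simp add: q_def)

lemma T_borel [measurable]: "T \<in> borel_measurable borel"
proof -
  have G_borel: "G \<in> borel_measurable borel" using G_cont by (rule borel_measurable_continuous_onI)
  define J where "J = {x. 0 < G x \<and> G x < 1}"
  have oJ: "open J" unfolding J_def
    by (intro open_Collect_conj open_Collect_less continuous_intros G_cont)
  have "continuous_on J T"
    by (rule continuous_at_imp_continuous_on) (auto simp: J_def intro: DERIV_isCont DERIV_T)
  then have "(\<lambda>x. if x \<in> J then T x else x) \<in> borel_measurable borel"
    using oJ by (intro borel_measurable_continuous_on_if) (auto intro: continuous_intros)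
  moreover have "(\<lambda>x. if x \<in> J then T x else x) = T" by (auto simp: J_def T_def)
  ultimately show ?thesis by simp
qed

text \<open>
  The exhaustion used for the limits below. The union of the intervals consists of the points with \<open>0 < G x < 1\<close>, and the
  remaining points carry no mass, but may carry a part of \<open>\<integral> \<phi> s\<^sup>2\<close>.
\<close>

definition A :: "nat \<Rightarrow> real set" where "A n = {X (- real n)..X (real n)} \<union> {x. \<not> (0 < G x \<and> G x < 1)}"

lemma J_closed: "closed {x. \<not> (0 < G x \<and> G x < 1)}"
proof -
  have "{x. \<not> (0 < G x \<and> G x < 1)} = {x. G x \<le> 0} \<union> {x. 1 \<le> G x}" by auto
  then show ?thesis by (auto intro!: closed_Collect_le continuous_intros G_cont)
qed

lemma A_borel [measurable]: "A n \<in> sets borel"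
  unfolding A_def using J_closed by (intro sets.Un borel_closed) auto

lemma Phi_nat_top: "(\<lambda>n. Phi (real n)) \<longlonglongrightarrow> 1" and Phi_nat_bot: "(\<lambda>n. Phi (- real n)) \<longlonglongrightarrow> 0"
  using cumul_at_top[OF integrable_phi] cumul_at_bot[OF integrable_phi] by (simp_all add: Phi_def integral_phi)

lemma eventually_less_X:
  assumes "G x < 1" shows "eventually (\<lambda>n. x < X (real n)) sequentially"
  using order_tendstoD(1)[OF Phi_nat_top assms]
proof eventually_elim
  case (elim n) then show ?case using G_mono[of "X (real n)" x] unfolding G_X by linarith
qed

lemma eventually_X_less:
  assumes "0 < G x" shows "eventually (\<lambda>n. X (- real n) < x) sequentially"
  using order_tendstoD(2)[OF Phi_nat_bot assms]
proof eventually_elim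
  case (elim n) then show ?case using G_mono[of x "X (- real n)"] unfolding G_X by linarith
qed

lemma eventually_in_A: "eventually (\<lambda>n. x \<in> A n) sequentially"
proof (cases "0 < G x \<and> G x < 1")
  case True
  then have "eventually (\<lambda>n. x < X (real n)) sequentially" "eventually (\<lambda>n. X (- real n) < x) sequentially"
    by (auto intro: eventually_less_X eventually_X_less)
  then show ?thesis by eventually_elim (auto simp: A_def)
qed (auto simp: A_def)

lemma A_split:
  fixes W :: "real \<Rightarrow> real"
  assumes "\<And>x. \<not> (0 < G x \<and> G x < 1) \<Longrightarrow> W x = 0"
  shows "indicator (A n) x *\<^sub>R W x = indicator {X (- real n)..X (real n)} x *\<^sub>R W x"
  using assms[of x] by (auto simp: A_def indicator_def)

section \<open>The deficit controls the gradient up to the displacement\<close>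

text \<open>
  The integrand of the deficit, \<open>\<phi> (f'\<^sup>2 / (2 f) - f ln f)\<close> for \<open>f = u\<^sup>2\<close> and \<open>s = u'\<close>.
\<close>

definition E :: "real \<Rightarrow> real" where "E x = \<phi> x * (2 * (s x)\<^sup>2 - (u x)\<^sup>2 * ln ((u x)\<^sup>2))"

definition D :: real where "D = (LBINT x. E x)"

definition \<theta> :: "real \<Rightarrow> real" where "\<theta> x = T x - x"

definition W :: "real \<Rightarrow> real" where "W x = \<phi> x * (2 * s x + \<theta> x * u x)\<^sup>2"

lemma theta_borel [measurable]: "\<theta> \<in> borel_measurable borel" unfolding \<theta>_def by measurable

lemma W_borel [measurable]: "W \<in> borel_measurable borel" unfolding W_def by measurable

lemma W_nonneg: "0 \<le> W x" by (simp add: W_def phi_nonneg)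

lemma F_le_K: "F x \<le> K"
proof -
  have "sqrt (G x) \<le> 1" using G_bounds[of x] by simp
  then have "K * sqrt (G x) \<le> K * 1" by (rule mult_left_mono) (rule K_nonneg)
  then show ?thesis using F_le_left[of x] by simp
qed

text \<open>
  The lower bound is \<open>t ln t \<ge> -1\<close>. For the upper bound, \<open>F\<close> is bounded, so that \<open>ln (u\<^sup>2) = ln (F / \<phi>)\<close> is
  at most \<open>c + x\<^sup>2 / 2\<close>, and the second moment is finite.
\<close>

lemma int_entropy: "integrable lborel (\<lambda>x. \<phi> x * ((u x)\<^sup>2 * ln ((u x)\<^sup>2)))"
proof -
  define c where "c = ln (K + 1) + ln (sqrt (2 * pi))"
  have "ln (1::real) \<le> ln (sqrt (2 * pi))" using pi_gt3 by (intro ln_mono) auto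
  then have c0: "0 \<le> c" using K_nonneg by (simp add: c_def)
  have I: "integrable lborel (\<lambda>x. \<phi> x + (c * F x + 1/2 * (\<phi> x * (x * u x)\<^sup>2)))"
    by (intro Bochner_Integration.integrable_add integrable_mult_right integrable_phi F_int int_xu)
  show ?thesis
  proof (rule Bochner_Integration.integrable_bound[OF I])
    show "AE x in lborel. norm (\<phi> x * ((u x)\<^sup>2 * ln ((u x)\<^sup>2))) \<le> norm (\<phi> x + (c * F x + 1/2 * (\<phi> x * (x * u x)\<^sup>2)))"
    proof (rule AE_I2)
      fix x
      let ?v = "(u x)\<^sup>2"
      have lo: "-1 \<le> ?v * ln ?v" by (rule x_ln_x_lower) simp
      have up: "?v * ln ?v \<le> ?v * (c + x\<^sup>2 / 2)"
      proof (cases "u x = 0")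
        case False
        then have Fp: "0 < F x" using phi_pos[of x] by (simp add: F_def)
        have "?v = F x * (sqrt (2 * pi) * exp (x\<^sup>2 / 2))"
          by (simp add: F_def std_normal_density_def exp_minus)
        then have "ln ?v = ln (F x) + (ln (sqrt (2 * pi)) + x\<^sup>2 / 2)"
          using Fp by (simp add: ln_mult)
        also have "ln (F x) \<le> ln (K + 1)" using Fp F_le_K[of x] by simp
        finally have "ln ?v \<le> c + x\<^sup>2 / 2" by (simp add: c_def)
        then show ?thesis by (rule mult_left_mono) simp
      qed simp
      have "0 \<le> ?v * (c + x\<^sup>2 / 2)" using c0 by simp
      then have "\<bar>?v * ln ?v\<bar> \<le> 1 + ?v * (c + x\<^sup>2 / 2)" using lo up by linarith
      then have "\<phi> x * \<bar>?v * ln ?v\<bar> \<le> \<phi> x * (1 + ?v * (c + x\<^sup>2 / 2))"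
        by (rule mult_left_mono) (simp add: phi_nonneg)
      also have "\<dots> = \<phi> x + (c * F x + 1/2 * (\<phi> x * (x * u x)\<^sup>2))"
        by (simp add: F_def algebra_simps power_mult_distrib)
      finally show "norm (\<phi> x * ((u x)\<^sup>2 * ln ((u x)\<^sup>2))) \<le> norm (\<phi> x + (c * F x + 1/2 * (\<phi> x * (x * u x)\<^sup>2)))"
        using phi_pos[of x] by (simp add: abs_mult)
    qed
  qed measurable
qed

lemma int_E: "integrable lborel E"
  and D_eq: "D = 2 * (LBINT x. \<phi> x * (s x)\<^sup>2) - (LBINT x. \<phi> x * ((u x)\<^sup>2 * ln ((u x)\<^sup>2)))"
proof -
  have e: "E = (\<lambda>x. 2 * (\<phi> x * (s x)\<^sup>2) - \<phi> x * ((u x)\<^sup>2 * ln ((u x)\<^sup>2)))"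
    by (auto simp: E_def algebra_simps)
  show "integrable lborel E" unfolding e
    by (intro Bochner_Integration.integrable_diff integrable_mult_right int_s2 int_entropy)
  show "D = 2 * (LBINT x. \<phi> x * (s x)\<^sup>2) - (LBINT x. \<phi> x * ((u x)\<^sup>2 * ln ((u x)\<^sup>2)))"
    unfolding D_def e using int_s2 int_entropy by simp
qed

text \<open>
  The heart of the transport proof of the logarithmic Sobolev inequality. The bracket is \<open>(F \<theta>)'\<close>; after expanding,
  what remains is \<open>ln q \<le> q - 1\<close> for \<open>q = T' = u\<^sup>2 exp (T\<^sup>2 / 2 - x\<^sup>2 / 2)\<close>.
\<close>

lemma pointwise_inequality:
  assumes "0 < G x" "G x < 1"
  shows "1/2 * W x \<le> E x + (\<phi> x * (u x * (2 * s x - x * u x)) * \<theta> x + F x * (q x - 1))"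
proof -
  have "(u x)\<^sup>2 * (ln ((u x)\<^sup>2) + (T x)\<^sup>2 / 2 - x\<^sup>2 / 2) \<le> (u x)\<^sup>2 * (q x - 1)"
  proof (cases "u x = 0")
    case False
    have "q x = (u x)\<^sup>2 * exp ((T x)\<^sup>2 / 2 - x\<^sup>2 / 2)"
    proof -
      have "exp (- x\<^sup>2 / 2) = exp ((T x)\<^sup>2 / 2 - x\<^sup>2 / 2) * exp (- (T x)\<^sup>2 / 2)"
        unfolding mult_exp_exp by (simp add: field_simps)
      then have "\<phi> x = exp ((T x)\<^sup>2 / 2 - x\<^sup>2 / 2) * \<phi> (T x)" by (simp only: std_normal_density_def mult.left_commute)
      then show ?thesis using phi_pos[of "T x"] by (simp add: q_def F_def)
    qed
    then have "ln (q x) = ln ((u x)\<^sup>2) + ((T x)\<^sup>2 / 2 - x\<^sup>2 / 2)" "0 < q x"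
      using False by (simp_all add: ln_mult)
    then show ?thesis using ln_le_minus_one[of "q x"] by (intro mult_left_mono) simp_all
  qed simp
  then have "\<phi> x * ((u x)\<^sup>2 * (ln ((u x)\<^sup>2) + (T x)\<^sup>2 / 2 - x\<^sup>2 / 2)) \<le> \<phi> x * ((u x)\<^sup>2 * (q x - 1))"
    by (rule mult_left_mono) (simp add: phi_nonneg)
  then show ?thesis
    by (simp add: W_def E_def F_def \<theta>_def power2_eq_square algebra_simps)
qed

lemma primitive_F_theta:
  "primitive_on (X a) (X b) (\<lambda>x. F x * \<theta> x)
     (\<lambda>x. \<phi> x * (u x * (2 * s x - x * u x)) * \<theta> x + F x * (q x - 1))"
proof (rule primitive_on_mult[OF F_prim primitive_on_DERIV])
  show "(\<theta> has_real_derivative q x - 1) (at x)" if "X a \<le> x" "x \<le> X b" for x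
    unfolding \<theta>_def[abs_def] using DERIV_T_q[OF that] by (auto intro!: derivative_eq_intros)
  show "continuous_on {X a..X b} (\<lambda>x. q x - 1)" by (intro continuous_intros q_cont)
qed

lemma theta_cont: "continuous_on {X a..X b} \<theta>"
  unfolding \<theta>_def[abs_def] by (intro continuous_intros T_cont)

lemma int_us: "integrable lborel (\<lambda>x. \<phi> x * (u x * s x))"
  by (rule weighted_Cauchy_Schwarz(1)) (auto simp: phi_nonneg int_u2 int_s2)

lemma set_integrable_W: "set_integrable lborel {X a..X b} W"
proof -
  have e: "W = (\<lambda>x. (4 * (\<phi> x * (s x)\<^sup>2) + (\<phi> x * (u x * s x)) * (4 * \<theta> x)) + F x * (\<theta> x)\<^sup>2)"
    by (auto simp: W_def F_def power2_eq_square algebra_simps)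
  have 1: "set_integrable lborel {X a..X b} (\<lambda>x. 4 * (\<phi> x * (s x)\<^sup>2))"
    using int_s2 by (intro set_integrable_of_integrable) auto
  have 2: "set_integrable lborel {X a..X b} (\<lambda>x. (\<phi> x * (u x * s x)) * (4 * \<theta> x))"
    by (rule set_integrable_mult_continuous[OF set_integrable_of_integrable[OF int_us]])
       (auto intro!: continuous_intros theta_cont)
  have 3: "set_integrable lborel {X a..X b} (\<lambda>x. F x * (\<theta> x)\<^sup>2)"
    by (intro borel_integrable_atLeastAtMost' continuous_intros theta_cont F_cont)
  show ?thesis unfolding e by (rule set_integral_add(1)[OF set_integral_add(1)[OF 1 2] 3])
qed

lemma finite_inequality:
  assumes "a \<le> b"
  shows "(LBINT x:{X a..X b}. W x)
    \<le> 2 * (LBINT x:{X a..X b}. E x) + 2 * (F (X b) * (b - X b) - F (X a) * (a - X a))"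
proof -
  let ?B = "\<lambda>x. \<phi> x * (u x * (2 * s x - x * u x)) * \<theta> x + F x * (q x - 1)"
  have BI: "set_integrable lborel {X a..X b} ?B" using primitive_F_theta by (rule primitive_on_integrable)
  have EI: "set_integrable lborel {X a..X b} E" by (rule set_integrable_of_integrable[OF int_E]) simp
  have "(LBINT x:{X a..X b}. 1/2 * W x) \<le> (LBINT x:{X a..X b}. E x + ?B x)"
  proof (rule set_integral_mono[OF set_integrable_mult_right[OF set_integrable_W] set_integral_add(1)[OF EI BI]])
    fix x assume "x \<in> {X a..X b}"
    then show "1/2 * W x \<le> E x + ?B x"
      using X_interval(1,2)[of a x b] by (intro pointwise_inequality) auto
  qed
  also have "\<dots> = (LBINT x:{X a..X b}. E x) + (LBINT x:{X a..X b}. ?B x)"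
    by (rule set_integral_add(2)[OF EI BI])
  also have "(LBINT x:{X a..X b}. ?B x) = F (X b) * \<theta> (X b) - F (X a) * \<theta> (X a)"
    by (rule primitive_on_increment[OF primitive_F_theta]) (use X_le[OF assms] in auto)
  finally show ?thesis by (simp add: \<theta>_def T_X)
qed

text \<open>
  The elementary estimate \<open>n\<^sup>2 / 4 \<ge> n - 1\<close> replaces the Gaussian tail by \<open>exp (1 - n)\<close>.
\<close>

lemma nat_times_F_bound:
  assumes "F x \<le> K * sqrt p" "p \<le> exp (- (real n)\<^sup>2 / 2) / 2"
  shows "real n * F x \<le> K * exp 1 * (real n ^ 1 / exp (real n))"
proof -
  have "sqrt p \<le> exp (1 - real n)"
  proof (rule real_le_lsqrt)
    have "p \<le> exp (- (real n)\<^sup>2 / 2)" using assms(2) exp_gt_zero[of "- (real n)\<^sup>2 / 2"] by linarith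
    also have "\<dots> \<le> exp (2 * (1 - real n))"
      using zero_le_power2[of "real n - 2"] by (simp add: power2_eq_square algebra_simps)
    also have "\<dots> = (exp (1 - real n))\<^sup>2" unfolding power2_eq_square mult_exp_exp by simp
    finally show "p \<le> (exp (1 - real n))\<^sup>2" .
  qed simp
  then have "F x \<le> K * exp (1 - real n)"
    using assms(1) mult_left_mono[OF _ K_nonneg] order_trans by blast
  then have "real n * F x \<le> real n * (K * exp (1 - real n))" by (rule mult_left_mono) simp
  then show ?thesis by (simp add: exp_diff mult_ac)
qed

lemma nat_div_exp_0: "(\<lambda>n. K * exp 1 * (real n ^ 1 / exp (real n))) \<longlonglongrightarrow> 0"
  using tendsto_mult_right_zero[OF filterlim_compose[OF tendsto_power_div_exp_0[of 1] filterlim_real_sequentially]]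
  by blast

lemma F_tail_tendsto: 
  assumes [measurable]: "\<And>n. S n \<in> sets borel"
    and ev: "\<And>x. 0 < G x \<Longrightarrow> G x < 1 \<Longrightarrow> eventually (\<lambda>n. x \<notin> S n) sequentially"
  shows "(\<lambda>n. LBINT x. indicator (S n) x * (\<phi> x * (x * u x)\<^sup>2)) \<longlonglongrightarrow> 0"
proof -
  have "(\<lambda>n. LBINT x. indicator (S n) x * (\<phi> x * (x * u x)\<^sup>2)) \<longlonglongrightarrow> (LBINT x::real. 0)"
  proof (rule integral_dominated_convergence[where w="\<lambda>x. \<phi> x * (x * u x)\<^sup>2"])
    show "AE x in lborel. (\<lambda>n. indicator (S n) x * (\<phi> x * (x * u x)\<^sup>2)) \<longlonglongrightarrow> 0"
    proof (rule AE_I2, rule tendsto_eventually)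
      fix x
      show "eventually (\<lambda>n. indicator (S n) x * (\<phi> x * (x * u x)\<^sup>2) = 0) sequentially"
      proof (cases "0 < G x \<and> G x < 1")
        case True
        then show ?thesis using ev[of x] by (auto elim!: eventually_mono)
      qed (simp add: u_eq_0)
    qed
    show "AE x in lborel. norm (indicator (S n) x * (\<phi> x * (x * u x)\<^sup>2)) \<le> \<phi> x * (x * u x)\<^sup>2" for n
      by (auto simp: indicator_def phi_nonneg)
  qed (use int_xu in auto)
  then show ?thesis by simp
qed

text \<open>
  The boundary term is \<open>F T - x F\<close>. Since \<open>F\<close> is at most \<open>K\<close> times the root of the tail mass \<open>p\<close>, the first part decays
  like \<open>n exp (- n\<^sup>2 / 4)\<close>. In the second part \<open>y\<^sup>2 p\<close> is at most the tail of the second moment when the tail lies farther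
  out than \<open>y\<close>; otherwise \<open>\<bar>y\<bar> \<le> \<bar>X 0\<bar>\<close> and \<open>p\<close> alone gives the decay.
\<close>

lemma boundary_term_tendsto_0:
  fixes y t p :: "nat \<Rightarrow> real" and S :: "nat \<Rightarrow> real set"
  assumes t: "\<And>n. \<bar>t n\<bar> = real n" and S: "\<And>n. S n \<in> sets borel"
    and p: "\<And>n. p n = (LBINT x:S n. F x)" "\<And>n. p n \<le> exp (- (real n)\<^sup>2 / 2) / 2" "p \<longlonglongrightarrow> 0"
    and Fy: "\<And>n. F (y n) \<le> K * sqrt (p n)"
    and ev: "\<And>x. 0 < G x \<Longrightarrow> G x < 1 \<Longrightarrow> eventually (\<lambda>n. x \<notin> S n) sequentially"
    and far: "\<And>n. (y n)\<^sup>2 \<le> (X 0)\<^sup>2 \<or> (\<forall>x\<in>S n. (y n)\<^sup>2 \<le> x\<^sup>2)"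
  shows "(\<lambda>n. F (y n) * (t n - y n)) \<longlonglongrightarrow> 0"
proof -
  define m where "m n = (LBINT x. indicator (S n) x * (\<phi> x * (x * u x)\<^sup>2))" for n
  have m: "m \<longlonglongrightarrow> 0" unfolding m_def using S ev by (rule F_tail_tendsto)
  define r where "r n = (X 0)\<^sup>2 * p n + m n" for n
  have m0: "0 \<le> m n" for n
    unfolding m_def by (intro Bochner_Integration.integral_nonneg) (simp add: phi_nonneg)
  have p0: "0 \<le> p n" for n
    unfolding p set_lebesgue_integral_def by (intro Bochner_Integration.integral_nonneg) (simp add: F_nonneg)
  have r: "(y n)\<^sup>2 * p n \<le> r n" for n
  proof (cases "(y n)\<^sup>2 \<le> (X 0)\<^sup>2")
    case True
    then have "(y n)\<^sup>2 * p n \<le> (X 0)\<^sup>2 * p n" using p0 by (rule mult_right_mono)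
    then show ?thesis using m0[of n] by (simp add: r_def)
  next
    case False
    have "(y n)\<^sup>2 * p n = (LBINT x. (y n)\<^sup>2 * (indicator (S n) x * F x))"
      by (simp add: p set_lebesgue_integral_def)
    also have "\<dots> \<le> m n" unfolding m_def
    proof (rule integral_mono)
      show "integrable lborel (\<lambda>x. (y n)\<^sup>2 * (indicator (S n) x * F x))"
        using set_integrable_of_integrable[OF F_int S] by (simp add: set_integrable_def)
      show "integrable lborel (\<lambda>x. indicator (S n) x * (\<phi> x * (x * u x)\<^sup>2))"
        using set_integrable_of_integrable[OF int_xu S] by (simp add: set_integrable_def)
      show "(y n)\<^sup>2 * (indicator (S n) x * F x) \<le> indicator (S n) x * (\<phi> x * (x * u x)\<^sup>2)" for x
        using far[of n] False mult_right_mono[OF _ F_nonneg, of "(y n)\<^sup>2" "x\<^sup>2" x]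
        by (cases "x \<in> S n") (auto simp: F_def power_mult_distrib mult_ac)
    qed
    also have "\<dots> \<le> r n" using p0[of n] by (simp add: r_def)
    finally show ?thesis .
  qed
  have "r \<longlonglongrightarrow> (X 0)\<^sup>2 * 0 + 0" unfolding r_def by (intro tendsto_intros p m)
  then have rlim: "r \<longlonglongrightarrow> 0" by simp
  show ?thesis
  proof (rule Lim_null_comparison)
    show "(\<lambda>n. K * exp 1 * (real n ^ 1 / exp (real n)) + K * sqrt (r n)) \<longlonglongrightarrow> 0"
      using tendsto_add[OF nat_div_exp_0 tendsto_mult[OF tendsto_const tendsto_real_sqrt[OF rlim], of K]] by simp
    show "eventually (\<lambda>n. norm (F (y n) * (t n - y n)) \<le> K * exp 1 * (real n ^ 1 / exp (real n)) + K * sqrt (r n)) sequentially"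
    proof (rule always_eventually, rule allI)
      fix n
      have 1: "real n * F (y n) \<le> K * exp 1 * (real n ^ 1 / exp (real n))"
        by (rule nat_times_F_bound[OF Fy p(2)])
      have "\<bar>y n\<bar> * F (y n) \<le> \<bar>y n\<bar> * (K * sqrt (p n))" using Fy by (rule mult_left_mono) simp
      also have "\<dots> = K * sqrt ((y n)\<^sup>2 * p n)" by (simp add: real_sqrt_mult)
      also have "\<dots> \<le> K * sqrt (r n)" using r[of n] K_nonneg by (intro mult_left_mono) auto
      finally have 2: "\<bar>y n\<bar> * F (y n) \<le> K * sqrt (r n)" .
      have "norm (F (y n) * (t n - y n)) = F (y n) * \<bar>t n - y n\<bar>" using F_nonneg[of "y n"] by (simp add: abs_mult)
      also have "\<dots> \<le> F (y n) * (real n + \<bar>y n\<bar>)"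
        using abs_triangle_ineq4[of "t n" "y n"] F_nonneg[of "y n"] by (intro mult_left_mono) (auto simp: t)
      finally show "norm (F (y n) * (t n - y n)) \<le> K * exp 1 * (real n ^ 1 / exp (real n)) + K * sqrt (r n)"
        using 1 2 by (simp add: algebra_simps)
    qed
  qed
qed

lemma boundary_right: "(\<lambda>n. F (X (real n)) * (real n - X (real n))) \<longlonglongrightarrow> 0"
proof (rule boundary_term_tendsto_0[where S="\<lambda>n. {X (real n)<..}" and p="\<lambda>n. 1 - Phi (real n)"])
  show "1 - Phi (real n) = (LBINT x:{X (real n)<..}. F x)" for n
    using cumul_total[OF F_int, of "X (real n)"] G_X[of "real n"] by (simp add: G_def F_mass)
  show "1 - Phi (real n) \<le> exp (- (real n)\<^sup>2 / 2) / 2" for n by (rule Phi_upper_tail) simp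
  show "(\<lambda>n. 1 - Phi (real n)) \<longlonglongrightarrow> 0" using tendsto_diff[OF tendsto_const[of 1] Phi_nat_top] by simp
  show "F (X (real n)) \<le> K * sqrt (1 - Phi (real n))" for n
    using F_le_right[of "X (real n)"] by (simp add: G_X)
  show "eventually (\<lambda>n. x \<notin> {X (real n)<..}) sequentially" if "0 < G x" "G x < 1" for x
    using eventually_less_X[OF that(2)] by eventually_elim auto
  show "(X (real n))\<^sup>2 \<le> (X 0)\<^sup>2 \<or> (\<forall>x\<in>{X (real n)<..}. (X (real n))\<^sup>2 \<le> x\<^sup>2)" for n
    using X_le[of 0 "real n"] by (cases "0 \<le> X (real n)") (auto simp: abs_le_square_iff[symmetric])
qed simp_all

lemma boundary_left: "(\<lambda>n. F (X (- real n)) * (- real n - X (- real n))) \<longlonglongrightarrow> 0"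
proof (rule boundary_term_tendsto_0[where S="\<lambda>n. {..X (- real n)}" and p="\<lambda>n. Phi (- real n)"])
  show "Phi (- real n) = (LBINT x:{..X (- real n)}. F x)" for n
    using G_X[of "- real n"] by (simp add: G_def cumul_def)
  show "Phi (- real n) \<le> exp (- (real n)\<^sup>2 / 2) / 2" for n using Phi_lower_tail[of "- real n"] by simp
  show "F (X (- real n)) \<le> K * sqrt (Phi (- real n))" for n
    using F_le_left[of "X (- real n)"] by (simp add: G_X)
  show "eventually (\<lambda>n. x \<notin> {..X (- real n)}) sequentially" if "0 < G x" "G x < 1" for x
    using eventually_X_less[OF that(1)] by eventually_elim auto
  show "(X (- real n))\<^sup>2 \<le> (X 0)\<^sup>2 \<or> (\<forall>x\<in>{..X (- real n)}. (X (- real n))\<^sup>2 \<le> x\<^sup>2)" for n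
    using X_le[of "- real n" 0] by (cases "X (- real n) \<le> 0") (auto simp: abs_le_square_iff[symmetric])
qed (simp_all add: Phi_nat_bot)

lemma A_integral_split:
  fixes g :: "real \<Rightarrow> real"
  assumes "set_integrable lborel {X (- real n)..X (real n)} g" 
    "set_integrable lborel {x. \<not> (0 < G x \<and> G x < 1)} g"
  shows "set_integrable lborel (A n) g"
    "(LBINT x:A n. g x) = (LBINT x:{X (- real n)..X (real n)}. g x) + (LBINT x:{x. \<not> (0 < G x \<and> G x < 1)}. g x)"
proof -
  have m: "{x. \<not> (0 < G x \<and> G x < 1)} \<in> sets borel" using J_closed by (rule borel_closed)
  show "set_integrable lborel (A n) g"
    unfolding A_def by (rule set_integrable_Un[OF assms]) (use m in auto)
  show "(LBINT x:A n. g x) = (LBINT x:{X (- real n)..X (real n)}. g x) + (LBINT x:{x. \<not> (0 < G x \<and> G x < 1)}. g x)"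
    unfolding A_def
  proof (rule set_integral_Un[OF _ assms])
    show "{X (- real n)..X (real n)} \<inter> {x. \<not> (0 < G x \<and> G x < 1)} = {}" using X_interval by auto
  qed
qed

text \<open>
  On the interval part of \<open>A n\<close> this is the pointwise inequality integrated up to boundary terms that tend to 0. Where \<open>G\<close> is
  0 or 1, \<open>u = 0\<close> makes \<open>W = 2 E\<close>.
\<close>

lemma deficit_bound: "integrable lborel W" "(LBINT x. W x) \<le> 2 * D"
proof -
  let ?N = "{x. \<not> (0 < G x \<and> G x < 1)}"
  have Nm: "?N \<in> sets borel" using J_closed by (rule borel_closed)
  define b where "b n = F (X (real n)) * (real n - X (real n)) - F (X (- real n)) * (- real n - X (- real n))" for n
  have b: "b \<longlonglongrightarrow> 0" using tendsto_diff[OF boundary_right boundary_left] unfolding b_def by simp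
  have WE: "W x = 2 * E x" if "x \<in> ?N" for x
    using u_eq_0[of x] that by (simp add: W_def E_def power2_eq_square algebra_simps)
  have EN: "set_integrable lborel ?N E" and EX: "set_integrable lborel {X (- real n)..X (real n)} E" for n
    using Nm by (auto intro: set_integrable_of_integrable[OF int_E])
  have WN: "set_integrable lborel ?N W"
    using set_integrable_mult_right[of 2, OF EN]
    by (subst set_integrable_cong[OF refl refl, of _ _ "\<lambda>x. 2 * E x"]) (auto simp: WE)
  note Wsplit = A_integral_split[OF set_integrable_W WN] and Esplit = A_integral_split[OF EX EN]
  have WNe: "(LBINT x:?N. W x) = 2 * (LBINT x:?N. E x)"
    unfolding set_integral_mult_right[symmetric]
    by (rule set_lebesgue_integral_cong) (use Nm WE in auto)
  have le: "(LBINT x:A n. W x) \<le> 2 * (LBINT x:A n. E x) + 2 * b n" for n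
  proof -
    have "- real n \<le> real n" by simp
    from finite_inequality[OF this] show ?thesis unfolding Wsplit(2) Esplit(2) WNe b_def by argo
  qed
  have Elim: "(\<lambda>n. LBINT x:A n. E x) \<longlonglongrightarrow> D"
    unfolding D_def set_lebesgue_integral_def
  proof (rule integral_dominated_convergence[where w="\<lambda>x. \<bar>E x\<bar>"])
    show "AE x in lborel. (\<lambda>n. indicator (A n) x *\<^sub>R E x) \<longlonglongrightarrow> E x"
    proof (rule AE_I2, rule tendsto_eventually)
      fix x show "eventually (\<lambda>n. indicator (A n) x *\<^sub>R E x = E x) sequentially"
        using eventually_in_A[of x] by eventually_elim simp
    qed
    show "E \<in> borel_measurable lborel" using int_E by (rule borel_measurable_integrable)
    then show "(\<lambda>x. indicator (A n) x *\<^sub>R E x) \<in> borel_measurable lborel" for n by measurable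
  qed (use int_E in \<open>auto simp: indicator_def\<close>)
  have lim: "(\<lambda>n. 2 * (LBINT x:A n. E x) + 2 * b n) \<longlonglongrightarrow> 2 * D + 2 * 0"
    by (intro tendsto_intros Elim b)
  have ev: "eventually (\<lambda>n. x \<in> A n \<or> W x = 0) sequentially" for x
    using eventually_in_A[of x] by eventually_elim simp
  have Wm: "W \<in> borel_measurable lborel" by measurable
  have Am: "A n \<in> sets lborel" for n by measurable
  note ex = integrable_exhaust[OF Wm Am W_nonneg ev Wsplit(1) le lim]
  show "integrable lborel W" by (rule ex(1))
  show "(LBINT x. W x) \<le> 2 * D" using ex(2) by simp
qed

section \<open>Moments and derivative of the transport map\<close>

lemma F_supp: "\<not> (0 < G x \<and> G x < 1) \<Longrightarrow> F x * g x = 0" by (simp add: F_eq_0)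

lemma A_eq_interval:
  "(LBINT x:A n. F x * g x) = (LBINT x:{X (- real n)..X (real n)}. F x * (g x :: real))"
  "set_integrable lborel (A n) (\<lambda>x. F x * g x) \<longleftrightarrow> set_integrable lborel {X (- real n)..X (real n)} (\<lambda>x. F x * (g x :: real))"
proof -
  have "indicator (A n) x *\<^sub>R (F x * g x) = indicator {X (- real n)..X (real n)} x *\<^sub>R (F x * g x)" for x
    by (rule A_split) (rule F_supp)
  then show "(LBINT x:A n. F x * g x) = (LBINT x:{X (- real n)..X (real n)}. F x * g x)"
    "set_integrable lborel (A n) (\<lambda>x. F x * g x) \<longleftrightarrow> set_integrable lborel {X (- real n)..X (real n)} (\<lambda>x. F x * g x)"
    unfolding set_lebesgue_integral_def set_integrable_def by (simp_all only:)
qed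

lemma limit_of_interval_integrals:
  assumes I: "integrable lborel (\<lambda>x. F x * g x)"
  shows "(\<lambda>n. LBINT x:{X (- real n)..X (real n)}. F x * g x) \<longlonglongrightarrow> (LBINT x. F x * (g x :: real))"
proof -
  have m: "(\<lambda>x. F x * g x) \<in> borel_measurable lborel" using I by (rule borel_measurable_integrable)
  have "(\<lambda>n. LBINT x. indicator (A n) x *\<^sub>R (F x * g x)) \<longlonglongrightarrow> (LBINT x. F x * g x)"
  proof (rule integral_dominated_convergence[where w="\<lambda>x. \<bar>F x * g x\<bar>", OF m])
    show "AE x in lborel. (\<lambda>n. indicator (A n) x *\<^sub>R (F x * g x)) \<longlonglongrightarrow> F x * g x"
    proof (rule AE_I2, rule tendsto_eventually)
      fix x show "eventually (\<lambda>n. indicator (A n) x *\<^sub>R (F x * g x) = F x * g x) sequentially"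
        using eventually_in_A[of x] by eventually_elim simp
    qed
    show "(\<lambda>x. indicator (A n) x *\<^sub>R (F x * g x)) \<in> borel_measurable lborel" for n using m by measurable
  qed (use I in \<open>auto simp: indicator_def\<close>)
  then show ?thesis by (simp only: set_lebesgue_integral_def[symmetric] A_eq_interval(1))
qed

lemma DERIV_phiT: "X a \<le> x \<Longrightarrow> x \<le> X b \<Longrightarrow> ((\<lambda>x. \<phi> (T x)) has_real_derivative - (T x * F x)) (at x)"
  by (rule DERIV_cong[OF DERIV_chain2[OF DERIV_phi DERIV_T_q]]) (simp_all add: q_phi[symmetric])

text \<open>
  The second moment of \<open>T\<close> is that of the Gaussian, since \<open>(T \<phi>(T))' = F - F T\<^sup>2\<close>; on finite intervals the
  boundary values of \<open>T \<phi>(T)\<close> have the sign that gives the upper bound.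
\<close>

lemma T_second_moment: "integrable lborel (\<lambda>x. F x * (T x)\<^sup>2)" "(LBINT x. F x * (T x)\<^sup>2) \<le> 1"
proof -
  have FI: "set_integrable lborel {X a..X b} F" for a b by (rule set_integrable_of_integrable[OF F_int]) simp
  have TI: "set_integrable lborel {X a..X b} (\<lambda>x. F x * (T x)\<^sup>2)" for a b
    by (intro borel_integrable_atLeastAtMost' continuous_intros T_cont F_cont)
  have le: "(LBINT x:{X (- real n)..X (real n)}. F x * (T x)\<^sup>2) \<le> 1" for n
  proof -
    let ?a = "- real n" let ?b = "real n"
    have P: "primitive_on (X ?a) (X ?b) (\<lambda>x. T x * \<phi> (T x)) (\<lambda>x. F x - F x * (T x)\<^sup>2)"
    proof (rule primitive_on_DERIV)
      fix x assume x: "X ?a \<le> x" "x \<le> X ?b"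
      show "((\<lambda>x. T x * \<phi> (T x)) has_real_derivative F x - F x * (T x)\<^sup>2) (at x)"
        by (rule DERIV_cong[OF DERIV_mult[OF DERIV_T_q[OF x] DERIV_phiT[OF x]]])
           (simp add: q_phi power2_eq_square)
    qed (intro continuous_intros T_cont F_cont)
    have "(LBINT x:{X ?a..X ?b}. F x) - (LBINT x:{X ?a..X ?b}. F x * (T x)\<^sup>2)
        = (LBINT x:{X ?a..X ?b}. F x - F x * (T x)\<^sup>2)"
      by (rule set_integral_diff(2)[OF FI TI, symmetric])
    also have "\<dots> = ?b * \<phi> ?b - ?a * \<phi> ?a"
      using primitive_on_increment[OF P, of "X ?a" "X ?b"] X_le[of ?a ?b] by (simp add: T_X)
    also have "\<dots> \<ge> 0" using phi_pos[of ?a] phi_pos[of ?b] by simp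
    finally have "(LBINT x:{X ?a..X ?b}. F x * (T x)\<^sup>2) \<le> (LBINT x:{X ?a..X ?b}. F x)" by simp
    also have "\<dots> = G (X ?b) - G (X ?a)" using G_diff[of "X ?a" "X ?b"] X_le[of ?a ?b] by simp
    also have "\<dots> \<le> 1" using G_bounds[of "X ?a"] G_bounds[of "X ?b"] by simp
    finally show ?thesis .
  qed
  have Wm: "(\<lambda>x. F x * (T x)\<^sup>2) \<in> borel_measurable lborel" by measurable
  have Am: "A n \<in> sets lborel" for n by measurable
  have nn: "0 \<le> F x * (T x)\<^sup>2" for x by (simp add: F_nonneg)
  have ev: "eventually (\<lambda>n. x \<in> A n \<or> F x * (T x)\<^sup>2 = 0) sequentially" for x
    using eventually_in_A[of x] by eventually_elim simp
  have AI: "set_integrable lborel (A n) (\<lambda>x. F x * (T x)\<^sup>2)" for n unfolding A_eq_interval by (rule TI)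
  have Ale: "(LBINT x:A n. F x * (T x)\<^sup>2) \<le> 1" for n unfolding A_eq_interval by (rule le)
  note ex = integrable_exhaust[OF Wm Am nn ev AI Ale tendsto_const]
  show "integrable lborel (\<lambda>x. F x * (T x)\<^sup>2)" "(LBINT x. F x * (T x)\<^sup>2) \<le> 1" by (rule ex)+
qed

lemma integrable_F_of_square:
  assumes [measurable]: "g \<in> borel_measurable borel" and I: "integrable lborel (\<lambda>x. F x * (g x)\<^sup>2)"
  shows "integrable lborel (\<lambda>x. F x * g x)"
proof (rule Bochner_Integration.integrable_bound[OF Bochner_Integration.integrable_add[OF F_int I]])
  show "AE x in lborel. norm (F x * g x) \<le> norm (F x + F x * (g x)\<^sup>2)"
  proof (rule AE_I2)
    fix x
    have "F x * \<bar>g x\<bar> \<le> F x * (1 + (g x)\<^sup>2)" by (rule mult_left_mono[OF abs_le_1_square F_nonneg])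
    then show "norm (F x * g x) \<le> norm (F x + F x * (g x)\<^sup>2)"
      using F_nonneg[of x] by (simp add: abs_mult distrib_left)
  qed
qed measurable

lemma T_mean: "integrable lborel (\<lambda>x. F x * T x)" "(LBINT x. F x * T x) = 0"
proof -
  show I: "integrable lborel (\<lambda>x. F x * T x)"
    by (rule integrable_F_of_square[OF T_borel T_second_moment(1)])
  have "(LBINT x:{X (- real n)..X (real n)}. F x * T x) = 0" for n
  proof -
    let ?a = "- real n" let ?b = "real n"
    have P: "primitive_on (X ?a) (X ?b) (\<lambda>x. - \<phi> (T x)) (\<lambda>x. F x * T x)"
    proof (rule primitive_on_DERIV)
      fix x assume x: "X ?a \<le> x" "x \<le> X ?b"
      show "((\<lambda>x. - \<phi> (T x)) has_real_derivative F x * T x) (at x)"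
        by (rule DERIV_cong[OF DERIV_minus[OF DERIV_phiT[OF x]]]) simp
    qed (intro continuous_intros T_cont F_cont)
    show ?thesis
      using primitive_on_increment[OF P, of "X ?a" "X ?b"] X_le[of ?a ?b] by (simp add: T_X phi_minus)
  qed
  then show "(LBINT x. F x * T x) = 0"
    using limit_of_interval_integrals[OF I] by (simp add: LIMSEQ_const_iff)
qed

lemma x_moments: "integrable lborel (\<lambda>x. F x * x\<^sup>2)" "(LBINT x. F x * x\<^sup>2) \<le> \<alpha>"
  "integrable lborel (\<lambda>x. F x * x)" "(LBINT x. F x * x) = 0"
proof -
  have e: "(\<lambda>x. F x * x\<^sup>2) = (\<lambda>x. \<phi> x * (x * u x)\<^sup>2)" by (auto simp: F_def power_mult_distrib)
  show I: "integrable lborel (\<lambda>x. F x * x\<^sup>2)" "(LBINT x. F x * x\<^sup>2) \<le> \<alpha>"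
    unfolding e by (rule int_xu, rule moment)
  show "integrable lborel (\<lambda>x. F x * x)" by (rule integrable_F_of_square[OF _ I(1)]) simp
  have "(\<lambda>x. F x * x) = (\<lambda>x. x * (\<phi> x * (u x)\<^sup>2))" by (auto simp: F_def)
  then show "(LBINT x. F x * x) = 0" using centered by simp
qed

lemma theta_moments: "integrable lborel (\<lambda>x. F x * (\<theta> x)\<^sup>2)" "(LBINT x. F x * (\<theta> x)\<^sup>2) \<le> 2 + 2 * \<alpha>"
  "integrable lborel (\<lambda>x. F x * \<theta> x)" "(LBINT x. F x * \<theta> x) = 0"
proof -
  have J: "integrable lborel (\<lambda>x. 2 * (F x * (T x)\<^sup>2) + 2 * (F x * x\<^sup>2))"
    by (intro Bochner_Integration.integrable_add integrable_mult_right T_second_moment x_moments)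
  have le: "F x * (\<theta> x)\<^sup>2 \<le> 2 * (F x * (T x)\<^sup>2) + 2 * (F x * x\<^sup>2)" for x
  proof -
    have "(\<theta> x)\<^sup>2 \<le> 2 * (T x)\<^sup>2 + 2 * x\<^sup>2"
      using zero_le_power2[of "T x + x"] by (simp add: \<theta>_def power2_sum power2_diff)
    then have "F x * (\<theta> x)\<^sup>2 \<le> F x * (2 * (T x)\<^sup>2 + 2 * x\<^sup>2)" by (rule mult_left_mono) (rule F_nonneg)
    then show ?thesis by (simp add: algebra_simps)
  qed
  show I: "integrable lborel (\<lambda>x. F x * (\<theta> x)\<^sup>2)"
  proof (rule Bochner_Integration.integrable_bound[OF J])
    show "AE x in lborel. norm (F x * (\<theta> x)\<^sup>2) \<le> norm (2 * (F x * (T x)\<^sup>2) + 2 * (F x * x\<^sup>2))"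
    proof (rule AE_I2)
      fix x show "norm (F x * (\<theta> x)\<^sup>2) \<le> norm (2 * (F x * (T x)\<^sup>2) + 2 * (F x * x\<^sup>2))"
        using le[of x] F_nonneg[of x] by simp
    qed
  qed measurable
  have "(LBINT x. F x * (\<theta> x)\<^sup>2) \<le> (LBINT x. 2 * (F x * (T x)\<^sup>2) + 2 * (F x * x\<^sup>2))"
    by (rule integral_mono[OF I J le])
  also have "\<dots> \<le> 2 + 2 * \<alpha>" using T_second_moment x_moments by simp
  finally show "(LBINT x. F x * (\<theta> x)\<^sup>2) \<le> 2 + 2 * \<alpha>" .
  show "integrable lborel (\<lambda>x. F x * \<theta> x)" by (rule integrable_F_of_square[OF theta_borel I])
  show "(LBINT x. F x * \<theta> x) = 0"
    using T_mean x_moments by (simp add: \<theta>_def right_diff_distrib)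
qed

lemma D_nonneg: "0 \<le> D"
proof -
  have "0 \<le> (LBINT x. W x)" by (intro Bochner_Integration.integral_nonneg W_nonneg)
  then show ?thesis using deficit_bound(2) by simp
qed

text \<open>
  The defect in the equation \<open>F = \<phi>(T)\<close> that characterizes translations of the Gaussian.
\<close>

definition P :: "real \<Rightarrow> real" where "P x = F x - \<phi> (T x)"

lemma primitive_P: "primitive_on (X a) (X b) P (\<lambda>x. \<phi> x * (u x * (2 * s x + \<theta> x * u x)))"
proof -
  have "primitive_on (X a) (X b) (\<lambda>x. \<phi> (T x)) (\<lambda>x. - (T x * F x))"
  proof (rule primitive_on_DERIV)
    show "((\<lambda>x. \<phi> (T x)) has_real_derivative - (T x * F x)) (at x)" if "X a \<le> x" "x \<le> X b" for x
      using that by (rule DERIV_phiT)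
  qed (intro continuous_intros T_cont F_cont)
  from primitive_on_diff[OF F_prim this] show ?thesis
    by (rule primitive_on_cong) (auto simp: P_def F_def \<theta>_def power2_eq_square algebra_simps)
qed

lemma P_increment:
  assumes "X a \<le> x" "x \<le> y" "y \<le> X b"
  shows "\<bar>P y - P x\<bar> \<le> sqrt (2 * D) * sqrt (G y - G x)"
proof (rule increment_bound)
  show "primitive_on x y P (\<lambda>x. \<phi> x * (u x * (2 * s x + \<theta> x * u x)))"
    using primitive_P by (rule primitive_on_subinterval) (use assms in auto)
  show "integrable lborel (\<lambda>t. \<phi> t * (2 * s t + \<theta> t * u t)\<^sup>2)" "(LBINT t. \<phi> t * (2 * s t + \<theta> t * u t)\<^sup>2) \<le> 2 * D"
    using deficit_bound unfolding W_def[abs_def] by auto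
  show "x \<le> y" by fact
qed measurable

lemma P_X_tendsto: "(\<lambda>n. P (X (real n))) \<longlonglongrightarrow> 0" "(\<lambda>n. P (X (- real n))) \<longlonglongrightarrow> 0"
proof -
  have "(\<lambda>n. F (X (real n))) \<longlonglongrightarrow> 0"
  proof (rule Lim_null_comparison)
    have "(\<lambda>n. K * sqrt (1 - Phi (real n))) \<longlonglongrightarrow> K * sqrt (1 - 1)" by (intro tendsto_intros Phi_nat_top)
    then show "(\<lambda>n. K * sqrt (1 - Phi (real n))) \<longlonglongrightarrow> 0" by simp
    show "eventually (\<lambda>n. norm (F (X (real n))) \<le> K * sqrt (1 - Phi (real n))) sequentially"
      using F_le_right F_nonneg by (auto simp: G_X[symmetric] intro!: always_eventually)
  qed
  then have "(\<lambda>n. F (X (real n)) - \<phi> (real n)) \<longlonglongrightarrow> 0 - 0" by (intro tendsto_diff phi_tendsto_0)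
  then show "(\<lambda>n. P (X (real n))) \<longlonglongrightarrow> 0" by (simp add: P_def T_X)
  have "(\<lambda>n. F (X (- real n))) \<longlonglongrightarrow> 0"
  proof (rule Lim_null_comparison)
    have "(\<lambda>n. K * sqrt (Phi (- real n))) \<longlonglongrightarrow> K * sqrt 0" by (intro tendsto_intros Phi_nat_bot)
    then show "(\<lambda>n. K * sqrt (Phi (- real n))) \<longlonglongrightarrow> 0" by simp
    show "eventually (\<lambda>n. norm (F (X (- real n))) \<le> K * sqrt (Phi (- real n))) sequentially"
      using F_le_left F_nonneg by (auto simp: G_X[symmetric] intro!: always_eventually)
  qed
  then have "(\<lambda>n. F (X (- real n)) - \<phi> (real n)) \<longlonglongrightarrow> 0 - 0" by (intro tendsto_diff phi_tendsto_0)
  then show "(\<lambda>n. P (X (- real n))) \<longlonglongrightarrow> 0" by (simp add: P_def T_X phi_minus)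
qed

text \<open>
  \<open>P\<close> vanishes at both ends, so its increments from the left and from the right both apply, and the smaller of the
  two masses \<open>Phi (T x)\<close> and \<open>1 - Phi (T x)\<close> is at most \<open>exp (- T\<^sup>2 / 2)\<close>.
\<close>

lemma P_bound:
  assumes x: "0 < G x" "G x < 1"
  shows "\<bar>P x\<bar> \<le> sqrt (2 * D) * exp (- (T x)\<^sup>2 / 4)"
proof -
  have lim: "\<bar>P x\<bar> \<le> B" if "y \<longlonglongrightarrow> 0" "eventually (\<lambda>n. \<bar>y n - P x\<bar> \<le> B) sequentially" for y B
    using tendsto_upperbound[OF tendsto_rabs[OF tendsto_diff[OF that(1) tendsto_const[of "P x"]]] that(2)] by simp
  have inside: "eventually (\<lambda>n. x < X (real n) \<and> X (- real n) < x) sequentially"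
    by (rule eventually_conj[OF eventually_less_X[OF x(2)] eventually_X_less[OF x(1)]])
  have scale: "sqrt (2 * D) * sqrt a \<le> sqrt (2 * D) * sqrt b" if "a \<le> b" for a b
    using that D_nonneg by (intro mult_left_mono) auto
  have r: "\<bar>P x\<bar> \<le> sqrt (2 * D) * sqrt (1 - G x)"
  proof (rule lim[OF P_X_tendsto(1)])
    show "eventually (\<lambda>n. \<bar>P (X (real n)) - P x\<bar> \<le> sqrt (2 * D) * sqrt (1 - G x)) sequentially"
      using inside
    proof eventually_elim
      case (elim n)
      have "\<bar>P (X (real n)) - P x\<bar> \<le> sqrt (2 * D) * sqrt (G (X (real n)) - G x)"
        by (rule P_increment[of "- real n" _ _ "real n"]) (use elim in auto)
      also have "\<dots> \<le> sqrt (2 * D) * sqrt (1 - G x)" by (rule scale) (use G_bounds in simp)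
      finally show ?case .
    qed
  qed
  have l: "\<bar>P x\<bar> \<le> sqrt (2 * D) * sqrt (G x)"
  proof (rule lim[OF P_X_tendsto(2)])
    show "eventually (\<lambda>n. \<bar>P (X (- real n)) - P x\<bar> \<le> sqrt (2 * D) * sqrt (G x)) sequentially"
      using inside
    proof eventually_elim
      case (elim n)
      have "\<bar>P x - P (X (- real n))\<bar> \<le> sqrt (2 * D) * sqrt (G x - G (X (- real n)))"
        by (rule P_increment[of "- real n" _ _ "real n"]) (use elim in auto)
      also have "\<dots> \<le> sqrt (2 * D) * sqrt (G x)" by (rule scale) (use G_bounds in simp)
      finally show ?case by (simp add: abs_minus_commute)
    qed
  qed
  have e: "sqrt p \<le> exp (- (T x)\<^sup>2 / 4)" if "p \<le> exp (- (T x)\<^sup>2 / 2) / 2" for p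
  proof (rule real_le_lsqrt)
    have "p \<le> exp (- (T x)\<^sup>2 / 2)" using that exp_gt_zero[of "- (T x)\<^sup>2 / 2"] by linarith
    also have "\<dots> = (exp (- (T x)\<^sup>2 / 4))\<^sup>2" unfolding power2_eq_square mult_exp_exp by simp
    finally show "p \<le> (exp (- (T x)\<^sup>2 / 4))\<^sup>2" .
  qed simp
  show ?thesis
  proof (cases "0 \<le> T x")
    case True
    then have "sqrt (1 - G x) \<le> exp (- (T x)\<^sup>2 / 4)"
      using Phi_upper_tail[OF True] by (intro e) (simp add: Phi_T[OF x])
    then show ?thesis using r mult_left_mono[of "sqrt (1 - G x)" "exp (- (T x)\<^sup>2 / 4)" "sqrt (2 * D)"] D_nonneg by simp
  next
    case False
    then have "sqrt (G x) \<le> exp (- (T x)\<^sup>2 / 4)"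
      using Phi_lower_tail[of "T x"] by (intro e) (simp add: Phi_T[OF x])
    then show ?thesis using l mult_left_mono[of "sqrt (G x)" "exp (- (T x)\<^sup>2 / 4)" "sqrt (2 * D)"] D_nonneg by simp
  qed
qed

lemma q_bound:
  assumes x: "0 < G x" "G x < 1"
  shows "\<bar>q x - 1\<bar> \<le> 2 * sqrt (pi * D) * exp ((T x)\<^sup>2 / 4)"
proof -
  have "q x - 1 = P x / \<phi> (T x)" using phi_pos[of "T x"] by (simp add: q_def P_def diff_divide_distrib)
  then have "\<bar>q x - 1\<bar> = \<bar>P x\<bar> / \<phi> (T x)" using phi_pos[of "T x"] by (simp add: abs_divide)
  also have "\<dots> \<le> sqrt (2 * D) * exp (- (T x)\<^sup>2 / 4) / \<phi> (T x)"
    using P_bound[OF x] phi_pos[of "T x"] by (intro divide_right_mono) auto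
  also have "\<dots> = sqrt (2 * D) * sqrt (2 * pi) * (exp (- (T x)\<^sup>2 / 4) / exp (- (T x)\<^sup>2 / 2))"
    by (simp add: std_normal_density_def)
  also have "exp (- (T x)\<^sup>2 / 4) / exp (- (T x)\<^sup>2 / 2) = exp ((T x)\<^sup>2 / 4)"
    unfolding exp_diff[symmetric] by (simp add: field_simps)
  also have "sqrt (2 * D) * sqrt (2 * pi) = 2 * sqrt (pi * D)"
    by (simp add: real_sqrt_mult[symmetric] mult_ac) (simp add: real_sqrt_mult)
  finally show ?thesis .
qed

section \<open>The transport cost\<close>

definition M :: real where "M = sqrt (2 + 2 * \<alpha>)"

lemma theta_second_nonneg: "0 \<le> (LBINT x. F x * (\<theta> x)\<^sup>2)"
  by (intro Bochner_Integration.integral_nonneg mult_nonneg_nonneg F_nonneg) simp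

lemma M_nonneg: "0 \<le> M" and sqrt_theta_le_M: "sqrt (LBINT x. F x * (\<theta> x)\<^sup>2) \<le> M"
  using theta_moments(2) theta_second_nonneg by (auto simp: M_def)

text \<open>
  Since \<open>q \<ge> 1/2\<close> as long as \<open>\<bar>T\<bar> \<le> R\<close>, the bound \<open>\<bar>q - 1\<bar> \<le> \<epsilon> exp (T\<^sup>2 / 4)\<close> is at most
  \<open>2 \<epsilon> exp (T\<^sup>2 / 4) T'\<close>, which is dominated by the derivative of \<open>2 \<epsilon> T exp (T\<^sup>2 / 4)\<close>. Both signs of the displacement
  are compared with this function, starting from \<open>X 0\<close>, where \<open>T = 0\<close>.
\<close>

lemma near_identity:
  assumes e: "2 * sqrt (pi * D) \<le> \<epsilon>" "0 < \<epsilon>" and R: "0 \<le> R" "\<epsilon> * exp (R\<^sup>2 / 4) = 1 / 2"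
    and x: "X (- R) \<le> x" "x \<le> X R"
  shows "\<bar>\<theta> x + X 0\<bar> \<le> 2 * \<epsilon> * (\<bar>T x\<bar> * exp ((T x)\<^sup>2 / 4))"
proof -
  \<comment> \<open>monotone for both signs \<open>\<sigma> = 1\<close> and \<open>\<sigma> = -1\<close>\<close>
  define h where "h \<sigma> y = 2 * \<epsilon> * (T y * exp ((T y)\<^sup>2 / 4)) + \<sigma> * (y - T y)" for \<sigma> y :: real
  have mono: "h \<sigma> y \<le> h \<sigma> z" if yz: "X (- R) \<le> y" "y \<le> z" "z \<le> X R" and s: "\<bar>\<sigma>\<bar> = 1" for \<sigma> y z
  proof (rule DERIV_nonneg_imp_nondecreasing[OF yz(2)])
    fix t assume "y \<le> t" "t \<le> z"
    then have t: "X (- R) \<le> t" "t \<le> X R" using yz by auto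
    note G = X_interval[OF t]
    let ?e = "exp ((T t)\<^sup>2 / 4)"
    have "\<bar>T t\<bar> \<le> R" using G by auto
    then have "(T t)\<^sup>2 \<le> R\<^sup>2" using R by (metis abs_le_square_iff abs_of_nonneg)
    then have "\<epsilon> * ?e \<le> \<epsilon> * exp (R\<^sup>2 / 4)" using e by (intro mult_left_mono) auto
    then have small: "\<epsilon> * ?e \<le> 1 / 2" using R by simp
    have "2 * sqrt (pi * D) * ?e \<le> \<epsilon> * ?e" using e by (intro mult_right_mono) auto
    then have q: "\<bar>q t - 1\<bar> \<le> \<epsilon> * ?e" using q_bound[OF G(1,2)] by linarith
    then have q2: "1 / 2 \<le> q t" using small by linarith
    have "?e * (1 + (T t)\<^sup>2 / 2) * q t \<ge> ?e * 1 * (1 / 2)"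
      using q2 by (intro mult_mono) auto
    then have "2 * \<epsilon> * (?e * (1 + (T t)\<^sup>2 / 2) * q t) \<ge> 2 * \<epsilon> * (?e * 1 * (1 / 2))"
      using e by (intro mult_left_mono) auto
    then have lower: "2 * \<epsilon> * (?e * (1 + (T t)\<^sup>2 / 2) * q t) \<ge> \<epsilon> * ?e" by simp
    have "\<bar>\<sigma> * (1 - q t)\<bar> \<le> \<epsilon> * ?e" using q s by (simp add: abs_mult abs_minus_commute)
    then have nn: "0 \<le> 2 * \<epsilon> * (?e * (1 + (T t)\<^sup>2 / 2) * q t) + \<sigma> * (1 - q t)" using lower by linarith
    have DT: "(T has_real_derivative q t) (at t)" by (rule DERIV_T_q[OF t])
    have "((\<lambda>y. h \<sigma> y) has_real_derivative 2 * \<epsilon> * (?e * (1 + (T t)\<^sup>2 / 2) * q t) + \<sigma> * (1 - q t)) (at t)"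
      unfolding h_def
      by (auto intro!: derivative_eq_intros DT simp: algebra_simps power2_eq_square)
    then show "\<exists>y. (h \<sigma> has_real_derivative y) (at t) \<and> 0 \<le> y" using nn by blast
  qed
  have h0: "h \<sigma> (X 0) = \<sigma> * X 0" for \<sigma> by (simp add: h_def T_X)
  show ?thesis
  proof (cases "X 0 \<le> x")
    case True
    have "h 1 (X 0) \<le> h 1 x" "h (-1) (X 0) \<le> h (-1) x"
      using mono[of "X 0" x] X_le[of "-R" 0] R True x by auto
    moreover have "0 \<le> T x" using X_interval[OF True x(2)] by simp
    ultimately show ?thesis unfolding h0 by (simp add: h_def \<theta>_def abs_le_iff)
  next
    case False
    have "h 1 x \<le> h 1 (X 0)" "h (-1) x \<le> h (-1) (X 0)"
      using mono[of x "X 0"] X_le[of 0 R] R False x by auto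
    moreover have "T x \<le> 0" using X_interval[of "-R" x 0] False x by simp
    ultimately show ?thesis unfolding h0 by (simp add: h_def \<theta>_def abs_le_iff)
  qed
qed

text \<open>
  In the variable \<open>y = T x\<close> this is the integral of \<open>y exp (y\<^sup>2 / 4) \<phi> y\<close>, which has an elementary primitive.
\<close>

lemma weighted_T_integral:
  assumes "a \<le> b"
  shows "(LBINT x:{X a..X b}. F x * (T x * exp ((T x)\<^sup>2 / 4))) = 2 / sqrt (2 * pi) * (exp (- a\<^sup>2 / 4) - exp (- b\<^sup>2 / 4))"
proof -
  have P: "primitive_on (X a) (X b) (\<lambda>x. - (2 / sqrt (2 * pi)) * exp (- (T x)\<^sup>2 / 4)) (\<lambda>x. F x * (T x * exp ((T x)\<^sup>2 / 4)))"
  proof (rule primitive_on_DERIV)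
    fix x assume x: "X a \<le> x" "x \<le> X b"
    have "exp (- (T x)\<^sup>2 / 2) * exp ((T x)\<^sup>2 / 4) = exp (- (T x)\<^sup>2 / 4)"
      unfolding mult_exp_exp by (simp add: field_simps)
    then have *: "\<phi> (T x) * exp ((T x)\<^sup>2 / 4) = exp (- (T x)\<^sup>2 / 4) / sqrt (2 * pi)"
      by (simp add: std_normal_density_def)
    have "F x * (T x * exp ((T x)\<^sup>2 / 4)) = q x * T x * (\<phi> (T x) * exp ((T x)\<^sup>2 / 4))"
      by (simp add: q_phi[symmetric] mult_ac)
    then have **: "F x * (T x * exp ((T x)\<^sup>2 / 4)) = q x * T x * (exp (- (T x)\<^sup>2 / 4) / sqrt (2 * pi))"
      unfolding * .
    have DT: "(T has_real_derivative q x) (at x)" by (rule DERIV_T_q[OF x])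
    show "((\<lambda>x. - (2 / sqrt (2 * pi)) * exp (- (T x)\<^sup>2 / 4)) has_real_derivative F x * (T x * exp ((T x)\<^sup>2 / 4))) (at x)"
      unfolding ** by (auto intro!: derivative_eq_intros DT simp: field_simps)
  next
    show "continuous_on {X a..X b} (\<lambda>x. F x * (T x * exp ((T x)\<^sup>2 / 4)))"
      by (intro continuous_intros F_cont T_cont) simp
  qed
  show ?thesis
    using primitive_on_increment[OF P, of "X a" "X b"] X_le[OF assms] by (simp add: T_X algebra_simps)
qed

lemma middle_bound:
  assumes e: "2 * sqrt (pi * D) \<le> \<epsilon>" "0 < \<epsilon>" and R: "0 \<le> R" "\<epsilon> * exp (R\<^sup>2 / 4) = 1 / 2"
  shows "(LBINT x:{X (- R)..X R}. F x * \<bar>\<theta> x + X 0\<bar>) \<le> 4 * \<epsilon>"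
proof -
  have I: "set_integrable lborel {X a..X b} (\<lambda>x. F x * \<bar>\<theta> x + X 0\<bar>)" for a b
    by (intro borel_integrable_atLeastAtMost' continuous_intros F_cont theta_cont)
  have J: "set_integrable lborel {X a..X b} (\<lambda>x. F x * (T x * exp ((T x)\<^sup>2 / 4)))" for a b
    by (intro borel_integrable_atLeastAtMost' continuous_intros F_cont T_cont) auto
  have xs: "X (- R) \<le> X 0" "X 0 \<le> X R" using R by (auto intro: X_le)
  have pi2: "2 / sqrt (2 * pi) \<le> 1" using real_sqrt_le_mono[of 4 "2 * pi"] pi_gt3 by simp
  have piece: "2 / sqrt (2 * pi) * (1 - exp (- R\<^sup>2 / 4)) \<le> 1"
    using mult_mono[OF pi2, of "1 - exp (- R\<^sup>2 / 4)" 1] by simp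
  have "(LBINT x:{X 0..X R}. F x * \<bar>\<theta> x + X 0\<bar>) \<le> (LBINT x:{X 0..X R}. 2 * \<epsilon> * (F x * (T x * exp ((T x)\<^sup>2 / 4))))"
  proof (rule set_integral_mono[OF I set_integrable_mult_right[OF J]])
    fix x assume x: "x \<in> {X 0..X R}"
    then have "0 \<le> T x" using X_interval[of 0 x R] by simp
    moreover have "\<bar>\<theta> x + X 0\<bar> \<le> 2 * \<epsilon> * (\<bar>T x\<bar> * exp ((T x)\<^sup>2 / 4))"
      using x xs by (intro near_identity[OF e R]) auto
    ultimately have "F x * \<bar>\<theta> x + X 0\<bar> \<le> F x * (2 * \<epsilon> * (T x * exp ((T x)\<^sup>2 / 4)))"
      by (intro mult_left_mono F_nonneg) simp
    then show "F x * \<bar>\<theta> x + X 0\<bar> \<le> 2 * \<epsilon> * (F x * (T x * exp ((T x)\<^sup>2 / 4)))" by (simp only: mult.left_commute)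
  qed
  also have "\<dots> = 2 * \<epsilon> * (2 / sqrt (2 * pi) * (1 - exp (- R\<^sup>2 / 4)))"
    using weighted_T_integral[OF R(1)] by simp
  also have "\<dots> \<le> 2 * \<epsilon> * 1" using e by (intro mult_left_mono piece) simp
  finally have right: "(LBINT x:{X 0..X R}. F x * \<bar>\<theta> x + X 0\<bar>) \<le> 2 * \<epsilon>" by simp
  have "(LBINT x:{X (- R)..X 0}. F x * \<bar>\<theta> x + X 0\<bar>) \<le> (LBINT x:{X (- R)..X 0}. - (2 * \<epsilon>) * (F x * (T x * exp ((T x)\<^sup>2 / 4))))"
  proof (rule set_integral_mono[OF I set_integrable_mult_right[OF J]])
    fix x assume x: "x \<in> {X (- R)..X 0}"
    then have "T x \<le> 0" using X_interval[of "-R" x 0] by simp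
    moreover have "\<bar>\<theta> x + X 0\<bar> \<le> 2 * \<epsilon> * (\<bar>T x\<bar> * exp ((T x)\<^sup>2 / 4))"
      using x xs by (intro near_identity[OF e R]) auto
    ultimately have "F x * \<bar>\<theta> x + X 0\<bar> \<le> F x * (- (2 * \<epsilon>) * (T x * exp ((T x)\<^sup>2 / 4)))"
      by (intro mult_left_mono F_nonneg) simp
    then show "F x * \<bar>\<theta> x + X 0\<bar> \<le> - (2 * \<epsilon>) * (F x * (T x * exp ((T x)\<^sup>2 / 4)))" by (simp only: mult.left_commute)
  qed
  also have "\<dots> = 2 * \<epsilon> * (2 / sqrt (2 * pi) * (1 - exp (- R\<^sup>2 / 4)))"
    unfolding set_integral_mult_right using weighted_T_integral[of "-R" 0] R(1)
    by (simp add: right_diff_distrib)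
  also have "\<dots> \<le> 2 * \<epsilon> * 1" using e by (intro mult_left_mono piece) simp
  finally have left: "(LBINT x:{X (- R)..X 0}. F x * \<bar>\<theta> x + X 0\<bar>) \<le> 2 * \<epsilon>" by simp
  show ?thesis using set_lborel_integral_split[OF I xs] left right by simp
qed

lemma F_sq_shift: "integrable lborel (\<lambda>x. F x * (\<theta> x + c)\<^sup>2)"
  "(LBINT x. F x * (\<theta> x + c)\<^sup>2) = (LBINT x. F x * (\<theta> x)\<^sup>2) + c\<^sup>2"
proof -
  have e: "(\<lambda>x. F x * (\<theta> x + c)\<^sup>2) = (\<lambda>x. F x * (\<theta> x)\<^sup>2 + 2 * c * (F x * \<theta> x) + c\<^sup>2 * F x)"
    by (auto simp: power2_sum algebra_simps)
  show "integrable lborel (\<lambda>x. F x * (\<theta> x + c)\<^sup>2)" unfolding e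
    by (intro Bochner_Integration.integrable_add integrable_mult_right theta_moments F_int)
  show "(LBINT x. F x * (\<theta> x + c)\<^sup>2) = (LBINT x. F x * (\<theta> x)\<^sup>2) + c\<^sup>2"
    unfolding e using theta_moments F_int by (simp add: F_mass)
qed

text \<open>
  Outside \<open>{X (- R)..X R}\<close> the mass is at most \<open>exp (- R\<^sup>2 / 2)\<close>, and the displacement is square integrable.
\<close>

lemma tail_bound:
  assumes R: "0 \<le> R"
  shows "integrable lborel (\<lambda>x. F x * \<bar>\<theta> x + c\<bar>)"
    "(LBINT x. F x * \<bar>\<theta> x + c\<bar>) \<le> (LBINT x:{X (- R)..X R}. F x * \<bar>\<theta> x + c\<bar>) + (M + \<bar>c\<bar>) * exp (- R\<^sup>2 / 4)"
proof -
  let ?S = "{X (- R)..X R}"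
  let ?o = "\<lambda>x. indicator (- ?S) x :: real"
  show I: "integrable lborel (\<lambda>x. F x * \<bar>\<theta> x + c\<bar>)"
    by (rule integrable_F_of_square) (use F_sq_shift(1) in auto)
  have O1: "integrable lborel (\<lambda>x. F x * (?o x)\<^sup>2)"
    by (rule Bochner_Integration.integrable_bound[OF F_int]) (auto simp: indicator_def)
  have "(LBINT x. F x * (?o x)\<^sup>2) = (LBINT x. F x - indicator ?S x * F x)"
    by (rule Bochner_Integration.integral_cong) (auto simp: indicator_def)
  also have "\<dots> = 1 - (G (X R) - G (X (- R)))"
    using F_int set_integrable_of_integrable[OF F_int, of ?S] G_diff[of "X (- R)" "X R"] X_le[of "-R" R] R
    by (simp add: F_mass set_integrable_def set_lebesgue_integral_def)
  also have "\<dots> = 2 * (1 - Phi R)" by (simp add: G_X Phi_minus)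
  also have "\<dots> \<le> exp (- R\<^sup>2 / 2)" using Phi_upper_tail[OF R] by simp
  also have "\<dots> = (exp (- R\<^sup>2 / 4))\<^sup>2" unfolding power2_eq_square mult_exp_exp by simp
  finally have "sqrt (LBINT x. F x * (?o x)\<^sup>2) \<le> sqrt ((exp (- R\<^sup>2 / 4))\<^sup>2)" by (rule real_sqrt_le_mono)
  then have o: "sqrt (LBINT x. F x * (?o x)\<^sup>2) \<le> exp (- R\<^sup>2 / 4)" by simp
  have "sqrt (LBINT x. F x * (\<theta> x + c)\<^sup>2) \<le> sqrt (LBINT x. F x * (\<theta> x)\<^sup>2) + sqrt (c\<^sup>2)"
    unfolding F_sq_shift(2) by (rule sqrt_add_le_add_sqrt) (use theta_second_nonneg in auto)
  then have p: "sqrt (LBINT x. F x * (\<theta> x + c)\<^sup>2) \<le> M + \<bar>c\<bar>" using sqrt_theta_le_M by simp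
  have "(LBINT x. F x * \<bar>(\<theta> x + c) * ?o x\<bar>) \<le> sqrt (LBINT x. F x * (\<theta> x + c)\<^sup>2) * sqrt (LBINT x. F x * (?o x)\<^sup>2)"
    by (rule weighted_Cauchy_Schwarz(2)[OF _ _ _ F_nonneg F_sq_shift(1) O1]) measurable
  also have "\<dots> \<le> (M + \<bar>c\<bar>) * exp (- R\<^sup>2 / 4)"
    by (intro mult_mono p o) (use M_nonneg in \<open>auto intro!: Bochner_Integration.integral_nonneg mult_nonneg_nonneg F_nonneg\<close>)
  finally have out: "(LBINT x. F x * \<bar>(\<theta> x + c) * ?o x\<bar>) \<le> (M + \<bar>c\<bar>) * exp (- R\<^sup>2 / 4)" .
  have IS: "integrable lborel (\<lambda>x. indicator ?S x * (F x * \<bar>\<theta> x + c\<bar>))"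
    using set_integrable_of_integrable[OF I, of ?S] by (simp add: set_integrable_def)
  have "(LBINT x. F x * \<bar>(\<theta> x + c) * ?o x\<bar>) = (LBINT x. F x * \<bar>\<theta> x + c\<bar> - indicator ?S x * (F x * \<bar>\<theta> x + c\<bar>))"
    by (rule Bochner_Integration.integral_cong) (auto simp: indicator_def)
  also have "\<dots> = (LBINT x. F x * \<bar>\<theta> x + c\<bar>) - (LBINT x:?S. F x * \<bar>\<theta> x + c\<bar>)"
    using I IS by (simp add: set_lebesgue_integral_def)
  finally show "(LBINT x. F x * \<bar>\<theta> x + c\<bar>) \<le> (LBINT x:?S. F x * \<bar>\<theta> x + c\<bar>) + (M + \<bar>c\<bar>) * exp (- R\<^sup>2 / 4)"
    using out by simp
qed

definition transport_cost :: real where "transport_cost = (LBINT x. F x * \<bar>\<theta> x\<bar>)"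

lemma int_F_theta: "integrable lborel (\<lambda>x. F x * \<bar>\<theta> x\<bar>)"
  using tail_bound(1)[of 0 0] by simp

lemma transport_cost_le_M: "transport_cost \<le> M"
proof -
  have "(LBINT x. F x * \<bar>\<theta> x * 1\<bar>) \<le> sqrt (LBINT x. F x * (\<theta> x)\<^sup>2) * sqrt (LBINT x. F x * 1\<^sup>2)"
    by (rule weighted_Cauchy_Schwarz(2)[OF _ _ _ F_nonneg theta_moments(1)]) (use F_int in auto)
  then show ?thesis using sqrt_theta_le_M by (simp add: transport_cost_def F_mass)
qed

text \<open>
  The middle part and the tail give \<open>a \<le> 4 \<epsilon> + 2 \<epsilon> (M + \<bar>X 0\<bar>)\<close> for \<open>a = \<integral> \<bar>\<theta> + X 0\<bar> F\<close>. Centering means that \<open>\<theta>\<close> has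
  mean 0, whence \<open>\<bar>X 0\<bar> \<le> a\<close>; for \<open>\<epsilon> \<le> 1/4\<close> the term with \<open>X 0\<close> is absorbed.
\<close>

lemma transport_cost_small:
  assumes e: "2 * sqrt (pi * D) \<le> \<epsilon>" "0 < \<epsilon>" "\<epsilon> \<le> 1 / 4"
  shows "transport_cost \<le> (16 + 8 * M) * \<epsilon>"
proof -
  \<comment> \<open>the solution of \<open>\<epsilon> exp (R\<^sup>2 / 4) = 1/2\<close>\<close>
  define R where "R = 2 * sqrt (ln (1 / (2 * \<epsilon>)))"
  have l: "0 \<le> ln (1 / (2 * \<epsilon>))" using e by (intro ln_ge_zero) (simp add: field_simps)
  then have R0: "0 \<le> R" by (simp add: R_def)
  have "R\<^sup>2 / 4 = ln (1 / (2 * \<epsilon>))" using l by (simp add: R_def power_mult_distrib)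
  then have eR: "exp (R\<^sup>2 / 4) = 1 / (2 * \<epsilon>)" using e by simp
  then have R1: "\<epsilon> * exp (R\<^sup>2 / 4) = 1 / 2" using e by simp
  have "exp (- R\<^sup>2 / 4) = 2 * \<epsilon>"
    using eR exp_minus[of "R\<^sup>2 / 4"] by simp
  define a where "a = (LBINT x. F x * \<bar>\<theta> x + X 0\<bar>)"
  have a: "a \<le> 4 * \<epsilon> + (M + \<bar>X 0\<bar>) * (2 * \<epsilon>)"
    using tail_bound(2)[OF R0, of "X 0"] middle_bound[OF e(1,2) R0 R1]
    unfolding a_def \<open>exp (- R\<^sup>2 / 4) = 2 * \<epsilon>\<close> by linarith
  have i1: "integrable lborel (\<lambda>x. F x * (\<theta> x + X 0))"
    using theta_moments(3) F_int by (simp add: distrib_left)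
  have "(LBINT x. F x * (\<theta> x + X 0)) = X 0"
    using theta_moments(3,4) F_int by (simp add: distrib_left F_mass)
  moreover have "\<bar>LBINT x. F x * (\<theta> x + X 0)\<bar> \<le> (LBINT x. \<bar>F x * (\<theta> x + X 0)\<bar>)"
    by (rule integral_abs_bound)
  ultimately have x0: "\<bar>X 0\<bar> \<le> a" using F_nonneg by (simp add: a_def abs_mult)
  have "transport_cost \<le> (LBINT x. F x * \<bar>\<theta> x + X 0\<bar> + F x * \<bar>X 0\<bar>)"
    unfolding transport_cost_def
  proof (rule integral_mono[OF int_F_theta])
    show "integrable lborel (\<lambda>x. F x * \<bar>\<theta> x + X 0\<bar> + F x * \<bar>X 0\<bar>)"
      using tail_bound(1)[OF R0] F_int by (intro Bochner_Integration.integrable_add) auto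
    fix x
    have "F x * \<bar>\<theta> x\<bar> \<le> F x * (\<bar>\<theta> x + X 0\<bar> + \<bar>X 0\<bar>)" by (intro mult_left_mono F_nonneg) simp
    then show "F x * \<bar>\<theta> x\<bar> \<le> F x * \<bar>\<theta> x + X 0\<bar> + F x * \<bar>X 0\<bar>" by (simp add: distrib_left)
  qed
  also have "\<dots> = a + \<bar>X 0\<bar>"
    using tail_bound(1)[OF R0, of "X 0"] F_int by (simp add: a_def F_mass)
  finally have d: "transport_cost \<le> a + \<bar>X 0\<bar>" .
  have h: "\<bar>X 0\<bar> * (2 * \<epsilon>) \<le> \<bar>X 0\<bar> * (1 / 2)" using e by (intro mult_left_mono) auto
  have "a \<le> 4 * \<epsilon> + 2 * (M * \<epsilon>) + \<bar>X 0\<bar> / 2" using a h by (simp add: algebra_simps)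
  then have "a \<le> 8 * \<epsilon> + 4 * (M * \<epsilon>)" using x0 by linarith
  then have "transport_cost \<le> 16 * \<epsilon> + 8 * (M * \<epsilon>)" using x0 d by linarith
  then show ?thesis by (simp add: algebra_simps)
qed

text \<open>
  For small positive deficit take \<open>\<epsilon> = 2 sqrt (pi D)\<close>, for deficit 0 let \<open>\<epsilon>\<close> tend to 0, and for large deficit
  the trivial bound \<open>M\<close> suffices.
\<close>

lemma transport_cost_bound: "transport_cost \<le> (32 + 16 * M) * sqrt (pi * D)"
proof -
  let ?d = "2 * sqrt (pi * D)"
  have d0: "0 \<le> ?d" using D_nonneg by simp
  consider "?d = 0" | "0 < ?d" "?d \<le> 1 / 4" | "1 / 4 < ?d" using d0 by linarith
  then show ?thesis
  proof cases
    case 1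
    have "transport_cost \<le> 0 + y" if "0 < y" for y
    proof -
      define \<epsilon> where "\<epsilon> = min (1 / 4) (y / (16 + 8 * M))"
      have e: "0 < \<epsilon>" "\<epsilon> \<le> 1 / 4" using that M_nonneg by (simp add: \<epsilon>_def add_pos_nonneg, simp only: \<epsilon>_def min.cobounded1)
      have "transport_cost \<le> (16 + 8 * M) * \<epsilon>" using 1 e by (intro transport_cost_small) auto
      also have "\<dots> \<le> (16 + 8 * M) * (y / (16 + 8 * M))" using M_nonneg by (intro mult_left_mono) (auto simp: \<epsilon>_def)
      also have "\<dots> = y" using M_nonneg by simp
      finally show ?thesis by simp
    qed
    then have "transport_cost \<le> 0" by (rule field_le_epsilon)
    then show ?thesis using 1 by simp
  next
    case 2
    from transport_cost_small[OF order_refl this] show ?thesis by (simp add: algebra_simps)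
  next
    case 3
    have "M * (1 / 4) \<le> M * ?d" using 3 M_nonneg by (intro mult_left_mono) auto
    then have "M \<le> 8 * (M * sqrt (pi * D))" by simp
    moreover have "0 \<le> M * sqrt (pi * D)" "0 \<le> sqrt (pi * D)" using M_nonneg D_nonneg by auto
    moreover have "(32 + 16 * M) * sqrt (pi * D) = 32 * sqrt (pi * D) + 16 * (M * sqrt (pi * D))"
      by (simp only: distrib_right mult.assoc)
    ultimately show ?thesis using transport_cost_le_M by linarith
  qed
qed

section \<open>Gradient and L1 bounds\<close>

definition gradient_const :: real where "gradient_const = sqrt 2 + (32 + 16 * M) * sqrt pi"

lemma gradient_const_nonneg: "0 \<le> gradient_const" using M_nonneg by (simp add: gradient_const_def)

lemma sqrt2D_transport_cost: "sqrt (2 * D) + transport_cost \<le> gradient_const * sqrt D"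
  using transport_cost_bound by (simp add: gradient_const_def real_sqrt_mult algebra_simps)

lemma int_W: "integrable lborel (\<lambda>x. \<phi> x * (2 * s x + \<theta> x * u x)\<^sup>2)"
  and sqrt_W: "sqrt (LBINT x. \<phi> x * (2 * s x + \<theta> x * u x)\<^sup>2) \<le> sqrt (2 * D)"
  using deficit_bound unfolding W_def[abs_def] by auto

text \<open>
  Split \<open>2 u s = u (2 s + \<theta> u) - u\<^sup>2 \<theta>\<close>.
\<close>

lemma density_gradient_bound: "(LBINT x. \<phi> x * \<bar>2 * u x * s x\<bar>) \<le> gradient_const * sqrt D"
proof -
  have CS: "(LBINT x. \<phi> x * \<bar>u x * (2 * s x + \<theta> x * u x)\<bar>) \<le> sqrt (LBINT x. \<phi> x * (u x)\<^sup>2) * sqrt (LBINT x. \<phi> x * (2 * s x + \<theta> x * u x)\<^sup>2)"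
    by (rule weighted_Cauchy_Schwarz(2)[OF _ _ _ _ int_u2 int_W]) (auto simp: phi_nonneg)
  have I: "integrable lborel (\<lambda>x. \<phi> x * \<bar>u x * (2 * s x + \<theta> x * u x)\<bar>)"
    using integrable_abs[OF weighted_Cauchy_Schwarz(1)[OF _ _ _ _ int_u2 int_W]] by (simp add: abs_mult phi_nonneg)
  have L: "integrable lborel (\<lambda>x. \<phi> x * \<bar>2 * u x * s x\<bar>)"
    using integrable_abs[OF integrable_mult_right[OF int_us, of 2]] by (simp add: abs_mult mult_ac)
  have "(LBINT x. \<phi> x * \<bar>2 * u x * s x\<bar>) \<le> (LBINT x. \<phi> x * \<bar>u x * (2 * s x + \<theta> x * u x)\<bar> + F x * \<bar>\<theta> x\<bar>)"
  proof (rule integral_mono[OF L Bochner_Integration.integrable_add[OF I int_F_theta]])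
    fix x
    have "2 * u x * s x = u x * (2 * s x + \<theta> x * u x) - (u x)\<^sup>2 * \<theta> x" by (simp add: power2_eq_square algebra_simps)
    then have "\<bar>2 * u x * s x\<bar> \<le> \<bar>u x * (2 * s x + \<theta> x * u x)\<bar> + (u x)\<^sup>2 * \<bar>\<theta> x\<bar>"
      using abs_triangle_ineq4[of "u x * (2 * s x + \<theta> x * u x)" "(u x)\<^sup>2 * \<theta> x"] by (simp add: abs_mult)
    then have "\<phi> x * \<bar>2 * u x * s x\<bar> \<le> \<phi> x * (\<bar>u x * (2 * s x + \<theta> x * u x)\<bar> + (u x)\<^sup>2 * \<bar>\<theta> x\<bar>)"
      by (rule mult_left_mono) (simp add: phi_nonneg)
    then show "\<phi> x * \<bar>2 * u x * s x\<bar> \<le> \<phi> x * \<bar>u x * (2 * s x + \<theta> x * u x)\<bar> + F x * \<bar>\<theta> x\<bar>"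
      by (simp add: F_def distrib_left mult.assoc)
  qed
  also have "\<dots> = (LBINT x. \<phi> x * \<bar>u x * (2 * s x + \<theta> x * u x)\<bar>) + transport_cost"
    unfolding transport_cost_def by (rule Bochner_Integration.integral_add[OF I int_F_theta])
  also have "\<dots> \<le> sqrt (2 * D) + transport_cost" using order_trans[OF CS[unfolded mass real_sqrt_one mult_1] sqrt_W] by (rule add_right_mono)
  also have "\<dots> \<le> gradient_const * sqrt D" by (rule sqrt2D_transport_cost)
  finally show ?thesis .
qed

lemma density_L1_bound: "(LBINT x. \<phi> x * \<bar>(u x)\<^sup>2 - 1\<bar>) \<le> sqrt (2 * pi) * (gradient_const * sqrt D)"
proof -
  have m: "(\<lambda>x. 2 * u x * s x) \<in> borel_measurable borel" by measurable
  have I: "integrable lborel (\<lambda>x. \<phi> x * (2 * u x * s x))"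
    using integrable_mult_right[OF int_us, of 2] by (simp add: mult_ac)
  have "(LBINT x. \<phi> x * \<bar>(u x)\<^sup>2 - 1\<bar>) \<le> sqrt (2 * pi) * (LBINT x. \<phi> x * \<bar>2 * u x * s x\<bar>)"
    using gaussian_poincare_L1(2)[OF prim_u2 m I] by (simp add: mass)
  also have "\<dots> \<le> sqrt (2 * pi) * (gradient_const * sqrt D)" by (rule mult_left_mono[OF density_gradient_bound]) simp
  finally show ?thesis .
qed

lemma int_density_minus_1: "integrable lborel (\<lambda>x. \<phi> x * \<bar>(u x)\<^sup>2 - 1\<bar>)"
proof -
  have "\<phi> x * \<bar>(u x)\<^sup>2 - 1\<bar> = \<bar>\<phi> x * (u x)\<^sup>2 - \<phi> x\<bar>" for x
    using abs_mult[of "\<phi> x" "(u x)\<^sup>2 - 1"] phi_pos[of x] by (simp add: right_diff_distrib)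
  then show ?thesis
    using integrable_abs[OF Bochner_Integration.integrable_diff[OF int_u2 integrable_phi]] by simp
qed

lemma int_phi_of_square:
  assumes [measurable]: "g \<in> borel_measurable borel" and I: "integrable lborel (\<lambda>x. \<phi> x * (g x)\<^sup>2)"
  shows "integrable lborel (\<lambda>x. \<phi> x * g x)"
  using weighted_Cauchy_Schwarz(1)[of \<phi> lborel "\<lambda>_. 1" g] I by (simp add: phi_nonneg)

lemma u_minus_1_le: "(u x - 1)\<^sup>2 \<le> \<bar>(u x)\<^sup>2 - 1\<bar>" "\<bar>u x - 1\<bar> \<le> \<bar>(u x)\<^sup>2 - 1\<bar>"
proof -
  have f: "\<bar>(u x)\<^sup>2 - 1\<bar> = \<bar>u x - 1\<bar> * (u x + 1)"
    using u_nonneg[of x] abs_mult[of "u x - 1" "u x + 1"] by (simp add: power2_eq_square algebra_simps)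
  have "\<bar>u x - 1\<bar> * \<bar>u x - 1\<bar> \<le> \<bar>u x - 1\<bar> * (u x + 1)" using u_nonneg[of x] by (intro mult_left_mono) auto
  then show "(u x - 1)\<^sup>2 \<le> \<bar>(u x)\<^sup>2 - 1\<bar>" unfolding f by (simp add: power2_eq_square abs_mult_self_eq)
  have "\<bar>u x - 1\<bar> * 1 \<le> \<bar>u x - 1\<bar> * (u x + 1)" using u_nonneg[of x] by (intro mult_left_mono) auto
  then show "\<bar>u x - 1\<bar> \<le> \<bar>(u x)\<^sup>2 - 1\<bar>" unfolding f by simp
qed

lemma int_phi_root: "integrable lborel (\<lambda>x. \<phi> x * \<bar>u x - 1\<bar>)"
  by (rule Bochner_Integration.integrable_bound[OF int_density_minus_1])
     (auto intro!: mult_mono u_minus_1_le simp: abs_mult)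

lemma int_phi_s: "integrable lborel (\<lambda>x. \<phi> x * \<bar>s x\<bar>)"
  using integrable_abs[OF int_phi_of_square[OF s_borel int_s2]] by (simp add: abs_mult phi_nonneg)

lemma root_L1_bound: "(LBINT x. \<phi> x * \<bar>u x - 1\<bar>) \<le> sqrt (2 * pi) * (gradient_const * sqrt D)"
proof -
  have "(LBINT x. \<phi> x * \<bar>u x - 1\<bar>) \<le> (LBINT x. \<phi> x * \<bar>(u x)\<^sup>2 - 1\<bar>)"
  proof (rule integral_mono[OF int_phi_root int_density_minus_1])
    show "\<phi> x * \<bar>u x - 1\<bar> \<le> \<phi> x * \<bar>(u x)\<^sup>2 - 1\<bar>" for x
      by (intro mult_left_mono u_minus_1_le) (simp add: phi_nonneg)
  qed
  then show ?thesis using density_L1_bound by linarith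
qed

text \<open>
  Split \<open>2 s = (2 s + \<theta> u) - u\<^sup>2 \<theta> + \<theta> u (u - 1)\<close>. The last term is the product of \<open>\<theta> u\<close>, whose \<open>L\<^sup>2\<close> norm is at
  most \<open>M\<close>, and \<open>u - 1\<close>, whose squared \<open>L\<^sup>2\<close> norm is at most the \<open>L\<^sup>1\<close> norm of \<open>u\<^sup>2 - 1\<close>.
\<close>

lemma root_gradient_bound:
  "(LBINT x. \<phi> x * \<bar>s x\<bar>) \<le> gradient_const * sqrt D + M * sqrt (sqrt (2 * pi) * (gradient_const * sqrt D))"
proof -
  let ?w = "\<lambda>x. 2 * s x + \<theta> x * u x"
  have wI: "integrable lborel (\<lambda>x. \<phi> x * \<bar>?w x\<bar>)"
    using integrable_abs[OF int_phi_of_square[OF _ int_W]] by (simp add: abs_mult phi_nonneg)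
  have W: "(LBINT x. \<phi> x * \<bar>?w x\<bar>) \<le> sqrt (2 * D)"
  proof -
    have "(LBINT x. \<phi> x * \<bar>1 * ?w x\<bar>) \<le> sqrt (LBINT x. \<phi> x * 1\<^sup>2) * sqrt (LBINT x. \<phi> x * (?w x)\<^sup>2)"
      by (rule weighted_Cauchy_Schwarz(2)[OF _ _ _ _ _ int_W]) (auto simp: phi_nonneg)
    then have "(LBINT x. \<phi> x * \<bar>?w x\<bar>) \<le> sqrt (LBINT x. \<phi> x * (?w x)\<^sup>2)" by (simp add: integral_phi)
    then show ?thesis using sqrt_W by (rule order_trans)
  qed
  have e: "(\<lambda>x. \<phi> x * (\<theta> x * u x)\<^sup>2) = (\<lambda>x. F x * (\<theta> x)\<^sup>2)" by (auto simp: F_def power_mult_distrib)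
  have tI: "integrable lborel (\<lambda>x. \<phi> x * (\<theta> x * u x)\<^sup>2)" unfolding e by (rule theta_moments(1))
  have vI: "integrable lborel (\<lambda>x. \<phi> x * (u x - 1)\<^sup>2)"
    by (rule Bochner_Integration.integrable_bound[OF int_density_minus_1])
       (auto intro!: mult_mono u_minus_1_le simp: abs_mult)
  have v: "(LBINT x. \<phi> x * (u x - 1)\<^sup>2) \<le> sqrt (2 * pi) * (gradient_const * sqrt D)"
    using integral_mono[OF vI int_density_minus_1] density_L1_bound
    by (smt (verit) mult_left_mono phi_pos u_minus_1_le(1))
  have cI: "integrable lborel (\<lambda>x. \<phi> x * \<bar>\<theta> x * u x * (u x - 1)\<bar>)"
    using integrable_abs[OF weighted_Cauchy_Schwarz(1)[OF _ _ _ _ tI vI]]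
    by (simp add: abs_mult phi_nonneg mult.assoc)
  have CS: "(LBINT x. \<phi> x * \<bar>\<theta> x * u x * (u x - 1)\<bar>) \<le> M * sqrt (sqrt (2 * pi) * (gradient_const * sqrt D))"
  proof -
    have "(LBINT x. \<phi> x * \<bar>\<theta> x * u x * (u x - 1)\<bar>) \<le> sqrt (LBINT x. \<phi> x * (\<theta> x * u x)\<^sup>2) * sqrt (LBINT x. \<phi> x * (u x - 1)\<^sup>2)"
      by (rule weighted_Cauchy_Schwarz(2)[OF _ _ _ _ tI vI]) (auto simp: phi_nonneg)
    also have "\<dots> \<le> M * sqrt (sqrt (2 * pi) * (gradient_const * sqrt D))"
      unfolding e
      by (intro mult_mono sqrt_theta_le_M real_sqrt_le_mono v M_nonneg real_sqrt_ge_zero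
          Bochner_Integration.integral_nonneg mult_nonneg_nonneg) (auto simp: phi_nonneg)
    finally show ?thesis .
  qed
  have "(LBINT x. \<phi> x * \<bar>s x\<bar>) \<le> (LBINT x. \<phi> x * \<bar>?w x\<bar> + (F x * \<bar>\<theta> x\<bar> + \<phi> x * \<bar>\<theta> x * u x * (u x - 1)\<bar>))"
  proof (rule integral_mono[OF int_phi_s Bochner_Integration.integrable_add[OF wI Bochner_Integration.integrable_add[OF int_F_theta cI]]])
    fix x
    have "2 * s x = ?w x - ((u x)\<^sup>2 * \<theta> x - \<theta> x * u x * (u x - 1))" by (simp add: power2_eq_square algebra_simps)
    then have "2 * \<bar>s x\<bar> \<le> \<bar>?w x\<bar> + (\<bar>(u x)\<^sup>2 * \<theta> x\<bar> + \<bar>\<theta> x * u x * (u x - 1)\<bar>)" by linarith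
    then have "\<bar>s x\<bar> \<le> \<bar>?w x\<bar> + ((u x)\<^sup>2 * \<bar>\<theta> x\<bar> + \<bar>\<theta> x * u x * (u x - 1)\<bar>)" by (simp add: abs_mult[of "(u x)\<^sup>2"])
    then have "\<phi> x * \<bar>s x\<bar> \<le> \<phi> x * (\<bar>?w x\<bar> + ((u x)\<^sup>2 * \<bar>\<theta> x\<bar> + \<bar>\<theta> x * u x * (u x - 1)\<bar>))"
      by (rule mult_left_mono) (simp add: phi_nonneg)
    then show "\<phi> x * \<bar>s x\<bar> \<le> \<phi> x * \<bar>?w x\<bar> + (F x * \<bar>\<theta> x\<bar> + \<phi> x * \<bar>\<theta> x * u x * (u x - 1)\<bar>)"
      by (simp only: F_def distrib_left mult.assoc)
  qed
  also have "\<dots> = (LBINT x. \<phi> x * \<bar>?w x\<bar>) + (transport_cost + (LBINT x. \<phi> x * \<bar>\<theta> x * u x * (u x - 1)\<bar>))"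
    unfolding transport_cost_def
    by (subst Bochner_Integration.integral_add[OF wI Bochner_Integration.integrable_add[OF int_F_theta cI]],
        subst Bochner_Integration.integral_add[OF int_F_theta cI]) simp
  also have "\<dots> \<le> gradient_const * sqrt D + M * sqrt (sqrt (2 * pi) * (gradient_const * sqrt D))"
    using W CS sqrt2D_transport_cost by linarith
  finally show ?thesis .
qed

end

section \<open>Reduction of the two Sobolev settings to the transport setting\<close>

lemma AE_weighted_lebesgue:
  assumes "w \<in> borel_measurable borel" "\<And>x. 0 < (w x :: real)"
  shows "(AE x in density lebesgue (\<lambda>x. ennreal (w x)). Q x) \<longleftrightarrow> (AE x in lborel. Q x)"
proof -
  have m: "(\<lambda>x. ennreal (w x)) \<in> borel_measurable lebesgue"
    using assms(1) by (intro measurable_completion) simp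
  show ?thesis using assms(2) by (simp add: AE_density[OF m] AE_completion_iff)
qed

lemma integral_weighted_lebesgue:
  fixes g g' w :: "real \<Rightarrow> real"
  assumes w: "w \<in> borel_measurable borel" "\<And>x. 0 < w x"
    and g: "AE x in lborel. g x = g' x" and g': "g' \<in> borel_measurable borel"
  shows "(LINT x|density lebesgue (\<lambda>x. ennreal (w x)). g x) = (LBINT x. w x * g' x)"
    and "integrable (density lebesgue (\<lambda>x. ennreal (w x))) g \<longleftrightarrow> integrable lborel (\<lambda>x. w x * g' x)"
proof -
  have wm: "w \<in> borel_measurable lebesgue" using w(1) by (simp add: measurable_completion)
  have g'm: "g' \<in> borel_measurable lebesgue" using g' by (simp add: measurable_completion)
  have "AE x in lborel. g' x = g x" using g by eventually_elim simp
  then have gm: "g \<in> borel_measurable lebesgue" by (rule borel_measurable_lebesgue_AE[OF g'm])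
  have w0: "AE x in lebesgue. 0 \<le> w x" by (rule AE_I2) (simp add: less_imp_le w(2))
  have ae: "AE x in lborel. w x *\<^sub>R g x = w x * g' x" using g by eventually_elim simp
  have m: "(\<lambda>x. w x * g' x) \<in> borel_measurable borel" using w(1) g' by simp
  show "(LINT x|density lebesgue (\<lambda>x. ennreal (w x)). g x) = (LBINT x. w x * g' x)"
    unfolding integral_density[OF gm wm w0] by (rule integral_lebesgue_eq_lborel(1)[OF ae m])
  show "integrable (density lebesgue (\<lambda>x. ennreal (w x))) g \<longleftrightarrow> integrable lborel (\<lambda>x. w x * g' x)"
    unfolding integrable_density[OF gm wm w0] by (rule integral_lebesgue_eq_lborel(2)[OF ae m])
qed

lemma nn_integral_weighted_lebesgue:
  fixes g g' w :: "real \<Rightarrow> real"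
  assumes w: "w \<in> borel_measurable borel" "\<And>x. 0 < w x"
    and g: "AE x in lborel. g x = g' x" and g': "g' \<in> borel_measurable borel" "\<And>x. 0 \<le> g' x"
  shows "(\<integral>\<^sup>+x. ennreal (g x) \<partial>density lebesgue (\<lambda>x. ennreal (w x))) = (\<integral>\<^sup>+x. ennreal (w x * g' x) \<partial>lborel)"
proof -
  have wm: "(\<lambda>x. ennreal (w x)) \<in> borel_measurable lebesgue"
    using w(1) by (intro measurable_completion) simp
  have g'm: "g' \<in> borel_measurable lebesgue" using g' by (simp add: measurable_completion)
  have "AE x in lborel. g' x = g x" using g by eventually_elim simp
  then have gm: "g \<in> borel_measurable lebesgue" by (rule borel_measurable_lebesgue_AE[OF g'm])
  have gm: "(\<lambda>x. ennreal (g x)) \<in> borel_measurable lebesgue" using gm by simp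
  have "(\<integral>\<^sup>+x. ennreal (g x) \<partial>density lebesgue (\<lambda>x. ennreal (w x))) = (\<integral>\<^sup>+x. ennreal (w x) * ennreal (g x) \<partial>lebesgue)"
    by (rule nn_integral_density[OF wm gm])
  also have "\<dots> = (\<integral>\<^sup>+x. ennreal (w x * g' x) \<partial>lebesgue)"
  proof (rule nn_integral_cong_AE)
    show "AE x in lebesgue. ennreal (w x) * ennreal (g x) = ennreal (w x * g' x)"
      using AE_completion[OF g] by eventually_elim (simp add: ennreal_mult'' g'(2))
  qed
  also have "\<dots> = (\<integral>\<^sup>+x. ennreal (w x * g' x) \<partial>lborel)" by (rule nn_integral_completion)
  finally show ?thesis .
qed

lemma integrable_if_nn_integral_le:
  fixes g :: "real \<Rightarrow> real"
  assumes "g \<in> borel_measurable borel" "\<And>x. 0 \<le> g x" "(\<integral>\<^sup>+x. ennreal (g x) \<partial>lborel) \<le> ennreal c" "0 \<le> c"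
  shows "integrable lborel g" "(LBINT x. g x) \<le> c"
proof -
  show I: "integrable lborel g"
    using le_less_trans[OF assms(3) ennreal_less_top] assms by (intro integrableI_bounded) auto
  show "(LBINT x. g x) \<le> c"
    using assms(3,4) nn_integral_eq_integral[OF I] assms(2) by simp
qed

lemma continuous_AE_nonneg:
  fixes G :: "real \<Rightarrow> real"
  assumes c: "continuous_on UNIV G" and ae: "AE x in lborel. 0 \<le> G x"
  shows "0 \<le> G x"
proof (rule ccontr)
  assume n: "\<not> 0 \<le> G x"
  have o: "open {x. G x < 0}" using c by (intro open_Collect_less continuous_intros)
  then obtain e where e: "e > 0" "ball x e \<subseteq> {x. G x < 0}" using n open_contains_ball by (metis mem_Collect_eq not_le)
  have s: "{x <..< x + e} \<subseteq> {x. G x < 0}" using e(2) by (auto simp: ball_def dist_real_def subset_eq)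
  have "AE y in lborel. y \<notin> {x <..< x + e}" using ae by eventually_elim (use s in force)
  then have "{x <..< x + e} \<in> null_sets lborel" by (subst AE_iff_null_sets) auto
  then have "emeasure lborel {x <..< x + e} = 0" by (rule null_setsD1)
  then show False using e(1) by (subst (asm) emeasure_lborel_Ioo) auto
qed

lemma primitive_on_square:
  assumes "primitive_on a b G H"
  shows "primitive_on a b (\<lambda>x. (G x)\<^sup>2) (\<lambda>x. 2 * G x * H x)"
  using primitive_on_mult[OF assms assms] by (rule primitive_on_cong) (auto simp: power2_eq_square)

lemma primitive_on_minus_const: "primitive_on a b G H \<Longrightarrow> primitive_on a b (\<lambda>x. G x - c) H"
  by (simp add: primitive_on_def)

lemma sqrt_le_powr:
  fixes x p :: real
  assumes "0 \<le> x" "1 / 2 \<le> p" shows "sqrt x \<le> x powr (1/4) + x powr p"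
proof (cases "x \<le> 1")
  case True
  have "x powr (1/2) \<le> x powr (1/4)" using True assms by (intro powr_mono') auto
  then show ?thesis using assms by (simp add: powr_half_sqrt add_increasing2)
next
  case False
  have "x powr (1/2) \<le> x powr p" using False assms by (intro powr_mono) auto
  then show ?thesis using assms by (simp add: powr_half_sqrt add_increasing)
qed

lemma phi_borel: "\<phi> \<in> borel_measurable borel" by measurable

lemmas integral_gauss = integral_weighted_lebesgue[OF phi_borel phi_pos, folded gauss_def]
lemmas nn_integral_gauss = nn_integral_weighted_lebesgue[OF phi_borel phi_pos, folded gauss_def]
lemmas AE_gauss = AE_weighted_lebesgue[OF phi_borel phi_pos, folded gauss_def]

text \<open>
  Here \<open>s\<close> is the derivative of \<open>sqrt f\<close>, set to 0 where \<open>f\<close> vanishes. With this choice \<open>f'\<^sup>2 / f = 4 s\<^sup>2\<close> holds almost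
  everywhere, including the points where the quotient is \<open>0 / 0\<close>.
\<close>

lemma W11_stability_density:
  fixes f :: "real \<Rightarrow> real"
  assumes \<alpha>: "0 < \<alpha>" and nonneg: "AE x in gauss. 0 \<le> f x"
    and sob: "(\<lambda>x. sqrt (f x)) \<in> sobolev 2 gauss"
    and mass: "(\<integral>x. f x \<partial>gauss) = 1" and centered: "(\<integral>x. x * f x \<partial>gauss) = 0"
    and moment: "(\<integral>\<^sup>+x. ennreal (\<bar>x\<bar>\<^sup>2 * f x) \<partial>gauss) \<le> ennreal \<alpha>"
  shows "(\<lambda>x. f x - 1) \<in> sobolev 1 gauss"
    and "W11_norm gauss (\<lambda>x. f x - 1) \<le>
      (1 + sqrt (2 * pi)) * (sqrt 2 + (32 + 16 * sqrt (2 + 2 * \<alpha>)) * sqrt pi)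
        * (deficit f powr (1/4) + deficit f powr (3/4))"
proof -
  obtain h where wd: "has_weak_deriv (\<lambda>x. sqrt (f x)) h" and I: "integrable gauss (\<lambda>x. \<bar>sqrt (f x)\<bar> ^ 2)" "integrable gauss (\<lambda>x. \<bar>h x\<bar> ^ 2)"
    using sob unfolding sobolev_def by blast
  from has_weak_deriv_imp_primitive[OF wd] obtain U H where
    UH: "H \<in> borel_measurable borel \<and> (\<forall>a b. primitive_on a b U H) \<and> (AE x in lborel. sqrt (f x) = U x) \<and> (AE x in lborel. h x = H x)"
    by (elim exE)
  then have [measurable]: "H \<in> borel_measurable borel" and P: "\<And>a b. primitive_on a b U H"
    and fU: "AE x in lborel. sqrt (f x) = U x" and hH: "AE x in lborel. h x = H x" by simp_all
  have Uc: "continuous_on UNIV U" using P by (rule primitive_on_continuous_UNIV)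
  then have [measurable]: "U \<in> borel_measurable borel" by (rule borel_measurable_continuous_onI)
  have f0: "AE x in lborel. 0 \<le> f x" using nonneg by (simp only: AE_gauss)
  have "AE x in lborel. 0 \<le> U x" using fU f0 by eventually_elim (metis real_sqrt_ge_zero)
  then have U0: "0 \<le> U x" for x by (rule continuous_AE_nonneg[OF Uc])
  have f: "AE x in lborel. f x = (U x)\<^sup>2" using fU f0 by eventually_elim (metis real_sqrt_pow2)
  define s where "s x = (if U x = 0 then 0 else H x)" for x
  have [measurable]: "s \<in> borel_measurable borel" unfolding s_def by measurable
  have P2: "primitive_on a b (\<lambda>x. (U x)\<^sup>2) (\<lambda>x. 2 * U x * s x)" for a b
    using primitive_on_square[OF P] by (rule primitive_on_cong) (auto simp: s_def)
  have U2I: "integrable lborel (\<lambda>x. \<phi> x * (U x)\<^sup>2)"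
    by (rule integral_gauss(2)[THEN iffD1, OF _ _ I(1)]) (use fU in eventually_elim, simp, measurable)
  have H2I: "integrable lborel (\<lambda>x. \<phi> x * (H x)\<^sup>2)"
    by (rule integral_gauss(2)[THEN iffD1, OF _ _ I(2)]) (use hH in eventually_elim, simp, measurable)
  have s2I: "integrable lborel (\<lambda>x. \<phi> x * (s x)\<^sup>2)"
    by (rule Bochner_Integration.integrable_bound[OF H2I]) (auto simp: s_def)
  have massU: "(LBINT x. \<phi> x * (U x)\<^sup>2) = 1"
    using integral_gauss(1)[OF f] mass by simp
  have "AE x in lborel. x * f x = x * (U x)\<^sup>2" using f by eventually_elim simp
  from integral_gauss(1)[OF this] centered
  have centeredU: "(LBINT x. x * (\<phi> x * (U x)\<^sup>2)) = 0" by (simp add: mult.left_commute)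
  have ae: "AE x in lborel. \<bar>x\<bar>\<^sup>2 * f x = (x * U x)\<^sup>2" using f by eventually_elim (simp add: power_mult_distrib)
  have "(\<integral>\<^sup>+x. ennreal (\<phi> x * (x * U x)\<^sup>2) \<partial>lborel) = (\<integral>\<^sup>+x. ennreal (\<bar>x\<bar>\<^sup>2 * f x) \<partial>gauss)"
    by (rule nn_integral_gauss[OF ae, symmetric]) auto
  then have nn: "(\<integral>\<^sup>+x. ennreal (\<phi> x * (x * U x)\<^sup>2) \<partial>lborel) \<le> ennreal \<alpha>" using moment by simp
  have m: "(\<lambda>x. \<phi> x * (x * U x)\<^sup>2) \<in> borel_measurable borel" by measurable
  note xI = integrable_if_nn_integral_le[OF m _ nn]
  interpret gaussian_transport U s \<alpha>
  proof
    show "integrable lborel (\<lambda>x. \<phi> x * (x * U x)\<^sup>2)" "(LBINT x. \<phi> x * (x * U x)\<^sup>2) \<le> \<alpha>"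
      by (rule xI; use \<alpha> in \<open>simp add: phi_nonneg\<close>)+
    show "s \<in> borel_measurable borel" by measurable
  qed (fact Uc U0 P2 U2I massU centeredU s2I)+
  have UH: "2 * U x * s x = 2 * U x * H x" for x by (simp add: s_def)
  have P1: "primitive_on a b (\<lambda>x. (U x)\<^sup>2 - 1) (\<lambda>x. 2 * U x * s x)" for a b
    by (rule primitive_on_minus_const[OF P2])
  have m2: "(\<lambda>x. 2 * U x * s x) \<in> borel_measurable borel" by measurable
  have f1: "AE x in lborel. f x - 1 = (U x)\<^sup>2 - 1" using f by eventually_elim simp
  have f1a: "AE x in lborel. \<bar>f x - 1\<bar> = \<bar>(U x)\<^sup>2 - 1\<bar>" using f by eventually_elim simp
  have w1: "has_weak_deriv (\<lambda>x. f x - 1) (\<lambda>x. 2 * U x * s x)"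
    by (rule primitive_imp_has_weak_deriv[OF P1 m2 f1]) simp
  have gI: "integrable lborel (\<lambda>x. \<phi> x * \<bar>2 * U x * s x\<bar>)"
    using integrable_abs[OF integrable_mult_right[OF int_us, of 2]] by (simp add: abs_mult mult_ac)
  have I1: "integrable gauss (\<lambda>x. \<bar>f x - 1\<bar>)"
    by (rule integral_gauss(2)[OF f1a, THEN iffD2, OF _ int_density_minus_1]) measurable
  have I2: "integrable gauss (\<lambda>x. \<bar>2 * U x * s x\<bar>)"
    by (rule integral_gauss(2)[THEN iffD2, OF _ _ gI]) (simp, measurable)
  show "(\<lambda>x. f x - 1) \<in> sobolev 1 gauss"
    unfolding sobolev_def using w1 I1 I2 by auto
  have wd1: "AE x in lborel. weak_deriv (\<lambda>x. f x - 1) x = 2 * U x * s x"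
    by (rule weak_deriv_primitive[OF P1 m2 f1])
  have wdf: "AE x in lborel. weak_deriv f x = 2 * U x * s x"
    by (rule weak_deriv_primitive[OF P2 m2 f])
  have "AE x in lborel. \<bar>weak_deriv f x\<bar>\<^sup>2 / f x = 4 * (s x)\<^sup>2"
    using wdf f by eventually_elim (auto simp: s_def power2_eq_square)
  then have "(\<integral>x. \<bar>weak_deriv f x\<bar>\<^sup>2 / f x \<partial>gauss) = (LBINT x. \<phi> x * (4 * (s x)\<^sup>2))"
    by (rule integral_gauss(1)) measurable
  also have "\<dots> = 4 * (LBINT x. \<phi> x * (s x)\<^sup>2)"
    by (subst integral_mult_right_zero[symmetric]) (simp add: mult_ac)
  finally have fisher: "(\<integral>x. \<bar>weak_deriv f x\<bar>\<^sup>2 / f x \<partial>gauss) = 4 * (LBINT x. \<phi> x * (s x)\<^sup>2)" .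
  have "AE x in lborel. f x * ln (f x) = (U x)\<^sup>2 * ln ((U x)\<^sup>2)" using f by eventually_elim simp
  then have ent: "(\<integral>x. f x * ln (f x) \<partial>gauss) = (LBINT x. \<phi> x * ((U x)\<^sup>2 * ln ((U x)\<^sup>2)))"
    by (rule integral_gauss(1)) measurable
  have D: "deficit f = D" unfolding deficit_def fisher ent D_eq by simp
  have "(\<integral>x. \<bar>f x - 1\<bar> \<partial>gauss) = (LBINT x. \<phi> x * \<bar>(U x)\<^sup>2 - 1\<bar>)"
    by (rule integral_gauss(1)[OF f1a]) measurable
  moreover have "AE x in lborel. \<bar>weak_deriv (\<lambda>x. f x - 1) x\<bar> = \<bar>2 * U x * s x\<bar>"
    using wd1 by eventually_elim simp
  then have "(\<integral>x. \<bar>weak_deriv (\<lambda>x. f x - 1) x\<bar> \<partial>gauss) = (LBINT x. \<phi> x * \<bar>2 * U x * s x\<bar>)"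
    by (rule integral_gauss(1)) measurable
  ultimately have "W11_norm gauss (\<lambda>x. f x - 1) \<le> sqrt (2 * pi) * (gradient_const * sqrt D) + gradient_const * sqrt D"
    unfolding W11_norm_def using density_L1_bound density_gradient_bound by linarith
  also have "\<dots> = (1 + sqrt (2 * pi)) * gradient_const * sqrt D" by (simp add: algebra_simps)
  also have "\<dots> \<le> (1 + sqrt (2 * pi)) * gradient_const * (D powr (1/4) + D powr (3/4))"
    by (rule mult_left_mono[OF sqrt_le_powr[OF D_nonneg]]) (use gradient_const_nonneg in auto)
  finally show "W11_norm gauss (\<lambda>x. f x - 1) \<le>
      (1 + sqrt (2 * pi)) * (sqrt 2 + (32 + 16 * sqrt (2 + 2 * \<alpha>)) * sqrt pi)
        * (deficit f powr (1/4) + deficit f powr (3/4))"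
    unfolding D gradient_const_def M_def .
qed

lemma gauss_pi_weight: "exp (- pi * x\<^sup>2) = sqrt (2 * pi) * \<phi> (sqrt (2 * pi) * x)"
  by (simp add: std_normal_density_def power_mult_distrib)

text \<open>
  The substitution \<open>y = sqrt (2 pi) x\<close> turns the weight \<open>exp (- pi x\<^sup>2)\<close> into the standard Gaussian density.
\<close>

lemma integral_gauss_pi:
  fixes g g' :: "real \<Rightarrow> real"
  assumes g: "AE x in lborel. g x = g' x" and g': "g' \<in> borel_measurable borel"
  shows "(\<integral>x. g x \<partial>gauss_pi) = (LBINT y. \<phi> y * g' (y / sqrt (2 * pi)))"
    and "integrable gauss_pi g \<longleftrightarrow> integrable lborel (\<lambda>y. \<phi> y * g' (y / sqrt (2 * pi)))"
proof -
  let ?c = "sqrt (2 * pi)"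
  have w: "(\<lambda>x. exp (- pi * x\<^sup>2)) \<in> borel_measurable borel" by measurable
  note W = integral_weighted_lebesgue[OF w _ g g', folded gauss_pi_def]
  have c: "?c \<noteq> 0" "?c > 0" by auto
  have "(LBINT y. \<phi> y * g' (y / ?c)) = ?c * (LBINT x. \<phi> (?c * x) * g' x)"
    using lborel_integral_real_affine[OF c(1), of "\<lambda>y. \<phi> y * g' (y / ?c)" 0] c by simp
  then show "(\<integral>x. g x \<partial>gauss_pi) = (LBINT y. \<phi> y * g' (y / ?c))"
    unfolding W(1)[OF exp_gt_zero] gauss_pi_weight mult.assoc by simp
  have "integrable lborel (\<lambda>y. \<phi> y * g' (y / ?c)) \<longleftrightarrow> integrable lborel (\<lambda>x. \<phi> (?c * x) * g' x)"
    using lborel_integrable_real_affine_iff[OF c(1), of "\<lambda>y. \<phi> y * g' (y / ?c)" 0] c by simp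
  then show "integrable gauss_pi g \<longleftrightarrow> integrable lborel (\<lambda>y. \<phi> y * g' (y / ?c))"
    unfolding W(2)[OF exp_gt_zero] gauss_pi_weight mult.assoc using c by simp
qed

lemma nn_integral_gauss_pi:
  fixes g g' :: "real \<Rightarrow> real"
  assumes g: "AE x in lborel. g x = g' x" and g': "g' \<in> borel_measurable borel" "\<And>x. 0 \<le> g' x"
  shows "(\<integral>\<^sup>+x. ennreal (g x) \<partial>gauss_pi) = (\<integral>\<^sup>+y. ennreal (\<phi> y * g' (y / sqrt (2 * pi))) \<partial>lborel)"
proof -
  let ?c = "sqrt (2 * pi)"
  have w: "(\<lambda>x. exp (- pi * x\<^sup>2)) \<in> borel_measurable borel" by measurable
  have c: "?c \<noteq> 0" "?c > 0" by auto
  have m: "(\<lambda>y. ennreal (\<phi> y * g' (y / ?c))) \<in> borel_measurable borel" using g'(1) by measurable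
  have m2: "(\<lambda>x. ennreal (\<phi> (?c * x) * g' x)) \<in> borel_measurable lborel" using g'(1) by measurable
  have "(\<integral>\<^sup>+y. ennreal (\<phi> y * g' (y / ?c)) \<partial>lborel) = ennreal ?c * (\<integral>\<^sup>+x. ennreal (\<phi> (?c * x) * g' x) \<partial>lborel)"
    using nn_integral_real_affine[OF m c(1), of 0] c by simp
  also have "\<dots> = (\<integral>\<^sup>+x. ennreal (exp (- pi * x\<^sup>2) * g' x) \<partial>lborel)"
    unfolding nn_integral_cmult[OF m2, symmetric] gauss_pi_weight
    by (intro nn_integral_cong) (simp add: ennreal_mult'[symmetric] mult.assoc)
  also have "\<dots> = (\<integral>\<^sup>+x. ennreal (g x) \<partial>gauss_pi)"
    using nn_integral_weighted_lebesgue[OF w exp_gt_zero g g', folded gauss_pi_def] by simp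
  finally show ?thesis by simp
qed

lemma AE_gauss_pi: "(AE x in gauss_pi. Q x) \<longleftrightarrow> (AE x in lborel. Q x)"
  unfolding gauss_pi_def by (rule AE_weighted_lebesgue) auto

text \<open>
  In the variable \<open>y = sqrt (2 pi) x\<close> the deficit becomes that of the standard Gaussian setting, the second moment
  is multiplied by \<open>2 pi\<close>, and the gradient gains a factor \<open>sqrt (2 pi)\<close>.
\<close>

lemma W11_stability_root:
  fixes u :: "real \<Rightarrow> real"
  assumes \<alpha>: "0 < \<alpha>" and nonneg: "AE x in gauss_pi. 0 \<le> u x"
    and sob: "u \<in> sobolev 2 gauss_pi"
    and mass: "(\<integral>x. \<bar>u x\<bar>\<^sup>2 \<partial>gauss_pi) = 1" and centered: "(\<integral>x. x * \<bar>u x\<bar>\<^sup>2 \<partial>gauss_pi) = 0"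
    and moment: "(\<integral>\<^sup>+x. ennreal (\<bar>x\<bar>\<^sup>2 * \<bar>u x\<bar>\<^sup>2) \<partial>gauss_pi) \<le> ennreal \<alpha>"
    and M': "M' = sqrt (2 + 2 * (2 * pi * \<alpha>))"
    and c': "c' = sqrt 2 + (32 + 16 * M') * sqrt pi"
  shows "(\<lambda>x. u x - 1) \<in> sobolev 1 gauss_pi"
    and "W11_norm gauss_pi (\<lambda>x. u x - 1) \<le>
      sqrt (2 * pi) * (2 * c' + M' * sqrt (sqrt (2 * pi) * c')) * (deficit_star u powr (1/4) + deficit_star u)"
proof -
  let ?c = "sqrt (2 * pi)"
  have c: "?c > 0" "?c \<noteq> 0" "?c\<^sup>2 = 2 * pi" by auto
  obtain h where wd: "has_weak_deriv u h" and I: "integrable gauss_pi (\<lambda>x. \<bar>u x\<bar> ^ 2)" "integrable gauss_pi (\<lambda>x. \<bar>h x\<bar> ^ 2)"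
    using sob unfolding sobolev_def by blast
  from has_weak_deriv_imp_primitive[OF wd] obtain V H where
    VH: "H \<in> borel_measurable borel \<and> (\<forall>a b. primitive_on a b V H) \<and> (AE x in lborel. u x = V x) \<and> (AE x in lborel. h x = H x)"
    by (elim exE)
  then have [measurable]: "H \<in> borel_measurable borel" and P: "\<And>a b. primitive_on a b V H"
    and uV: "AE x in lborel. u x = V x" and hH: "AE x in lborel. h x = H x" by simp_all
  have Vc: "continuous_on UNIV V" using P by (rule primitive_on_continuous_UNIV)
  then have [measurable]: "V \<in> borel_measurable borel" by (rule borel_measurable_continuous_onI)
  have u0: "AE x in lborel. 0 \<le> u x" using nonneg by (simp only: AE_gauss_pi)
  have "AE x in lborel. 0 \<le> V x" using uV u0 by eventually_elim simp
  then have V0: "0 \<le> V x" for x by (rule continuous_AE_nonneg[OF Vc])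
  define U where "U y = V (y / ?c)" for y
  define s where "s y = H (y / ?c) / ?c" for y
  have [measurable]: "U \<in> borel_measurable borel" "s \<in> borel_measurable borel" unfolding U_def s_def by measurable
  have Hs: "H (y / ?c) = ?c * s y" for y by (simp add: s_def)
  have PU: "primitive_on a b U s" for a b
    using primitive_on_affine[OF P, of "1 / ?c" a b] by (simp add: U_def[abs_def] s_def[abs_def])
  have Uc: "continuous_on UNIV U" using PU by (rule primitive_on_continuous_UNIV)
  have u2: "AE x in lborel. \<bar>u x\<bar>\<^sup>2 = (V x)\<^sup>2" using uV by eventually_elim simp
  have V2m: "(\<lambda>x. (V x)\<^sup>2) \<in> borel_measurable borel" by measurable
  have U2I: "integrable lborel (\<lambda>y. \<phi> y * (U y)\<^sup>2)"
    using I(1) unfolding integral_gauss_pi(2)[OF u2 V2m] by (simp add: U_def)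
  have "AE x in lborel. \<bar>h x\<bar>\<^sup>2 = (H x)\<^sup>2" using hH by eventually_elim simp
  from integral_gauss_pi(2)[OF this] I(2) have "integrable lborel (\<lambda>y. \<phi> y * (?c * s y)\<^sup>2)" by (simp add: Hs)
  then have "integrable lborel (\<lambda>y. 1 / (2 * pi) * (\<phi> y * (?c * s y)\<^sup>2))" by (rule integrable_mult_right)
  moreover have "(\<lambda>y. 1 / (2 * pi) * (\<phi> y * (?c * s y)\<^sup>2)) = (\<lambda>y. \<phi> y * (s y)\<^sup>2)"
    by (auto simp: power_mult_distrib)
  ultimately have s2I: "integrable lborel (\<lambda>y. \<phi> y * (s y)\<^sup>2)" by simp
  have massU: "(LBINT y. \<phi> y * (U y)\<^sup>2) = 1"
    using mass unfolding integral_gauss_pi(1)[OF u2 V2m] by (simp add: U_def)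
  have "AE x in lborel. x * \<bar>u x\<bar>\<^sup>2 = x * (V x)\<^sup>2" using u2 by eventually_elim simp
  from integral_gauss_pi(1)[OF this] centered have "(LBINT y. \<phi> y * (y / ?c * (U y)\<^sup>2)) = 0" by (simp add: U_def)
  then have centeredU: "(LBINT y. y * (\<phi> y * (U y)\<^sup>2)) = 0" by (simp add: mult.left_commute)
  have xa: "AE x in lborel. \<bar>x\<bar>\<^sup>2 * \<bar>u x\<bar>\<^sup>2 = (x * V x)\<^sup>2" using u2 by eventually_elim (simp add: power_mult_distrib)
  have "(\<integral>\<^sup>+x. ennreal (\<bar>x\<bar>\<^sup>2 * \<bar>u x\<bar>\<^sup>2) \<partial>gauss_pi) = (\<integral>\<^sup>+y. ennreal (\<phi> y * (y / ?c * V (y / ?c))\<^sup>2) \<partial>lborel)"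
    by (rule nn_integral_gauss_pi[OF xa]) auto
  then have nn: "(\<integral>\<^sup>+y. ennreal (\<phi> y * (y / ?c * U y)\<^sup>2) \<partial>lborel) \<le> ennreal \<alpha>" using moment by (simp add: U_def)
  have xm: "(\<lambda>y. \<phi> y * (y / ?c * U y)\<^sup>2) \<in> borel_measurable borel" by measurable
  have x0: "0 \<le> \<phi> y * (y / ?c * U y)\<^sup>2" for y by (simp add: phi_nonneg)
  note xI = integrable_if_nn_integral_le[OF xm x0 nn less_imp_le[OF \<alpha>]]
  have xe: "(\<lambda>y. \<phi> y * (y * U y)\<^sup>2) = (\<lambda>y. 2 * pi * (\<phi> y * (y / ?c * U y)\<^sup>2))"
    by (auto simp: power_mult_distrib power_divide)
  interpret gaussian_transport U s "2 * pi * \<alpha>"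
  proof
    show "integrable lborel (\<lambda>y. \<phi> y * (y * U y)\<^sup>2)" "(LBINT y. \<phi> y * (y * U y)\<^sup>2) \<le> 2 * pi * \<alpha>"
      unfolding xe using xI by auto
    show "s \<in> borel_measurable borel" by measurable
    show "primitive_on a b (\<lambda>x. (U x)\<^sup>2) (\<lambda>x. 2 * U x * s x)" for a b by (rule primitive_on_square[OF PU])
    show "0 \<le> U x" for x by (simp add: U_def V0)
  qed (fact Uc U2I massU centeredU s2I)+
  have P1: "primitive_on a b (\<lambda>x. V x - 1) H" for a b by (rule primitive_on_minus_const[OF P])
  have Hm: "H \<in> borel_measurable borel" by measurable
  have u1: "AE x in lborel. u x - 1 = V x - 1" using uV by eventually_elim simp
  have u1a: "AE x in lborel. \<bar>u x - 1\<bar> = \<bar>V x - 1\<bar>" using uV by eventually_elim simp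
  have u1m: "(\<lambda>x. \<bar>V x - 1\<bar>) \<in> borel_measurable borel" by measurable
  have Ham: "(\<lambda>x. \<bar>H x\<bar>) \<in> borel_measurable borel" by measurable
  have w1: "has_weak_deriv (\<lambda>x. u x - 1) H"
    by (rule primitive_imp_has_weak_deriv[OF P1 Hm u1]) simp
  have I1: "integrable gauss_pi (\<lambda>x. \<bar>u x - 1\<bar>)"
    unfolding integral_gauss_pi(2)[OF u1a u1m] using int_phi_root by (simp add: U_def)
  have I2: "integrable gauss_pi (\<lambda>x. \<bar>H x\<bar>)"
  proof -
    have "(\<lambda>y. \<phi> y * \<bar>?c * s y\<bar>) = (\<lambda>y. ?c * (\<phi> y * \<bar>s y\<bar>))" by (auto simp: abs_mult)
    then show ?thesis
      unfolding integral_gauss_pi(2)[OF AE_I2[OF refl] Ham] Hs using integrable_mult_right[OF int_phi_s, of ?c] by metis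
  qed
  show "(\<lambda>x. u x - 1) \<in> sobolev 1 gauss_pi"
    unfolding sobolev_def using w1 I1 I2 by auto
  have wd1: "AE x in lborel. \<bar>weak_deriv (\<lambda>x. u x - 1) x\<bar> = \<bar>H x\<bar>"
    using weak_deriv_primitive[OF P1 Hm u1] by eventually_elim simp
  have wdu: "AE x in lborel. \<bar>weak_deriv u x\<bar>\<^sup>2 = (H x)\<^sup>2"
    using weak_deriv_primitive[OF P Hm uV] by eventually_elim simp
  have "(\<integral>x. \<bar>weak_deriv u x\<bar>\<^sup>2 \<partial>gauss_pi) = (LBINT y. \<phi> y * (?c * s y)\<^sup>2)"
    unfolding Hs[symmetric] by (rule integral_gauss_pi(1)[OF wdu]) measurable
  also have "\<dots> = (LBINT y. 2 * pi * (\<phi> y * (s y)\<^sup>2))"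
    by (rule Bochner_Integration.integral_cong) (simp_all add: power_mult_distrib)
  also have "\<dots> = 2 * pi * (LBINT y. \<phi> y * (s y)\<^sup>2)" by (rule integral_mult_right_zero)
  finally have fisher: "(\<integral>x. \<bar>weak_deriv u x\<bar>\<^sup>2 \<partial>gauss_pi) = 2 * pi * (LBINT y. \<phi> y * (s y)\<^sup>2)" .
  have "AE x in lborel. \<bar>u x\<bar>\<^sup>2 * ln (\<bar>u x\<bar>\<^sup>2) = (V x)\<^sup>2 * ln ((V x)\<^sup>2)" using u2 by eventually_elim simp
  then have ent: "(\<integral>x. \<bar>u x\<bar>\<^sup>2 * ln (\<bar>u x\<bar>\<^sup>2) \<partial>gauss_pi) = (LBINT y. \<phi> y * ((U y)\<^sup>2 * ln ((U y)\<^sup>2)))"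
    unfolding U_def by (rule integral_gauss_pi(1)) measurable
  have D: "deficit_star u = D" unfolding deficit_star_def fisher ent D_eq by (simp add: right_diff_distrib)
  have n1: "(\<integral>x. \<bar>u x - 1\<bar> \<partial>gauss_pi) = (LBINT y. \<phi> y * \<bar>U y - 1\<bar>)"
    unfolding U_def by (rule integral_gauss_pi(1)[OF u1a u1m])
  have "(\<integral>x. \<bar>weak_deriv (\<lambda>x. u x - 1) x\<bar> \<partial>gauss_pi) = (LBINT y. \<phi> y * \<bar>?c * s y\<bar>)"
    unfolding Hs[symmetric] by (rule integral_gauss_pi(1)[OF wd1 Ham])
  also have "\<dots> = (LBINT y. ?c * (\<phi> y * \<bar>s y\<bar>))"
    by (rule Bochner_Integration.integral_cong) (simp_all add: abs_mult)
  also have "\<dots> = ?c * (LBINT y. \<phi> y * \<bar>s y\<bar>)" by (rule integral_mult_right_zero)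
  finally have n2: "(\<integral>x. \<bar>weak_deriv (\<lambda>x. u x - 1) x\<bar> \<partial>gauss_pi) = ?c * (LBINT y. \<phi> y * \<bar>s y\<bar>)" .
  have Mc: "M' = M" "c' = gradient_const" by (simp_all add: M' c' M_def gradient_const_def)
  have "W11_norm gauss_pi (\<lambda>x. u x - 1) \<le> ?c * (gradient_const * sqrt D) + ?c * (gradient_const * sqrt D + M * sqrt (?c * (gradient_const * sqrt D)))"
    unfolding W11_norm_def n1 n2 by (intro add_mono root_L1_bound mult_left_mono root_gradient_bound) simp
  also have "sqrt (?c * (gradient_const * sqrt D)) = sqrt (?c * gradient_const) * D powr (1/4)"
  proof -
    have "sqrt (sqrt D) = D powr (1/4)"
      using D_nonneg by (simp add: powr_half_sqrt[symmetric] powr_powr)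
    then show ?thesis by (simp add: real_sqrt_mult mult.assoc)
  qed
  also have "?c * (gradient_const * sqrt D) + ?c * (gradient_const * sqrt D + M * (sqrt (?c * gradient_const) * D powr (1/4)))
      = ?c * (2 * gradient_const * sqrt D + M * sqrt (?c * gradient_const) * D powr (1/4))" by (simp add: algebra_simps)
  also have "\<dots> \<le> ?c * (2 * gradient_const * (D powr (1/4) + D) + M * sqrt (?c * gradient_const) * (D powr (1/4) + D))"
  proof (intro mult_left_mono add_mono)
    show "sqrt D \<le> D powr (1/4) + D" using sqrt_le_powr[OF D_nonneg, of 1] D_nonneg by simp
  qed (use gradient_const_nonneg M_nonneg D_nonneg in auto)
  finally show "W11_norm gauss_pi (\<lambda>x. u x - 1) \<le>
      ?c * (2 * c' + M' * sqrt (?c * c')) * (deficit_star u powr (1/4) + deficit_star u)"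
    unfolding D Mc by (simp only: distrib_right mult.assoc)
qed

theorem theorem1p1:
  shows "(\<forall>\<alpha>::real. \<alpha> > 0 \<longrightarrow> (\<exists>a::real. a > 0 \<and>
      (\<forall>f::real \<Rightarrow> real.
         (AE x in gauss. 0 \<le> f x) \<and>
         (\<lambda>x. sqrt (f x)) \<in> sobolev 2 gauss \<and>
         (\<integral>x. f x \<partial>gauss) = 1 \<and>
         (\<integral>x. x * f x \<partial>gauss) = 0 \<and>
         (\<integral>\<^sup>+x. ennreal (\<bar>x\<bar>\<^sup>2 * f x) \<partial>gauss) \<le> ennreal \<alpha>
         \<longrightarrow> (\<lambda>x. f x - 1) \<in> sobolev 1 gauss \<and>
             W11_norm gauss (\<lambda>x. f x - 1)
               \<le> a * (deficit f powr (1/4) + deficit f powr (3/4)))))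
   \<and>
   (\<forall>\<alpha>::real. \<alpha> > 0 \<longrightarrow> (\<exists>a::real. a > 0 \<and>
      (\<forall>u::real \<Rightarrow> real.
         (AE x in gauss_pi. 0 \<le> u x) \<and>
         u \<in> sobolev 2 gauss_pi \<and>
         (\<integral>x. \<bar>u x\<bar>\<^sup>2 \<partial>gauss_pi) = 1 \<and>
         (\<integral>x. x * \<bar>u x\<bar>\<^sup>2 \<partial>gauss_pi) = 0 \<and>
         (\<integral>\<^sup>+x. ennreal (\<bar>x\<bar>\<^sup>2 * \<bar>u x\<bar>\<^sup>2) \<partial>gauss_pi) \<le> ennreal \<alpha>
         \<longrightarrow> (\<lambda>x. u x - 1) \<in> sobolev 1 gauss_pi \<and>
             W11_norm gauss_pi (\<lambda>x. u x - 1)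
               \<le> a * (deficit_star u powr (1/4) + deficit_star u))))"
proof (intro conjI allI impI, goal_cases)
  case (1 \<alpha>)
  let ?a = "(1 + sqrt (2 * pi)) * (sqrt 2 + (32 + 16 * sqrt (2 + 2 * \<alpha>)) * sqrt pi)"
  show ?case
  proof (intro exI[of _ ?a] conjI allI impI)
    have "0 \<le> (32 + 16 * sqrt (2 + 2 * \<alpha>)) * sqrt pi" using 1 by simp
    then have "0 < sqrt 2 + (32 + 16 * sqrt (2 + 2 * \<alpha>)) * sqrt pi" by (simp add: add_pos_nonneg)
    moreover have "0 < 1 + sqrt (2 * pi)" by (simp add: add_pos_nonneg)
    ultimately show "0 < ?a" by simp
  qed (elim conjE, rule W11_stability_density[OF 1], assumption+)+
next
  case (2 \<alpha>)
  define M' where "M' = sqrt (2 + 2 * (2 * pi * \<alpha>))"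
  define c' where "c' = sqrt 2 + (32 + 16 * M') * sqrt pi"
  let ?a = "sqrt (2 * pi) * (2 * c' + M' * sqrt (sqrt (2 * pi) * c'))"
  show ?case
  proof (intro exI[of _ ?a] conjI allI impI)
    have M0: "0 \<le> M'" using 2 by (simp add: M'_def)
    then have "0 \<le> (32 + 16 * M') * sqrt pi" by simp
    then have c0: "0 < c'" unfolding c'_def by (simp add: add_pos_nonneg)
    then have "0 < 2 * c' + M' * sqrt (sqrt (2 * pi) * c')" using M0 by (intro add_pos_nonneg) auto
    then show "0 < ?a" by simp
  qed (elim conjE, rule W11_stability_root[OF 2 _ _ _ _ _ M'_def c'_def], assumption+)+
qed

end
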